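(* Let $\tilde\mu,\kappa>0$ and $0<\mathcal{T}_-<\mathcal{T}_+$ with $\delta=|\mathcal{T}_+-\mathcal{T}_-|\le\delta_0$, where $\delta_0,\varepsilon_0$ are the constants described in the context, and for $0<\varepsilon\le\varepsilon_0$ let $(v^\varepsilon,u^\varepsilon,\mathcal{T}^\varepsilon)$ be the unique global smooth solution of the Cauchy problem described in the context. Let $\eta_0>0$ be given and let $c_{\eta_0}>0$ be a constant such that $\hat{\mathcal{T}}'(\eta)>c_{\eta_0}\delta>0$ for $|\eta|\le\eta_0$. Then there exist a small positive constant $\varepsilon_1=\varepsilon_1(\eta_0)\le\varepsilon_0$ and a suitably large positive constant $C_1$ depending only on $\mathcal{T}_\pm$ such that, if $\varepsilon\le\varepsilon_1$, then $$\begin{cases}0<\dfrac{c_{\eta_0}\delta}{C_1\sqrt{1+t}}<\dfrac1{C_1}\hat{\mathcal{T}}_x\le u^\varepsilon(x,t)\le C_1\hat{\mathcal{T}}_x,\\[2mm] 0<\dfrac12\hat{\mathcal{T}}_x\le\mathcal{T}^\varepsilon_x(x,t)\le\dfrac32\hat{\mathcal{T}}_x,\end{cases}\qquad\text{for }|x|\le\eta_0(1+t)^{\frac12},\ t\ge0,$$ and consequently $$\frac{2}{3C_1}\mathcal{T}^\varepsilon_x(x,t)\le u^\varepsilon(x,t)\le 2C_1\mathcal{T}^\varepsilon_x(x,t),\qquad\text{for }|x|\le\eta_0(1+t)^{\frac12},\ t\ge0.$$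
   Context: The system is $$\begin{cases} v^\varepsilon_t-u^\varepsilon_x=0,\\ u^\varepsilon_t+\frac1{\varepsilon^2}P^\varepsilon_x=\tilde\mu\left(\frac{u^\varepsilon_x}{v^\varepsilon}\right)_x,\\ \left(\mathcal{T}^\varepsilon+\frac12|\varepsilon u^\varepsilon|^2\right)_t+(P^\varepsilon u^\varepsilon)_x=\kappa\left(\frac{1}{v^\varepsilon}\mathcal{T}^\varepsilon_x\right)_x+\varepsilon^2\left(\frac{\tilde\mu}{v^\varepsilon}u^\varepsilon u^\varepsilon_x\right)_x,\end{cases}\qquad P^\varepsilon=\frac{\mathcal{T}^\varepsilon}{v^\varepsilon},\quad x\in\mathbb{R},\ t>0,$$ where $\tilde\mu,\kappa>0$ are fixed physical constants. $\hat{\mathcal{T}}(\eta)$, $\eta=\frac{x}{\sqrt{1+t}}$, is the unique self-similar solution of $\mathcal{T}_t=\left(\frac{\kappa\mathcal{T}_x}{2\mathcal{T}}\right)_x$ with $\lim_{x\to\pm\infty}\mathcal{T}=\mathcal{T}_\pm$; $\hat{\mathcal{T}}'$ is the derivative in $\eta$ and $\hat{\mathcal{T}}_x$ the $x$-derivative of $\hat{\mathcal{T}}(x/\sqrt{1+t})$. The profile is $(\tilde v,\tilde u,\tilde{\mathcal{T}})=\left(\hat{\mathcal{T}},\frac{\kappa\hat{\mathcal{T}}_x}{2\hat{\mathcal{T}}},\hat{\mathcal{T}}-\frac12|\varepsilon\tilde u|^2\right)$. The positive constants $\delta_0,\varepsilon_0$ are such that for $\delta\le\delta_0$, $\varepsilon\le\varepsilon_0$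 the Cauchy problem with initial data $(v^\varepsilon,u^\varepsilon,\mathcal{T}^\varepsilon)|_{t=0}=(\tilde v,\tilde u,\tilde{\mathcal{T}})(x,0)$ has a unique global smooth solution satisfying, with constants $C,C_0>0$ independent of $\varepsilon,\delta$ and for all $t\ge0$: $\|(v^\varepsilon-\tilde v,\varepsilon u^\varepsilon-\varepsilon\tilde u,\mathcal{T}^\varepsilon-\tilde{\mathcal{T}})(t)\|^2_{L^2_x}\le C\sqrt\delta\varepsilon^3(1+t)^{-1+C_0\sqrt\delta}$ and $\|(v^\varepsilon-\tilde v,\varepsilon u^\varepsilon-\varepsilon\tilde u,\mathcal{T}^\varepsilon-\tilde{\mathcal{T}})_x(t)\|^2_{L^2_x}\le C\sqrt\delta\varepsilon^2(1+t)^{-\frac32+C_0\sqrt\delta}$, as well as $\|(v^\varepsilon-\hat{\mathcal{T}},\mathcal{T}^\varepsilon-\hat{\mathcal{T}})(t)\|_{L^\infty}\le C\delta^{\frac14}\varepsilon^{\frac54}(1+t)^{-\frac12}$ and $\|(u^\varepsilon-\tilde u)(t)\|_{L^\infty}\le C\delta^{\frac14}\varepsilon^{\frac14}(1+t)^{-\frac12}$. *)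

theory Defs
  imports "HOL-Analysis.Analysis"
begin

text \<open>
  Functions of space and time are curried, \<open>f x t\<close>, with \<open>x\<close> real and \<open>t \<ge> 0\<close>.
  Their values at negative times carry no meaning.
\<close>

type_synonym spacetime_fun = "real \<Rightarrow> real \<Rightarrow> real"

definition dx :: "spacetime_fun \<Rightarrow> spacetime_fun" where
  "dx f = (\<lambda>x t. deriv (\<lambda>y. f y t) x)"

definition dt :: "spacetime_fun \<Rightarrow> spacetime_fun" where
  "dt f = (\<lambda>x t. deriv (\<lambda>s. f x s) t)"

text \<open>
  \<open>Ck_halfplane n f\<close>: \<open>f\<close> is \<open>n\<close> times continuously differentiable on the closed half
  plane \<open>t \<ge> 0\<close>, time derivatives at \<open>t = 0\<close> being one-sided.
\<close>

primrec Ck_halfplane :: "nat \<Rightarrow> spacetime_fun \<Rightarrow> bool" where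
  "Ck_halfplane 0 f = continuous_on (UNIV \<times> {0..}) (\<lambda>(x, t). f x t)"
| "Ck_halfplane (Suc n) f =
    (\<exists>fx ft.
      (\<forall>x. \<forall>t\<ge>0. ((\<lambda>y. f y t) has_real_derivative fx x t) (at x) \<and>
                 ((\<lambda>s. f x s) has_real_derivative ft x t) (at t within {0..})) \<and>
      Ck_halfplane n fx \<and> Ck_halfplane n ft)"

definition smooth_halfplane :: "spacetime_fun \<Rightarrow> bool" where
  "smooth_halfplane f \<longleftrightarrow> (\<forall>n. Ck_halfplane n f)"

text \<open>
  Square of the \<open>L\<^sup>2(\<real>)\<close> norm of a vector-valued function, with value \<open>\<infinity>\<close> if the function
  is not square integrable.  On tuples of reals, \<open>norm\<close> is the Euclidean norm.
\<close>

definition L2_norm_sq :: "(real \<Rightarrow> 'a::real_normed_vector) \<Rightarrow> ennreal" where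
  "L2_norm_sq f = (\<integral>\<^sup>+ x. ennreal ((norm (f x))\<^sup>2) \<partial>lborel)"

definition self_similar :: "(real \<Rightarrow> real) \<Rightarrow> spacetime_fun" where
  "self_similar That = (\<lambda>x t. That (x / sqrt (1 + t)))"

text \<open>
  \<open>That\<close>, as a function of \<open>\<eta>\<close>, is the profile of the self-similar solution of
  \<open>T\<^sub>t = (\<kappa> T\<^sub>x / (2 T))\<^sub>x\<close> with limits \<open>Tm\<close> and \<open>Tp\<close> at \<open>-\<infinity>\<close> and \<open>+\<infinity>\<close>.
\<close>

definition diffusion_profile :: "real \<Rightarrow> real \<Rightarrow> real \<Rightarrow> (real \<Rightarrow> real) \<Rightarrow> bool" where
  "diffusion_profile \<kappa> Tm Tp That \<longleftrightarrow>
     (\<forall>n. (deriv ^^ n) That differentiable_on UNIV) \<and>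
     (\<forall>\<eta>. That \<eta> > 0) \<and>
     (let T = self_similar That in
        \<forall>x. \<forall>t>0. dt T x t = dx (\<lambda>x t. \<kappa> * dx T x t / (2 * T x t)) x t) \<and>
     (That \<longlongrightarrow> Tm) at_bot \<and> (That \<longlongrightarrow> Tp) at_top"

definition v_profile :: "(real \<Rightarrow> real) \<Rightarrow> spacetime_fun" where
  "v_profile That = self_similar That"

definition u_profile :: "real \<Rightarrow> (real \<Rightarrow> real) \<Rightarrow> spacetime_fun" where
  "u_profile \<kappa> That =
     (\<lambda>x t. \<kappa> * dx (self_similar That) x t / (2 * self_similar That x t))"

definition T_profile :: "real \<Rightarrow> real \<Rightarrow> (real \<Rightarrow> real) \<Rightarrow> spacetime_fun" where
  "T_profile \<kappa> \<epsilon> That =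
     (\<lambda>x t. self_similar That x t - 1/2 * \<bar>\<epsilon> * u_profile \<kappa> That x t\<bar>\<^sup>2)"

definition low_mach_system ::
  "real \<Rightarrow> real \<Rightarrow> real \<Rightarrow> spacetime_fun \<Rightarrow> spacetime_fun \<Rightarrow> spacetime_fun \<Rightarrow> bool" where
  "low_mach_system \<mu> \<kappa> \<epsilon> v u T \<longleftrightarrow>
     (let P = (\<lambda>x t. T x t / v x t) in
      \<forall>x. \<forall>t>0.
        dt v x t - dx u x t = 0 \<and>
        dt u x t + 1 / \<epsilon>\<^sup>2 * dx P x t = \<mu> * dx (\<lambda>x t. dx u x t / v x t) x t \<and>
        dt (\<lambda>x t. T x t + 1/2 * \<bar>\<epsilon> * u x t\<bar>\<^sup>2) x t + dx (\<lambda>x t. P x t * u x t) x t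
          = \<kappa> * dx (\<lambda>x t. 1 / v x t * dx T x t) x t
            + \<epsilon>\<^sup>2 * dx (\<lambda>x t. \<mu> / v x t * u x t * dx u x t) x t)"

definition perturbation_norm_sq ::
  "real \<Rightarrow> real \<Rightarrow> (real \<Rightarrow> real) \<Rightarrow> spacetime_fun \<Rightarrow> spacetime_fun \<Rightarrow> spacetime_fun
    \<Rightarrow> real \<Rightarrow> ennreal" where
  "perturbation_norm_sq \<kappa> \<epsilon> That v u T t =
     L2_norm_sq (\<lambda>x.
       (v x t - v_profile That x t,
        \<epsilon> * u x t - \<epsilon> * u_profile \<kappa> That x t,
        T x t - T_profile \<kappa> \<epsilon> That x t))"

definition perturbation_dx_norm_sq ::
  "real \<Rightarrow> real \<Rightarrow> (real \<Rightarrow> real) \<Rightarrow> spacetime_fun \<Rightarrow> spacetime_fun \<Rightarrow> spacetime_fun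
    \<Rightarrow> real \<Rightarrow> ennreal" where
  "perturbation_dx_norm_sq \<kappa> \<epsilon> That v u T t =
     L2_norm_sq (\<lambda>x.
       (dx (\<lambda>x t. v x t - v_profile That x t) x t,
        dx (\<lambda>x t. \<epsilon> * u x t - \<epsilon> * u_profile \<kappa> That x t) x t,
        dx (\<lambda>x t. T x t - T_profile \<kappa> \<epsilon> That x t) x t))"

text \<open>
  Uniqueness of smooth solutions of the Cauchy problem on the whole line needs control at
  \<open>x = \<plusminus>\<infinity>\<close>.  The last conjunct provides it: the perturbation of the profile is bounded in
  \<open>H\<^sup>1(\<real>)\<close>, locally uniformly in time.
\<close>

definition global_smooth_solution ::
  "real \<Rightarrow> real \<Rightarrow> real \<Rightarrow> (real \<Rightarrow> real)
    \<Rightarrow> spacetime_fun \<Rightarrow> spacetime_fun \<Rightarrow> spacetime_fun \<Rightarrow> bool" where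
  "global_smooth_solution \<mu> \<kappa> \<epsilon> That v u T \<longleftrightarrow>
     smooth_halfplane v \<and> smooth_halfplane u \<and> smooth_halfplane T \<and>
     (\<forall>x. \<forall>t\<ge>0. v x t > 0) \<and>
     low_mach_system \<mu> \<kappa> \<epsilon> v u T \<and>
     (\<forall>x. v x 0 = v_profile That x 0 \<and>
          u x 0 = u_profile \<kappa> That x 0 \<and>
          T x 0 = T_profile \<kappa> \<epsilon> That x 0) \<and>
     (\<forall>\<tau>\<ge>0. \<exists>B. \<forall>t\<in>{0..\<tau>}.
        perturbation_norm_sq \<kappa> \<epsilon> That v u T t \<le> ennreal B \<and>
        perturbation_dx_norm_sq \<kappa> \<epsilon> That v u T t \<le> ennreal B)"

text \<open>
  The decay estimates.  All functions in the two \<open>L\<^sup>\<infinity>\<close> bounds are continuous in \<open>x\<close>, so these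
  are stated pointwise for all \<open>x\<close>.
\<close>

definition decay_estimates ::
  "real \<Rightarrow> real \<Rightarrow> real \<Rightarrow> real \<Rightarrow> real \<Rightarrow> (real \<Rightarrow> real)
    \<Rightarrow> spacetime_fun \<Rightarrow> spacetime_fun \<Rightarrow> spacetime_fun \<Rightarrow> bool" where
  "decay_estimates C C0 \<delta> \<kappa> \<epsilon> That v u T \<longleftrightarrow>
     (\<forall>t\<ge>0.
        perturbation_norm_sq \<kappa> \<epsilon> That v u T t
          \<le> ennreal (C * sqrt \<delta> * \<epsilon> ^ 3 * (1 + t) powr (-1 + C0 * sqrt \<delta>)) \<and>
        perturbation_dx_norm_sq \<kappa> \<epsilon> That v u T t
          \<le> ennreal (C * sqrt \<delta> * \<epsilon>\<^sup>2 * (1 + t) powr (-3/2 + C0 * sqrt \<delta>)) \<and>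
        (\<forall>x. norm (v x t - self_similar That x t, T x t - self_similar That x t)
          \<le> C * \<delta> powr (1/4) * \<epsilon> powr (5/4) * (1 + t) powr (-1/2)) \<and>
        (\<forall>x. \<bar>u x t - u_profile \<kappa> That x t\<bar>
          \<le> C * \<delta> powr (1/4) * \<epsilon> powr (1/4) * (1 + t) powr (-1/2)))"

text \<open>
  The state \<open>Tm\<close> is fixed and \<open>Tp\<close> varies within distance \<open>\<delta>0\<close> of it, so that \<open>\<delta>0\<close>, \<open>\<epsilon>0\<close>,
  \<open>C\<close> and \<open>C0\<close> may depend on \<open>\<mu>\<close>, \<open>\<kappa>\<close>, \<open>Tm\<close>, but \<open>C\<close> and \<open>C0\<close> depend neither on \<open>\<epsilon>\<close> nor on
  \<open>\<delta> = \<bar>Tp - Tm\<bar>\<close>.  Uniqueness is only meaningful for \<open>t \<ge> 0\<close>, hence is not stated with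
  \<open>\<exists>!\<close> over total functions.
\<close>

definition small_data_constants :: "real \<Rightarrow> real \<Rightarrow> real \<Rightarrow> real \<Rightarrow> real \<Rightarrow> bool" where
  "small_data_constants \<mu> \<kappa> Tm \<delta>0 \<epsilon>0 \<longleftrightarrow>
     \<delta>0 > 0 \<and> \<epsilon>0 > 0 \<and>
     (\<exists>C>0. \<exists>C0>0. \<forall>Tp That \<epsilon>.
        Tp > 0 \<and> \<bar>Tp - Tm\<bar> \<le> \<delta>0 \<and> diffusion_profile \<kappa> Tm Tp That \<and> 0 < \<epsilon> \<and> \<epsilon> \<le> \<epsilon>0 \<longrightarrow>
        (\<exists>v u T.
           global_smooth_solution \<mu> \<kappa> \<epsilon> That v u T \<and>
           decay_estimates C C0 \<bar>Tp - Tm\<bar> \<kappa> \<epsilon> That v u T \<and>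
           (\<forall>v' u' T'. global_smooth_solution \<mu> \<kappa> \<epsilon> That v' u' T' \<longrightarrow>
              (\<forall>x. \<forall>t\<ge>0. v' x t = v x t \<and> u' x t = u x t \<and> T' x t = T x t))))"

end

theory Submission
  imports Defs
begin

text \<open>
  The pointwise bounds on \<open>u\<close> follow from the \<open>L\<^sup>\<infinity>\<close> decay estimate, since \<open>u_profile\<close> is a
  positive multiple of the derivative of the profile.  The bounds on \<open>T\<^sub>x\<close> do not follow from
  the \<open>L\<^sup>2\<close> bound on first derivatives; they are obtained by local regularity.  On the scale
  \<open>x \<sim> \<epsilon>\<close>, \<open>t \<sim> \<epsilon>\<^sup>2\<close>, the system for \<open>(v, \<epsilon> u, T)\<close> has coefficients of order one, and by the
  \<open>L\<^sup>\<infinity>\<close> estimates its solution deviates from the profile by \<open>O(\<epsilon>\<^sup>5\<^sup>/\<^sup>4)\<close>, up to the time decay.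
  The equations for \<open>u\<close> and \<open>T\<close> are parabolic, so the maximum principle turns this into bounds
  on \<open>\<epsilon> u\<^sub>x\<close> and \<open>T\<^sub>x\<close> by \<open>O(\<epsilon>\<^sup>1\<^sup>/\<^sup>4)\<close>, provided \<open>v\<^sub>x\<close> is controlled; and \<open>v\<^sub>x\<close> is controlled by
  \<open>T\<^sub>x\<close>, because \<open>\<mu> v\<^sub>x / v - u\<close> solves a strongly damped ordinary differential equation in time.
  A continuity argument on boxes of width \<open>2 \<epsilon>\<close>, with weights vanishing on the lateral boundary,
  closes the loop.
\<close>

section \<open>Comparison principles and mixed partial derivatives\<close>

text \<open>Write h for the self-similar profile. The goal needs T_x - h_x pointwise below a small
  multiple of (1+t)^(-1/2), while the known pointwise estimates concern undifferentiated quantities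
  only. The dependence between the gradients is circular: the forcing of T contains u_x and v_x,
  that of u contains P_x / \<epsilon>^2 and hence T_x and v_x, and v_x at time t depends on T_x at
  the same x over all earlier times. For this reason the boxes reach back to t = 0 and the weights
  depend on x alone. The circle closes because, on a neighbourhood of radius r \<epsilon>, the
  interior gradient estimate returns a multiple of e / r from the size e of the deviation and a
  multiple of r (\<Lambda> + e) from the forcing, \<Lambda> being the gradient bound sought. Fixing
  r in terms of the bounds \<open>B\<close> on the coefficients leaves \<Lambda> as a large multiple
  of e, hence of order \<epsilon>^(1/4). That P_x / \<epsilon>^2 fits into this scheme rests on the
  constant pressure of the profile v = T = h: every term of P_x contains a deviation from
  it.\<close>

lemma second_deriv_nonpos_at_max:
  fixes g g' :: "real \<Rightarrow> real"
  assumes "r > 0"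
    and d: "\<And>y. \<bar>y - x\<bar> < r \<Longrightarrow> (g has_real_derivative g' y) (at y)"
    and d2: "(g' has_real_derivative g'') (at x)"
    and le: "\<And>y. \<bar>y - x\<bar> < r \<Longrightarrow> g y \<le> g x"
  shows "g'' \<le> 0"
proof (rule ccontr)
  assume "\<not> g'' \<le> 0"
  then obtain e where e: "e > 0" "\<And>k. 0 < k \<Longrightarrow> k < e \<Longrightarrow> g' x < g' (x + k)"
    using DERIV_pos_inc_right[OF d2] by auto
  have "g' x = 0"
    by (rule DERIV_local_max[OF d[of x] \<open>r > 0\<close>])
      (use \<open>r > 0\<close> le in \<open>auto simp: abs_minus_commute\<close>)
  define y where "y = x + min e r / 2"
  have y: "x < y" "y - x < e" "y - x < r" using e(1) \<open>r > 0\<close> by (auto simp: y_def)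
  obtain z where z: "x < z" "z < y" "g y - g x = (y - x) * g' z"
    using MVT2[of x y g g'] d y by force
  have "g' z > 0" using e(2)[of "z - x"] z y \<open>g' x = 0\<close> by auto
  then have "g y > g x" using z y by (metis diff_gt_0_iff_gt mult_pos_pos)
  with le[of y] y show False by auto
qed

text \<open>Only earlier times are compared, so this applies to a maximum at the final time of a
  cylinder as well as to one inside.\<close>

lemma deriv_nonneg_at_right_max:
  fixes g :: "real \<Rightarrow> real"
  assumes "r > 0" and d: "(g has_real_derivative D) (at t)"
    and le: "\<And>s. t - r < s \<Longrightarrow> s < t \<Longrightarrow> g s \<le> g t"
  shows "D \<ge> 0"
proof (rule ccontr)
  assume "\<not> D \<ge> 0"
  then obtain e where e: "e > 0" "\<And>k. 0 < k \<Longrightarrow> k < e \<Longrightarrow> g t < g (t - k)"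
    using DERIV_neg_dec_left[OF d] by auto
  show False using e(2)[of "min e r / 2"] le[of "t - min e r / 2"] e(1) \<open>r > 0\<close> by force
qed

section \<open>Interior gradient estimate by doubling the space variable\<close>

text \<open>The function \<open>f x t - f y t\<close> of three variables is compared with a barrier that is concave in
  \<open>x - y\<close>.  No modulus of continuity of the coefficient \<open>a\<close> is needed.\<close>

lemma interior_upper_gradient_bound:
  fixes f fx fxx ft a F :: "real \<Rightarrow> real \<Rightarrow> real"
  assumes \<rho>: "\<rho> > 0" and a0: "a0 > 0" and L: "L \<ge> 0" and m: "m \<ge> 0" and \<Phi>: "\<Phi> > 0" and ts: "ts < t0"
    and cont: "continuous_on ({x0-\<rho>..x0+\<rho>} \<times> {ts..t0}) (\<lambda>(x,t). f x t)"
    and fx: "\<And>x t. \<bar>x - x0\<bar> < \<rho> \<Longrightarrow> ts < t \<Longrightarrow> t \<le> t0 \<Longrightarrow> ((\<lambda>y. f y t) has_real_derivative fx x t) (at x)"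
    and fxx: "\<And>x t. \<bar>x - x0\<bar> < \<rho> \<Longrightarrow> ts < t \<Longrightarrow> t \<le> t0 \<Longrightarrow> ((\<lambda>y. fx y t) has_real_derivative fxx x t) (at x)"
    and ft: "\<And>x t. \<bar>x - x0\<bar> < \<rho> \<Longrightarrow> ts < t \<Longrightarrow> t \<le> t0 \<Longrightarrow> ((\<lambda>s. f x s) has_real_derivative ft x t) (at t)"
    and eq: "\<And>x t. \<bar>x - x0\<bar> < \<rho> \<Longrightarrow> ts < t \<Longrightarrow> t \<le> t0 \<Longrightarrow> ft x t = a x t * fxx x t + F x t"
    and a: "\<And>x t. \<bar>x - x0\<bar> < \<rho> \<Longrightarrow> ts < t \<Longrightarrow> t \<le> t0 \<Longrightarrow> a x t \<ge> a0"
    and F: "\<And>x t. \<bar>x - x0\<bar> < \<rho> \<Longrightarrow> ts < t \<Longrightarrow> t \<le> t0 \<Longrightarrow> \<bar>F x t\<bar> \<le> \<Phi>"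
    and f: "\<And>x t. \<bar>x - x0\<bar> \<le> \<rho> \<Longrightarrow> ts \<le> t \<Longrightarrow> t \<le> t0 \<Longrightarrow> \<bar>f x t\<bar> \<le> m"
    and init: "ts \<le> t0 - \<rho>\<^sup>2 \<or> (\<forall>x y. \<bar>x - x0\<bar> \<le> \<rho> \<longrightarrow> \<bar>y - x0\<bar> \<le> \<rho> \<longrightarrow> y \<le> x \<longrightarrow> f x ts - f y ts \<le> L * (x - y))"
  shows "fx x0 t0 \<le> L + 16 * m / \<rho> + 8 * (\<rho> * \<Phi> + m / \<rho>) / a0"
proof -
  \<comment> \<open>The \<open>k\<close> part of the barrier reaches 2 m, the largest possible value
    of \<open>f x t - f y t\<close>, as soon as x or y is at distance \<rho> from \<open>x0\<close>
    or t0 - t equals \<rho>^2. This keeps a positive maximum of \<open>H\<close> away from the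
    lateral boundary.\<close>
  define k where "k = 2 * m / \<rho>\<^sup>2"
  have k: "k \<ge> 0" "k * \<rho>\<^sup>2 = 2 * m" using m \<rho> by (auto simp: k_def)
  \<comment> \<open>\<open>A\<close> solves a0 (A - 2 k) = 2 \<Phi> + k. At a positive maximum each
    of the two diffusion terms then contributes at most -(2 \<Phi> + k), against 2 \<Phi> from the
    two forcings and k from the time slope of the barrier.\<close>
  define A where "A = 2 * k + (2 * \<Phi> + k) / a0"
  have A: "A \<ge> 2 * k" using k \<Phi> a0 by (auto simp: A_def)
  have Aa: "a0 * (A - 2 * k) = 2 * \<Phi> + k" using a0 by (auto simp: A_def)
  \<comment> \<open>For 0 \<le> s \<le> 2 \<rho>, the range of s = x - y, the function 4 \<rho> s -
    s^2 / 2 is nonnegative; its second derivative is -1, and its slope 4 \<rho> at s = 0 produces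
    the final gradient bound.\<close>
  define b where "b = (\<lambda>x y t. L * (x - y) + A * (4 * \<rho> * (x - y) - (x - y)\<^sup>2 / 2)
    + k * ((x - x0)\<^sup>2 + (y - x0)\<^sup>2 + (t0 - t)))"
  define H where "H = (\<lambda>x y t. f x t - f y t - b x y t)"
  define D where "D = {(x, y, t). x \<le> x0 + \<rho> \<and> x0 - \<rho> \<le> y \<and> y \<le> x \<and> ts \<le> t \<and> t \<le> t0}"
  have Dsub: "D = ({x0-\<rho>..x0+\<rho>} \<times> {x0-\<rho>..x0+\<rho>} \<times> {ts..t0}) \<inter> {q. fst (snd q) \<le> fst q}"
    by (auto simp: D_def)
  have "closed {q :: real \<times> real \<times> real. fst (snd q) \<le> fst q}"
    by (intro closed_Collect_le continuous_intros)
  then have cD: "compact D" unfolding Dsub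
    by (intro compact_Int_closed compact_Times compact_Icc)
  have "(x0, x0, t0) \<in> D" using \<rho> ts by (auto simp: D_def)
  then have "D \<noteq> {}" by blast
  have c1: "continuous_on D (\<lambda>q. f (fst q) (snd (snd q)))"
    using continuous_on_compose2[OF cont, of D "\<lambda>q. (fst q, snd (snd q))"]
    by (force simp: D_def intro!: continuous_intros)
  have c2: "continuous_on D (\<lambda>q. f (fst (snd q)) (snd (snd q)))"
    using continuous_on_compose2[OF cont, of D "\<lambda>q. (fst (snd q), snd (snd q))"]
    by (force simp: D_def intro!: continuous_intros)
  have "continuous_on D (\<lambda>q. H (fst q) (fst (snd q)) (snd (snd q)))"
    unfolding H_def b_def by (intro continuous_intros c1 c2) auto
  from continuous_attains_sup[OF cD \<open>D \<noteq> {}\<close> this]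
  obtain x y t where D: "(x, y, t) \<in> D"
    and max: "\<And>x' y' t'. (x', y', t') \<in> D \<Longrightarrow> H x' y' t' \<le> H x y t"
    by force
  have xyt: "x \<le> x0 + \<rho>" "x0 - \<rho> \<le> y" "y \<le> x" "ts \<le> t" "t \<le> t0" using D by (auto simp: D_def)
  have gge: "4 * \<rho> * (x - y) - (x - y)\<^sup>2 / 2 \<ge> 0"
  proof -
    have "(x - y) * (x - y) \<le> 2 * \<rho> * (x - y)" using xyt by (intro mult_right_mono) auto
    moreover have "\<rho> * (x - y) \<ge> 0" using \<rho> xyt by simp
    ultimately show ?thesis unfolding power2_eq_square by linarith
  qed
  have bge: "b x y t \<ge> L * (x - y)" "b x y t \<ge> k * ((x - x0)\<^sup>2 + (y - x0)\<^sup>2 + (t0 - t))"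
    using mult_nonneg_nonneg[OF _ gge, of A] A k L xyt
    by (auto simp: b_def)
  have ff: "f x t - f y t \<le> 2 * m" using f[of x t] f[of y t] xyt by (auto simp: abs_le_iff)
  have "H x y t \<le> 0"
  proof (rule ccontr)
    assume pos: "\<not> H x y t \<le> 0"
    have sq: "k * ((x - x0)\<^sup>2 + (y - x0)\<^sup>2 + (t0 - t)) < 2 * m"
      using pos ff bge(2) by (auto simp: H_def)
    have small: "(x - x0)\<^sup>2 + (y - x0)\<^sup>2 + (t0 - t) < \<rho>\<^sup>2"
      using sq k by (metis mult_less_cancel_left_pos mult_left_mono not_le)
    have sqs: "(x - x0)\<^sup>2 < \<rho>\<^sup>2" "(y - x0)\<^sup>2 < \<rho>\<^sup>2" "t0 - t < \<rho>\<^sup>2"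
      using small xyt zero_le_power2[of "x - x0"] zero_le_power2[of "y - x0"] by linarith+
    have int: "\<bar>x - x0\<bar> < \<rho>" "\<bar>y - x0\<bar> < \<rho>"
      using sqs \<rho> by (metis abs_le_square_iff abs_of_pos not_le)+
    \<comment> \<open>On the diagonal the difference of the two values of \<open>f\<close> vanishes
      and \<open>H\<close> is at most 0, so a positive maximum lies where x and y can be varied
      independently.\<close>
    have "x \<noteq> y" using pos by (auto simp: H_def b_def k xyt intro: mult_nonneg_nonneg)
    then have xy: "y < x" using xyt by simp
    have tt: "ts < t"
    proof (rule ccontr)
      assume "\<not> ts < t"
      then have [simp]: "t = ts" using xyt by simp
      show False using init
      proof
        assume "ts \<le> t0 - \<rho>\<^sup>2" then show False using sqs by simp
      next
        assume "\<forall>x y. \<bar>x - x0\<bar> \<le> \<rho> \<longrightarrow> \<bar>y - x0\<bar> \<le> \<rho> \<longrightarrow> y \<le> x \<longrightarrow> f x ts - f y ts \<le> L * (x - y)"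
        then have "f x ts - f y ts \<le> L * (x - y)" using int xy by simp
        then show False using pos bge(1) by (simp add: H_def)
      qed
    qed
    obtain s where s: "s > 0" "s \<le> x - y" "s \<le> \<rho> - \<bar>x - x0\<bar>" "s \<le> \<rho> - \<bar>y - x0\<bar>"
      by (rule that[of "min (x - y) (min (\<rho> - \<bar>x - x0\<bar>) (\<rho> - \<bar>y - x0\<bar>))"]) (use int xy in auto)
    have hxx: "fxx x t - (- A + 2 * k) \<le> 0"
    proof (rule second_deriv_nonpos_at_max[OF s(1)])
      show "((\<lambda>x. H x y t) has_real_derivative
          fx x' t - (L + A * (4 * \<rho> - (x' - y)) + k * (2 * (x' - x0)))) (at x')" if "\<bar>x' - x\<bar> < s" for x'
        unfolding H_def b_def
        using that s tt xyt
        by (auto intro!: derivative_eq_intros fx simp: field_simps)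
      show "((\<lambda>x'. fx x' t - (L + A * (4 * \<rho> - (x' - y)) + k * (2 * (x' - x0))))
          has_real_derivative fxx x t - (- A + 2 * k)) (at x)"
        using int tt xyt
        by (auto intro!: derivative_eq_intros fxx simp: field_simps)
      show "H x' y t \<le> H x y t" if "\<bar>x' - x\<bar> < s" for x'
        by (rule max) (use that s xyt in \<open>auto simp: D_def\<close>)
    qed
    have hyy: "- fxx y t - (- A + 2 * k) \<le> 0"
    proof (rule second_deriv_nonpos_at_max[OF s(1)])
      show "((\<lambda>y. H x y t) has_real_derivative
          - fx y' t - (- L + A * (- 4 * \<rho> + (x - y')) + k * (2 * (y' - x0)))) (at y')" if "\<bar>y' - y\<bar> < s" for y'
        unfolding H_def b_def
        using that s tt xyt
        by (auto intro!: derivative_eq_intros fx simp: field_simps)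
      show "((\<lambda>y'. - fx y' t - (- L + A * (- 4 * \<rho> + (x - y')) + k * (2 * (y' - x0))))
          has_real_derivative - fxx y t - (- A + 2 * k)) (at y)"
        using int tt xyt
        by (auto intro!: derivative_eq_intros fxx simp: field_simps)
      show "H x y' t \<le> H x y t" if "\<bar>y' - y\<bar> < s" for y'
        by (rule max) (use that s xyt in \<open>auto simp: D_def\<close>)
    qed
    have ht: "ft x t - ft y t + k \<ge> 0"
    proof (rule deriv_nonneg_at_right_max)
      show "t - ts > 0" using tt by simp
      show "((\<lambda>t. H x y t) has_real_derivative ft x t - ft y t + k) (at t)"
        unfolding H_def b_def
        using int tt xyt
        by (auto intro!: derivative_eq_intros ft simp: field_simps)
      show "H x y s \<le> H x y t" if "t - (t - ts) < s" "s < t" for s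
        by (rule max) (use that xyt in \<open>auto simp: D_def\<close>)
    qed
    have ax: "a x t \<ge> a0" "a y t \<ge> a0" "\<bar>F x t\<bar> \<le> \<Phi>" "\<bar>F y t\<bar> \<le> \<Phi>" using int tt xyt a F by auto
    \<comment> \<open>Both second derivatives have a definite sign, each beating A - 2 k, so the
      equations at x and at y are estimated separately and \<open>a x t\<close> is never compared
      with \<open>a y t\<close>.\<close>
    have "a x t * fxx x t \<le> a x t * - (A - 2 * k)" using ax a0 hxx by (intro mult_left_mono) auto
    also have "\<dots> \<le> a0 * - (A - 2 * k)" using ax A by (intro mult_right_mono_neg) auto
    finally have e1: "a x t * fxx x t \<le> - (2 * \<Phi> + k)" unfolding mult_minus_right Aa .
    have "a y t * - fxx y t \<le> a y t * - (A - 2 * k)" using ax a0 hyy by (intro mult_left_mono) auto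
    also have "\<dots> \<le> a0 * - (A - 2 * k)" using ax A by (intro mult_right_mono_neg) auto
    finally have e2: "a y t * - fxx y t \<le> - (2 * \<Phi> + k)" unfolding mult_minus_right Aa .
    have "ft x t - ft y t = a x t * fxx x t + F x t - a y t * fxx y t - F y t"
      using eq int tt xyt by simp
    then show False using ht e1 e2 ax k \<Phi> by (auto simp: abs_le_iff)
  qed
  then have le0: "H x' y' t' \<le> 0" if "(x', y', t') \<in> D" for x' y' t'
    using max[OF that] by simp
  \<comment> \<open>With y = x0 and t = t0 frozen, \<open>H \<le> 0\<close> gives
    \<open>G \<ge> 0\<close> to the right of \<open>x0\<close>, where \<open>G\<close> vanishes.
    Hence the slope of the barrier at the diagonal dominates \<open>fx x0 t0\<close>.\<close>
  define G where "G = (\<lambda>x. b x x0 t0 - (f x t0 - f x0 t0))"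
  have G: "(G has_real_derivative L + A * 4 * \<rho> - fx x0 t0) (at x0)"
    unfolding G_def b_def
    using \<rho> ts
        by (auto intro!: derivative_eq_intros fx simp: field_simps)
  have "L + A * 4 * \<rho> - fx x0 t0 \<ge> 0"
  proof (rule ccontr)
    assume "\<not> ?thesis"
    then obtain s where s: "s > 0" "\<And>h. 0 < h \<Longrightarrow> h < s \<Longrightarrow> G x0 > G (x0 + h)"
      using DERIV_neg_dec_right[OF G] by auto
    define h where "h = min s \<rho> / 2"
    have h: "0 < h" "h < s" "h < \<rho>" using s \<rho> by (auto simp: h_def)
    have "H (x0 + h) x0 t0 \<le> 0" using h ts by (intro le0) (auto simp: D_def)
    then have "G (x0 + h) \<ge> 0" by (simp add: G_def H_def)
    moreover have "G x0 = 0" by (simp add: G_def b_def)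
    ultimately show False using s(2)[OF h(1,2)] by simp
  qed
  moreover have "A * 4 * \<rho> = 16 * m / \<rho> + 8 * (\<rho> * \<Phi> + m / \<rho>) / a0"
    using \<rho> a0 by (simp add: A_def k_def field_simps power2_eq_square)
  ultimately show ?thesis by simp
qed

lemma interior_gradient_bound:
  fixes f fx fxx ft a F :: "real \<Rightarrow> real \<Rightarrow> real"
  assumes \<rho>: "\<rho> > 0" and a0: "a0 > 0" and L: "L \<ge> 0" and m: "m \<ge> 0" and \<Phi>: "\<Phi> > 0" and ts: "ts < t0"
    and cont: "continuous_on ({x0-\<rho>..x0+\<rho>} \<times> {ts..t0}) (\<lambda>(x,t). f x t)"
    and fx: "\<And>x t. \<bar>x - x0\<bar> < \<rho> \<Longrightarrow> ts < t \<Longrightarrow> t \<le> t0 \<Longrightarrow> ((\<lambda>y. f y t) has_real_derivative fx x t) (at x)"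
    and fxx: "\<And>x t. \<bar>x - x0\<bar> < \<rho> \<Longrightarrow> ts < t \<Longrightarrow> t \<le> t0 \<Longrightarrow> ((\<lambda>y. fx y t) has_real_derivative fxx x t) (at x)"
    and ft: "\<And>x t. \<bar>x - x0\<bar> < \<rho> \<Longrightarrow> ts < t \<Longrightarrow> t \<le> t0 \<Longrightarrow> ((\<lambda>s. f x s) has_real_derivative ft x t) (at t)"
    and eq: "\<And>x t. \<bar>x - x0\<bar> < \<rho> \<Longrightarrow> ts < t \<Longrightarrow> t \<le> t0 \<Longrightarrow> ft x t = a x t * fxx x t + F x t"
    and a: "\<And>x t. \<bar>x - x0\<bar> < \<rho> \<Longrightarrow> ts < t \<Longrightarrow> t \<le> t0 \<Longrightarrow> a x t \<ge> a0"
    and F: "\<And>x t. \<bar>x - x0\<bar> < \<rho> \<Longrightarrow> ts < t \<Longrightarrow> t \<le> t0 \<Longrightarrow> \<bar>F x t\<bar> \<le> \<Phi>"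
    and f: "\<And>x t. \<bar>x - x0\<bar> \<le> \<rho> \<Longrightarrow> ts \<le> t \<Longrightarrow> t \<le> t0 \<Longrightarrow> \<bar>f x t\<bar> \<le> m"
    and init: "ts \<le> t0 - \<rho>\<^sup>2 \<or> (\<forall>x y. \<bar>x - x0\<bar> \<le> \<rho> \<longrightarrow> \<bar>y - x0\<bar> \<le> \<rho> \<longrightarrow> \<bar>f x ts - f y ts\<bar> \<le> L * \<bar>x - y\<bar>)"
  shows "\<bar>fx x0 t0\<bar> \<le> L + 16 * m / \<rho> + 8 * (\<rho> * \<Phi> + m / \<rho>) / a0"
proof -
  have *: "p - q \<le> c * \<bar>x - y\<bar> \<and> q - p \<le> c * \<bar>x - y\<bar>" if "\<bar>p - q\<bar> \<le> c * \<bar>x - y\<bar>" for p q c x y :: real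
    using that by linarith
  have i1: "ts \<le> t0 - \<rho>\<^sup>2 \<or> (\<forall>x y. \<bar>x - x0\<bar> \<le> \<rho> \<longrightarrow> \<bar>y - x0\<bar> \<le> \<rho> \<longrightarrow> y \<le> x \<longrightarrow> f x ts - f y ts \<le> L * (x - y))"
    and i2: "ts \<le> t0 - \<rho>\<^sup>2 \<or> (\<forall>x y. \<bar>x - x0\<bar> \<le> \<rho> \<longrightarrow> \<bar>y - x0\<bar> \<le> \<rho> \<longrightarrow> y \<le> x \<longrightarrow> f y ts - f x ts \<le> L * (x - y))"
    using init by (metis * abs_of_nonneg diff_ge_0_iff_ge)+
  have "fx x0 t0 \<le> L + 16 * m / \<rho> + 8 * (\<rho> * \<Phi> + m / \<rho>) / a0"
    by (rule interior_upper_gradient_bound[OF \<rho> a0 L m \<Phi> ts cont fx fxx ft eq a F f])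
      (use i1 in auto)
  moreover have "- fx x0 t0 \<le> L + 16 * m / \<rho> + 8 * (\<rho> * \<Phi> + m / \<rho>) / a0"
  proof (rule interior_upper_gradient_bound[OF \<rho> a0 L m \<Phi> ts, where a = a and f = "\<lambda>x t. - f x t"
        and fx = "\<lambda>x t. - fx x t" and fxx = "\<lambda>x t. - fxx x t" and ft = "\<lambda>x t. - ft x t" and F = "\<lambda>x t. - F x t"])
    show "continuous_on ({x0-\<rho>..x0+\<rho>} \<times> {ts..t0}) (\<lambda>(x,t). - f x t)"
      using continuous_on_minus[OF cont] by (simp add: case_prod_unfold)
    show "ts \<le> t0 - \<rho>\<^sup>2 \<or> (\<forall>x y. \<bar>x - x0\<bar> \<le> \<rho> \<longrightarrow> \<bar>y - x0\<bar> \<le> \<rho> \<longrightarrow> y \<le> x \<longrightarrow> - f x ts - - f y ts \<le> L * (x - y))"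
      using i2 by simp
    show "((\<lambda>s. - f x s) has_real_derivative - ft x t) (at t)"
      if "\<bar>x - x0\<bar> < \<rho>" "ts < t" "t \<le> t0" for x t
      using ft[OF that] by (rule DERIV_minus)
  qed (auto intro!: fx fxx DERIV_minus simp: eq a F f)
  ultimately show ?thesis by simp
qed

text \<open>\<open>b\<close> is a strict supersolution. At a positive maximum of z - b the damping
  gives -a z + g < b', although the derivative of z - b is nonnegative there.\<close>

lemma damped_ode_upper_bound:
  fixes z z' a g b b' :: "real \<Rightarrow> real"
  assumes t: "t1 \<ge> 0" and cz: "continuous_on {0..t1} z" and cb: "continuous_on {0..t1} b"
    and dz: "\<And>t. 0 < t \<Longrightarrow> t \<le> t1 \<Longrightarrow> (z has_real_derivative - a t * z t + g t) (at t)"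
    and db: "\<And>t. 0 < t \<Longrightarrow> t \<le> t1 \<Longrightarrow> (b has_real_derivative b' t) (at t)"
    and a: "\<And>t. 0 < t \<Longrightarrow> t \<le> t1 \<Longrightarrow> a t \<ge> 0"
    and g: "\<And>t. 0 < t \<Longrightarrow> t \<le> t1 \<Longrightarrow> g t < a t * b t + b' t"
    and init: "z 0 \<le> b 0"
  shows "z t1 \<le> b t1"
proof -
  have "continuous_on {0..t1} (\<lambda>t. z t - b t)" by (intro continuous_intros cz cb)
  from continuous_attains_sup[OF compact_Icc _ this] t
  obtain t where t01: "0 \<le> t" "t \<le> t1" and max: "\<And>s. 0 \<le> s \<Longrightarrow> s \<le> t1 \<Longrightarrow> z s - b s \<le> z t - b t"
    by fastforce
  have "z t - b t \<le> 0"
  proof (rule ccontr)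
    assume pos: "\<not> z t - b t \<le> 0"
    then have "t > 0" using init t01 by (cases "t = 0") auto
    have "- a t * z t + g t - b' t \<ge> 0"
      by (rule deriv_nonneg_at_right_max[OF \<open>t > 0\<close>, of "\<lambda>s. z s - b s"])
        (use DERIV_diff[OF dz db] \<open>t > 0\<close> t01 max in auto)
    moreover have "a t * b t \<le> a t * z t" using pos a \<open>t > 0\<close> t01 by (intro mult_left_mono) auto
    ultimately show False using g[OF \<open>t > 0\<close> t01(2)] by simp
  qed
  then show ?thesis using max[of t1] t by simp
qed

text \<open>Schwarz's theorem: the second difference over a small square is evaluated in both orders
  by the mean value theorem. It serves to turn the x-derivative of v_t = u_x into an equation for
  the time derivative of v_x.\<close>

lemma mixed_partials_eq:
  fixes f fx ft fxt ftx :: "real \<Rightarrow> real \<Rightarrow> real"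
  assumes "open S" and S: "(x, t) \<in> S"
    and fx: "\<And>x t. (x, t) \<in> S \<Longrightarrow> ((\<lambda>y. f y t) has_real_derivative fx x t) (at x)"
    and ft: "\<And>x t. (x, t) \<in> S \<Longrightarrow> ((\<lambda>s. f x s) has_real_derivative ft x t) (at t)"
    and fxt: "\<And>x t. (x, t) \<in> S \<Longrightarrow> ((\<lambda>s. fx x s) has_real_derivative fxt x t) (at t)"
    and ftx: "\<And>x t. (x, t) \<in> S \<Longrightarrow> ((\<lambda>y. ft y t) has_real_derivative ftx x t) (at x)"
    and c1: "continuous_on S (\<lambda>(x, t). fxt x t)" and c2: "continuous_on S (\<lambda>(x, t). ftx x t)"
  shows "fxt x t = ftx x t"
proof (rule ccontr)
  assume ne: "fxt x t \<noteq> ftx x t"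
  define e where "e = \<bar>fxt x t - ftx x t\<bar> / 2"
  have e: "e > 0" using ne by (simp add: e_def)
  have "isCont (\<lambda>(x, t). fxt x t) (x, t)" "isCont (\<lambda>(x, t). ftx x t) (x, t)"
    using c1 c2 \<open>open S\<close> S continuous_on_eq_continuous_at by blast+
  then obtain d1 d2 where d1: "d1 > 0" "\<And>q. dist q (x,t) < d1 \<Longrightarrow> \<bar>fxt (fst q) (snd q) - fxt x t\<bar> < e"
    and d2: "d2 > 0" "\<And>q. dist q (x,t) < d2 \<Longrightarrow> \<bar>ftx (fst q) (snd q) - ftx x t\<bar> < e"
    using e unfolding continuous_at_eps_delta by (force simp: case_prod_unfold dist_real_def)
  obtain d3 where d3: "d3 > 0" "ball (x,t) d3 \<subseteq> S" using \<open>open S\<close> S open_contains_ball by blast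
  define h where "h = min d1 (min d2 d3) / 3"
  have h: "h > 0" using d1 d2 d3 by (simp add: h_def)
  have near: "dist (y, s) (x, t) < min d1 (min d2 d3)" if "x \<le> y" "y \<le> x + h" "t \<le> s" "s \<le> t + h" for y s
  proof -
    have "dist (y, s) (x, t) \<le> \<bar>y - x\<bar> + \<bar>s - t\<bar>"
      by (simp add: dist_Pair_Pair dist_real_def sqrt_sum_squares_le_sum_abs)
    also have "\<dots> < 3 * h" using that h by simp
    finally show ?thesis by (simp add: h_def)
  qed
  have inS: "(y, s) \<in> S" if "x \<le> y" "y \<le> x + h" "t \<le> s" "s \<le> t + h" for y s
    using near[OF that] d3 by (auto simp: mem_ball dist_commute)
  have "\<exists>z>x. z < x + h \<and>
      (f (x+h) (t+h) - f (x+h) t) - (f x (t+h) - f x t) = (x + h - x) * (fx z (t+h) - fx z t)"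
    by (rule MVT2[of x "x+h" "\<lambda>y. f y (t+h) - f y t" "\<lambda>y. fx y (t+h) - fx y t"]) (use h in \<open>auto intro!: DERIV_diff fx inS\<close>)
  then obtain y1 where y1: "x < y1" "y1 < x + h"
    "(f (x+h) (t+h) - f (x+h) t) - (f x (t+h) - f x t) = (x + h - x) * (fx y1 (t+h) - fx y1 t)"
    by blast
  have "\<exists>z>t. z < t + h \<and>
      fx y1 (t+h) - fx y1 t = (t + h - t) * fxt y1 z"
    by (rule MVT2[of t "t+h" "\<lambda>s. fx y1 s" "\<lambda>s. fxt y1 s"]) (use h y1 in \<open>auto intro!: fxt inS\<close>)
  then obtain s1 where s1: "t < s1" "s1 < t + h" "fx y1 (t+h) - fx y1 t = (t + h - t) * fxt y1 s1"
    by blast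
  have "\<exists>z>t. z < t + h \<and>
      (f (x+h) (t+h) - f x (t+h)) - (f (x+h) t - f x t) = (t + h - t) * (ft (x+h) z - ft x z)"
    by (rule MVT2[of t "t+h" "\<lambda>s. f (x+h) s - f x s" "\<lambda>s. ft (x+h) s - ft x s"]) (use h in \<open>auto intro!: DERIV_diff ft inS\<close>)
  then obtain s2 where s2: "t < s2" "s2 < t + h"
    "(f (x+h) (t+h) - f x (t+h)) - (f (x+h) t - f x t) = (t + h - t) * (ft (x+h) s2 - ft x s2)"
    by blast
  have "\<exists>z>x. z < x + h \<and>
      ft (x+h) s2 - ft x s2 = (x + h - x) * ftx z s2"
    by (rule MVT2[of x "x+h" "\<lambda>y. ft y s2" "\<lambda>y. ftx y s2"]) (use h s2 in \<open>auto intro!: ftx inS\<close>)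
  then obtain y2 where y2: "x < y2" "y2 < x + h" "ft (x+h) s2 - ft x s2 = (x + h - x) * ftx y2 s2"
    by blast
  have "h * (h * fxt y1 s1) = h * (h * ftx y2 s2)" using y1(3) s1(3) s2(3) y2(3) by (simp add: algebra_simps)
  then have "fxt y1 s1 = ftx y2 s2" using h by simp
  moreover have "\<bar>fxt y1 s1 - fxt x t\<bar> < e" using d1(2)[of "(y1,s1)"] near[of y1 s1] y1 s1 by simp
  moreover have "\<bar>ftx y2 s2 - ftx x t\<bar> < e" using d2(2)[of "(y2,s2)"] near[of y2 s2] y2 s2 by simp
  ultimately show False by (simp add: e_def abs_if split: if_splits)
qed

section \<open>Solutions near a profile\<close>

definition time_weight :: "real \<Rightarrow> real" where
  "time_weight t = 1 / sqrt (1 + t)"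

lemma time_weight_pos: "t \<ge> 0 \<Longrightarrow> time_weight t > 0"
  and time_weight_le_1: "t \<ge> 0 \<Longrightarrow> time_weight t \<le> 1"
  by (auto simp: time_weight_def)

lemma DERIV_time_weight:
  assumes "t > -1" shows "(time_weight has_real_derivative - (time_weight t ^ 3 / 2)) (at t)"
proof -
  have "sqrt (1 + t) > 0" using assms by simp
  moreover have "sqrt (1 + t) ^ 2 = 1 + t" using assms by simp
  ultimately show ?thesis unfolding time_weight_def
    using assms by (auto intro!: derivative_eq_intros simp: field_simps power3_eq_cube power2_eq_square)
qed

text \<open>1 + t0 \<le> 4 (1 + t) holds when t \<ge> 0 lies at most 1/4 before t0. The windows of
  the gradient estimate have height at most \<rho>^2 \<le> 1/4, so weights inside a window are
  comparable.\<close>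

lemma time_weight_mono_window:
  assumes t0: "0 \<le> t0" and "0 \<le> t" "t0 - 1/4 \<le> t"
  shows "time_weight t \<le> 2 * time_weight t0"
proof -
  have "sqrt (1 + t0) \<le> sqrt (4 * (1 + t))" using assms by (intro real_sqrt_le_mono) auto
  also have "\<dots> = 2 * sqrt (1 + t)" by (simp only: real_sqrt_mult real_sqrt_four)
  finally have le: "sqrt (1 + t0) \<le> 2 * sqrt (1 + t)" .
  have "sqrt (1 + t) > 0" "sqrt (1 + t0) > 0" using assms t0 by auto
  then show ?thesis using le unfolding time_weight_def by (simp add: field_simps)
qed

lemma abs_add_mono: "\<bar>a :: real\<bar> \<le> A \<Longrightarrow> \<bar>b\<bar> \<le> B \<Longrightarrow> \<bar>a + b\<bar> \<le> A + B"
  by linarith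

lemma abs_diff_mono: "\<bar>a :: real\<bar> \<le> A \<Longrightarrow> \<bar>b\<bar> \<le> B \<Longrightarrow> \<bar>a - b\<bar> \<le> A + B"
  by linarith

lemma abs_mult_mono: "\<bar>a :: real\<bar> \<le> A \<Longrightarrow> \<bar>b\<bar> \<le> B \<Longrightarrow> \<bar>a * b\<bar> \<le> A * B"
  by (metis abs_ge_zero abs_mult mult_mono' )

lemma continuous_on_time_slice:
  fixes f :: "real \<Rightarrow> real \<Rightarrow> real"
  assumes "continuous_on (UNIV \<times> {0..}) (\<lambda>(x, t). f x t)" "S \<subseteq> {0..}"
  shows "continuous_on S (f x)"
  using continuous_on_compose2[OF assms(1), of S "\<lambda>t. (x, t)"] assms(2)
  by (force intro!: continuous_intros)

text \<open>All quantities are bounded by powers of a single constant \<open>B\<close>; \<open>e\<close> measures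
  the distance to the profile.\<close>

locale near_profile =
  fixes \<mu> \<kappa> B \<epsilon> e :: real
    and h p px pxx pt v vx u ux uxx ut T Tx Txx Tt :: "real \<Rightarrow> real \<Rightarrow> real"
  assumes eps: "0 < \<epsilon>" "\<epsilon> \<le> 1" "\<epsilon> \<le> e" "B ^ 3 * \<epsilon>\<^sup>2 \<le> 1" and e_small: "4000000 * B ^ 18 * e \<le> 1"
    and B: "B \<ge> 1"
    and mu: "1 / B \<le> \<mu>" "\<mu> \<le> B" and kap: "1 / B \<le> \<kappa>" "\<kappa> \<le> B"
    and h: "\<And>x t. t \<ge> 0 \<Longrightarrow> 1 / B \<le> h x t \<and> h x t \<le> B"
    and v: "\<And>x t. t \<ge> 0 \<Longrightarrow> 1 / B \<le> v x t \<and> v x t \<le> B"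
    and T: "\<And>x t. t \<ge> 0 \<Longrightarrow> 1 / B \<le> T x t \<and> T x t \<le> B"
    and p: "\<And>x t. t \<ge> 0 \<Longrightarrow> \<bar>p x t\<bar> \<le> B * time_weight t"
    and px: "\<And>x t. t \<ge> 0 \<Longrightarrow> \<bar>px x t\<bar> \<le> B * time_weight t"
    and pxx: "\<And>x t. t \<ge> 0 \<Longrightarrow> \<bar>pxx x t\<bar> \<le> B * time_weight t"
    and pt: "\<And>x t. t \<ge> 0 \<Longrightarrow> \<bar>pt x t\<bar> \<le> B * time_weight t"
    and v_near: "\<And>x t. t \<ge> 0 \<Longrightarrow> \<bar>v x t - h x t\<bar> \<le> e * \<epsilon> * time_weight t"
    and T_near: "\<And>x t. t \<ge> 0 \<Longrightarrow> \<bar>T x t - h x t\<bar> \<le> e * \<epsilon> * time_weight t"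
    and u_near: "\<And>x t. t \<ge> 0 \<Longrightarrow> \<bar>u x t - p x t\<bar> \<le> e * time_weight t"
    and h_x: "\<And>x t. t \<ge> 0 \<Longrightarrow> ((\<lambda>y. h y t) has_real_derivative 2 * h x t * p x t / \<kappa>) (at x)"
    and p_x: "\<And>x t. t \<ge> 0 \<Longrightarrow> ((\<lambda>y. p y t) has_real_derivative px x t) (at x)"
    and p_xx: "\<And>x t. t \<ge> 0 \<Longrightarrow> ((\<lambda>y. px y t) has_real_derivative pxx x t) (at x)"
    and v_x: "\<And>x t. t \<ge> 0 \<Longrightarrow> ((\<lambda>y. v y t) has_real_derivative vx x t) (at x)"
    and u_x: "\<And>x t. t \<ge> 0 \<Longrightarrow> ((\<lambda>y. u y t) has_real_derivative ux x t) (at x)"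
    and u_xx: "\<And>x t. t \<ge> 0 \<Longrightarrow> ((\<lambda>y. ux y t) has_real_derivative uxx x t) (at x)"
    and T_x: "\<And>x t. t \<ge> 0 \<Longrightarrow> ((\<lambda>y. T y t) has_real_derivative Tx x t) (at x)"
    and T_xx: "\<And>x t. t \<ge> 0 \<Longrightarrow> ((\<lambda>y. Tx y t) has_real_derivative Txx x t) (at x)"
    and h_t: "\<And>x t. t > 0 \<Longrightarrow> (h x has_real_derivative px x t) (at t)"
    and p_t: "\<And>x t. t > 0 \<Longrightarrow> (p x has_real_derivative pt x t) (at t)"
    and v_t: "\<And>x t. t > 0 \<Longrightarrow> (v x has_real_derivative ux x t) (at t)"
    and vx_t: "\<And>x t. t > 0 \<Longrightarrow> (vx x has_real_derivative uxx x t) (at t)"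
    and u_t: "\<And>x t. t > 0 \<Longrightarrow> (u x has_real_derivative ut x t) (at t)"
    and T_t: "\<And>x t. t > 0 \<Longrightarrow> (T x has_real_derivative Tt x t) (at t)"
    and momentum: "\<And>x t. t > 0 \<Longrightarrow> ut x t + (Tx x t / v x t - T x t * vx x t / (v x t)\<^sup>2) / \<epsilon>\<^sup>2
        = \<mu> * (uxx x t / v x t - ux x t * vx x t / (v x t)\<^sup>2)"
    and energy: "\<And>x t. t > 0 \<Longrightarrow> Tt x t = \<kappa> * (Txx x t / v x t - Tx x t * vx x t / (v x t)\<^sup>2)
        - T x t / v x t * ux x t + \<epsilon>\<^sup>2 * \<mu> * (ux x t)\<^sup>2 / v x t"
    and init: "\<And>x. v x 0 = h x 0" "\<And>x. u x 0 = p x 0" "\<And>x. T x 0 = h x 0 - \<epsilon>\<^sup>2 * (p x 0)\<^sup>2 / 2"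
    and conts: "continuous_on (UNIV \<times> {0..}) (\<lambda>(x, t). h x t)" "continuous_on (UNIV \<times> {0..}) (\<lambda>(x, t). p x t)"
      "continuous_on (UNIV \<times> {0..}) (\<lambda>(x, t). px x t)"
      "continuous_on (UNIV \<times> {0..}) (\<lambda>(x, t). v x t)" "continuous_on (UNIV \<times> {0..}) (\<lambda>(x, t). vx x t)"
      "continuous_on (UNIV \<times> {0..}) (\<lambda>(x, t). u x t)" "continuous_on (UNIV \<times> {0..}) (\<lambda>(x, t). ux x t)"
      "continuous_on (UNIV \<times> {0..}) (\<lambda>(x, t). T x t)" "continuous_on (UNIV \<times> {0..}) (\<lambda>(x, t). Tx x t)"
begin

section \<open>Pressure gradient and damping of v_x\<close>

definition hx :: "real \<Rightarrow> real \<Rightarrow> real" where "hx x t = 2 * h x t * p x t / \<kappa>"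

definition hxx :: "real \<Rightarrow> real \<Rightarrow> real" where "hxx x t = 2 * (hx x t * p x t + h x t * px x t) / \<kappa>"

text \<open>By the first two equations, this combination of \<open>v\<^sub>x\<close> and \<open>u\<close> (the profile part subtracted)
  satisfies at each \<open>x\<close> an ordinary differential equation in \<open>t\<close> with damping rate of
  order \<open>1/\<epsilon>\<^sup>2\<close>.\<close>

definition z :: "real \<Rightarrow> real \<Rightarrow> real" where
  "z x t = \<mu> * vx x t / v x t - u x t - (2 * \<mu> / \<kappa> - 1) * p x t"

definition Px :: "real \<Rightarrow> real \<Rightarrow> real" where
  "Px x t = Tx x t / v x t - T x t * vx x t / (v x t)\<^sup>2"

lemma mu_pos: "\<mu> > 0" and kap_pos: "\<kappa> > 0" and e_pos: "e > 0" and B_pos: "B > 0"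
  using mu kap eps B by (auto intro: less_le_trans[of 0 "1 / B"])

lemma e_le_1: "e \<le> 1"
proof -
  have "1 \<le> 4000000 * B ^ 18" using B one_le_power[of B 18] by linarith
  then have "1 * e \<le> 4000000 * B ^ 18 * e" using e_pos by (intro mult_right_mono) auto
  then show ?thesis using e_small by linarith
qed

lemma pos: "t \<ge> 0 \<Longrightarrow> v x t > 0" "t \<ge> 0 \<Longrightarrow> T x t > 0" "t \<ge> 0 \<Longrightarrow> h x t > 0"
  using v[of t x] T[of t x] h[of t x] B_pos by (auto intro: less_le_trans[of 0 "1 / B"])

lemma coeff_bounds: "\<bar>1 / \<mu>\<bar> \<le> B" "\<bar>1 / \<kappa>\<bar> \<le> B" "\<bar>\<mu>\<bar> \<le> B" "\<bar>\<kappa>\<bar> \<le> B"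
  using mu kap mu_pos kap_pos B_pos by (auto simp: field_simps)

lemma abs_bounds:
  assumes "t \<ge> 0"
  shows "\<bar>v x t\<bar> \<le> B" "\<bar>h x t\<bar> \<le> B" "\<bar>T x t\<bar> \<le> B" "\<bar>1 / v x t\<bar> \<le> B"
  using v[OF assms, of x] h[OF assms, of x] T[OF assms, of x] pos[OF assms, of x] B_pos
  by (auto simp: field_simps)

lemma hx_bound: assumes "t \<ge> 0" shows "\<bar>hx x t\<bar> \<le> 2 * B ^ 3 * time_weight t"
proof -
  have "\<bar>2 * (h x t * (p x t * (1 / \<kappa>)))\<bar> \<le> 2 * (B * ((B * time_weight t) * B))"
    by (intro abs_mult_mono coeff_bounds abs_bounds p assms) auto
  then show ?thesis by (simp add: hx_def field_simps power3_eq_cube)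
qed

lemma hxx_bound: assumes "t \<ge> 0" shows "\<bar>hxx x t\<bar> \<le> 6 * B ^ 5 * time_weight t"
proof -
  note tw = time_weight_pos[OF assms] time_weight_le_1[OF assms]
  have "\<bar>hx x t * (p x t * (1 / \<kappa>))\<bar> \<le> (2 * B ^ 3 * time_weight t) * ((B * time_weight t) * B)"
    by (intro abs_mult_mono coeff_bounds hx_bound p assms)
  also have "\<dots> = 2 * B ^ 5 * time_weight t * time_weight t" by algebra
  also have "\<dots> \<le> 2 * B ^ 5 * time_weight t * 1" using tw B_pos by (intro mult_left_mono) auto
  finally have 1: "\<bar>hx x t * (p x t * (1 / \<kappa>))\<bar> \<le> 2 * B ^ 5 * time_weight t" by simp
  have "\<bar>h x t * (px x t * (1 / \<kappa>))\<bar> \<le> B * ((B * time_weight t) * B)"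
    by (intro abs_mult_mono coeff_bounds abs_bounds px assms)
  also have "\<dots> = B ^ 3 * time_weight t" by algebra
  also have "\<dots> \<le> B ^ 5 * time_weight t" using tw B by (intro mult_right_mono power_increasing) auto
  finally have 2: "\<bar>h x t * (px x t * (1 / \<kappa>))\<bar> \<le> B ^ 5 * time_weight t" .
  have "hxx x t = 2 * (hx x t * (p x t * (1 / \<kappa>))) + 2 * (h x t * (px x t * (1 / \<kappa>)))"
    using kap_pos by (simp add: hxx_def field_simps)
  then show ?thesis using 1 2 by linarith
qed

text \<open>The pressure of v = T = h is constantly 1, so each term contains a deviation from the
  profile. Eliminating \<open>vx\<close> in favour of \<open>z\<close> exposes the term -T z /
  (\<mu> v), which is the damping.\<close>

lemma Px_eq:
  assumes "t \<ge> 0"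
  shows "Px x t = (Tx x t - hx x t) * (1 / v x t) - T x t * (1 / v x t) * (1 / \<mu>) * (z x t + (u x t - p x t))
    + 2 * p x t * (h x t - T x t) * (1 / v x t) * (1 / \<kappa>)"
  using pos[OF assms, of x] mu_pos kap_pos
  by (simp add: Px_def hx_def z_def field_simps power2_eq_square)

lemma vx_eq:
  assumes "t \<ge> 0"
  shows "vx x t - hx x t = v x t * (1 / \<mu>) * (z x t + (u x t - p x t)) + 2 * (v x t - h x t) * p x t * (1 / \<kappa>)"
  using pos[OF assms, of x] mu_pos kap_pos
  by (simp add: hx_def z_def field_simps power2_eq_square)

text \<open>Since v_t = u_x, the time derivative of \<mu> v_x / v is the x-derivative of \<mu> u_x /
  v, that is, the viscous term. It cancels against the one in the momentum equation and leaves the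
  pressure gradient and the profile term.\<close>

lemma z_t:
  assumes "t > 0"
  shows "(z x has_real_derivative Px x t / \<epsilon>\<^sup>2 - (2 * \<mu> / \<kappa> - 1) * pt x t) (at t)"
proof -
  have "v x t \<noteq> 0" using pos[of t x] assms by auto
  have "(z x has_real_derivative \<mu> * (uxx x t / v x t - ux x t * vx x t / (v x t)\<^sup>2) - ut x t
      - (2 * \<mu> / \<kappa> - 1) * pt x t) (at t)"
    unfolding z_def
    by (rule derivative_eq_intros vx_t v_t u_t p_t refl | use assms \<open>v x t \<noteq> 0\<close> in \<open>simp add: field_simps power2_eq_square\<close>)+
  moreover have "\<mu> * (uxx x t / v x t - ux x t * vx x t / (v x t)\<^sup>2) - ut x t = Px x t / \<epsilon>\<^sup>2"
    using momentum[OF assms, of x] by (simp add: Px_def)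
  ultimately show ?thesis by simp
qed

text \<open>The coefficient \<open>2 * \<mu> / \<kappa> - 1\<close> in \<open>z\<close> is chosen
  for this: on the profile, \<mu> h_x / h = (2 \<mu> / \<kappa>) p, and all terms cancel. There is
  no initial layer to be damped out.\<close>

lemma z_init: "z x 0 = 0"
proof -
  have "((\<lambda>y. h y 0) has_real_derivative vx x 0) (at x)" using v_x[of 0 x] by (simp add: init)
  then have "vx x 0 = 2 * h x 0 * p x 0 / \<kappa>" using h_x[of 0 x] DERIV_unique by auto
  then show ?thesis using pos(3)[of 0 x] kap_pos
    by (simp add: z_def init field_simps)
qed

lemma cont_slices:
  assumes "S \<subseteq> {0..}"
  shows "continuous_on S (h x)" "continuous_on S (p x)" "continuous_on S (v x)" "continuous_on S (vx x)"
    "continuous_on S (u x)" "continuous_on S (T x)"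
  using conts[THEN continuous_on_time_slice[OF _ assms]] by auto

lemma z_cont: "continuous_on {0..t} (z x)"
  unfolding z_def using pos(1)
  by (intro continuous_intros cont_slices) (auto simp: less_imp_neq[symmetric])

lemma e_eps_weight:
  assumes "t \<ge> 0" shows "e * \<epsilon> * time_weight t \<le> e * time_weight t"
proof -
  have "e * \<epsilon> \<le> e * 1" using eps e_pos by (intro mult_left_mono) auto
  then show ?thesis using time_weight_pos[OF assms] by (intro mult_right_mono) auto
qed

lemma pressure_remainder_bound:
  assumes "t \<ge> 0"
  shows "\<bar>2 * p x t * (h x t - T x t) * (1 / v x t) * (1 / \<kappa>)\<bar> \<le> 2 * B ^ 3 * e * time_weight t"
proof -
  note tw = time_weight_pos[OF assms] time_weight_le_1[OF assms]
  have hT: "\<bar>h x t - T x t\<bar> \<le> e * time_weight t"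
    using T_near[OF assms, of x] e_eps_weight[OF assms] by (simp add: abs_minus_commute)
  have "\<bar>2 * (p x t * ((h x t - T x t) * ((1 / v x t) * (1 / \<kappa>))))\<bar>
      \<le> 2 * (B * time_weight t * (e * time_weight t * (B * B)))"
    by (intro abs_mult_mono coeff_bounds abs_bounds p hT assms) auto
  also have "\<dots> = 2 * B ^ 3 * e * time_weight t * time_weight t" by algebra
  also have "\<dots> \<le> 2 * B ^ 3 * e * time_weight t * 1" using tw B_pos e_pos by (intro mult_left_mono) auto
  finally show ?thesis by (simp add: mult_ac)
qed

text \<open>The equation for \<open>z\<close> is an ordinary differential equation at each fixed x,
  so control of T_x at this x over the whole past suffices. The supersolution is a multiple of the
  decay weight: half of the damping rate, at least 1 / (B^3 \<epsilon>^2) \<ge> 1, absorbs the decay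
  of the weight, and the other half beats the forcing.\<close>

lemma z_bound:
  assumes N: "N \<ge> 0" and t1: "t1 \<ge> 0"
    and Tx: "\<And>t. 0 \<le> t \<Longrightarrow> t \<le> t1 \<Longrightarrow> \<bar>Tx x t - hx x t\<bar> \<le> N * time_weight t"
  shows "\<bar>z x t1\<bar> \<le> 30 * B ^ 6 * (N + e) * time_weight t1"
proof -
  \<comment> \<open>Half of the damping yields (c / 2) / B^3 = 15 B^3 (N + e), which exceeds the
    factor B N + 6 B^3 e bounding \<open>G\<close>.\<close>
  define c where "c = 30 * B ^ 6 * (N + e)"
  have c: "c > 0" using N e_pos B_pos by (simp add: c_def)
  define a where "a = (\<lambda>t. T x t * (1 / v x t) * (1 / \<mu>) / \<epsilon>\<^sup>2)"
  define G where "G = (\<lambda>t. (Tx x t - hx x t) * (1 / v x t) - T x t * (1 / v x t) * (1 / \<mu>) * (u x t - p x t)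
    + 2 * p x t * (h x t - T x t) * (1 / v x t) * (1 / \<kappa>) - \<epsilon>\<^sup>2 * ((2 * \<mu> / \<kappa> - 1) * pt x t))"
  have dz: "(z x has_real_derivative - a t * z x t + G t / \<epsilon>\<^sup>2) (at t)" if "t > 0" for t
  proof -
    have "Px x t / \<epsilon>\<^sup>2 - (2 * \<mu> / \<kappa> - 1) * pt x t = - a t * z x t + G t / \<epsilon>\<^sup>2"
      using eps(1) that by (simp add: Px_eq G_def a_def add_divide_distrib diff_divide_distrib algebra_simps)
    then show ?thesis using z_t[OF that, of x] by simp
  qed
  have dz': "((\<lambda>t. - z x t) has_real_derivative - a t * (- z x t) + (- G t / \<epsilon>\<^sup>2)) (at t)" if "t > 0" for t
    using DERIV_minus[OF dz[OF that]] by simp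
  have a: "a t \<ge> 1 / B ^ 3 / \<epsilon>\<^sup>2" if "t \<ge> 0" for t
  proof -
    have "(1 / B) * (1 / B) * (1 / B) \<le> T x t * (1 / v x t) * (1 / \<mu>)"
      using T[OF that, of x] v[OF that, of x] mu B_pos mu_pos pos[OF that, of x]
      by (intro mult_mono) (auto simp: field_simps)
    then show ?thesis unfolding a_def by (intro divide_right_mono) (auto simp: power3_eq_cube)
  qed
  have Gb: "\<bar>G t\<bar> \<le> (B * N + 6 * B ^ 3 * e) * time_weight t" if "0 < t" "t \<le> t1" for t
  proof -
    have t: "t \<ge> 0" using that by simp
    note tw = time_weight_pos[OF t] time_weight_le_1[OF t]
    have 1: "\<bar>(Tx x t - hx x t) * (1 / v x t)\<bar> \<le> N * time_weight t * B"
      using that by (intro abs_mult_mono Tx abs_bounds) auto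
    have 2: "\<bar>T x t * (1 / v x t) * (1 / \<mu>) * (u x t - p x t)\<bar> \<le> B * B * B * (e * time_weight t)"
      by (intro abs_mult_mono coeff_bounds abs_bounds u_near t)
    have "\<bar>2 * (\<mu> * (1 / \<kappa>))\<bar> \<le> 2 * (B * B)"
      by (intro abs_mult_mono coeff_bounds) auto
    moreover have "1 \<le> B * B" using B by (metis mult_mono' one_le_numeral mult_1 zero_le_one)
    moreover have "2 * (\<mu> * (1 / \<kappa>)) = 2 * \<mu> / \<kappa>" by simp
    ultimately have k: "\<bar>2 * \<mu> / \<kappa> - 1\<bar> \<le> 3 * (B * B)" by linarith
    have "\<bar>\<epsilon>\<^sup>2\<bar> \<le> e" using eps by (simp add: power2_eq_square mult_le_one order_trans[OF mult_left_le])
    then have "\<bar>\<epsilon>\<^sup>2 * ((2 * \<mu> / \<kappa> - 1) * pt x t)\<bar> \<le> e * (3 * (B * B) * (B * time_weight t))"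
      by (intro abs_mult_mono k pt t)
    moreover have "(B * N + 6 * B ^ 3 * e) * time_weight t = N * time_weight t * B
        + B * B * B * (e * time_weight t) + 2 * B ^ 3 * e * time_weight t
        + e * (3 * (B * B) * (B * time_weight t))"
      by algebra
    ultimately show ?thesis using 1 2 pressure_remainder_bound[OF t, of x]
      unfolding G_def by linarith
  qed
  have key: "\<bar>G t\<bar> / \<epsilon>\<^sup>2 < a t * (c * time_weight t) + c * - (time_weight t ^ 3 / 2)"
    if "0 < t" "t \<le> t1" for t
  proof -
    have t: "t \<ge> 0" using that by simp
    note tw = time_weight_pos[OF t] time_weight_le_1[OF t]
    have "time_weight t ^ 3 \<le> time_weight t" using tw by (simp add: power3_eq_cube mult_le_one)
    then have 1: "c * (time_weight t ^ 3 / 2) \<le> c * time_weight t / 2" using c by simp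
    have e2: "1 \<le> 1 / B ^ 3 / \<epsilon>\<^sup>2" using eps B_pos by (simp add: field_simps)
    have *: "a - r / 2 \<ge> q / 2" if "q \<le> a" "1 * r \<le> q" for a q r :: real
      using that by simp
    have "a t * (c * time_weight t) \<ge> 1 / B ^ 3 / \<epsilon>\<^sup>2 * (c * time_weight t)"
      using a[OF t] c tw by (intro mult_right_mono) auto
    moreover have "1 / B ^ 3 / \<epsilon>\<^sup>2 * (c * time_weight t) \<ge> 1 * (c * time_weight t)"
      using e2 c tw by (intro mult_right_mono) auto
    ultimately have 2: "a t * (c * time_weight t) - c * time_weight t / 2 \<ge> 1 / B ^ 3 / \<epsilon>\<^sup>2 * (c * time_weight t) / 2"
      by (rule *)
    have 3: "1 / B ^ 3 / \<epsilon>\<^sup>2 * (c * time_weight t) / 2 = 15 * B ^ 3 * (N + e) * time_weight t / \<epsilon>\<^sup>2"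
      using B_pos eps by (simp add: c_def field_simps power_numeral_reduce)
    have "B * N \<le> B ^ 3 * N" using N B power_increasing[of 1 3 B] by (intro mult_right_mono) auto
    moreover have "B ^ 3 * e > 0" "B ^ 3 * N \<ge> 0" using B_pos e_pos N by auto
    ultimately have "B * N + 6 * B ^ 3 * e < 15 * B ^ 3 * (N + e)" by (simp add: algebra_simps)
    then have "(B * N + 6 * B ^ 3 * e) * time_weight t < 15 * B ^ 3 * (N + e) * time_weight t"
      using tw by simp
    then have "\<bar>G t\<bar> < 15 * B ^ 3 * (N + e) * time_weight t" using Gb[OF that] by linarith
    then have "\<bar>G t\<bar> / \<epsilon>\<^sup>2 < 15 * B ^ 3 * (N + e) * time_weight t / \<epsilon>\<^sup>2"
      using eps by (intro divide_strict_right_mono) auto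
    then show ?thesis using 1 2 3 by linarith
  qed
  have key': "G t / \<epsilon>\<^sup>2 < a t * (c * time_weight t) + c * - (time_weight t ^ 3 / 2)"
    "- G t / \<epsilon>\<^sup>2 < a t * (c * time_weight t) + c * - (time_weight t ^ 3 / 2)"
    if "0 < t" "t \<le> t1" for t
    using key[OF that] abs_divide[of "G t" "\<epsilon>\<^sup>2"] by (simp_all only: abs_power2 minus_divide_left[symmetric])
  have cw: "continuous_on {0..t1} (\<lambda>t. c * time_weight t)"
    unfolding time_weight_def by (intro continuous_intros) auto
  have dw: "((\<lambda>t. c * time_weight t) has_real_derivative c * - (time_weight t ^ 3 / 2)) (at t)" if "t > 0" for t
    using that by (intro DERIV_cmult DERIV_time_weight) auto
  have a0: "a t \<ge> 0" if "t > 0" for t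
    using order_trans[OF _ a[of t]] that B_pos by simp
  have z0: "z x 0 \<le> c * time_weight 0" "- z x 0 \<le> c * time_weight 0"
    using c time_weight_pos[of 0] by (simp_all add: z_init)
  have "z x t1 \<le> c * time_weight t1"
    by (rule damped_ode_upper_bound[OF t1 z_cont cw dz dw a0 _ z0(1)])
      (use key' in auto)
  moreover have "- z x t1 \<le> c * time_weight t1"
    by (rule damped_ode_upper_bound[OF t1 continuous_on_minus[OF z_cont] cw dz' dw a0 _ z0(2)])
      (use key' in auto)
  ultimately show ?thesis by (simp add: c_def)
qed

text \<open>The passage from \<open>z\<close> to \<open>vx\<close> and \<open>Px\<close> is
  algebraic and costs only powers of \<open>B\<close>. The bound on \<open>Px\<close> stays
  proportional to N + e, as the factor 1 / \<epsilon>^2 in front of it in the momentum equation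
  requires.\<close>

lemma vx_bound:
  assumes "N \<ge> 0" "t1 \<ge> 0"
    and "\<And>t. 0 \<le> t \<Longrightarrow> t \<le> t1 \<Longrightarrow> \<bar>Tx x t - hx x t\<bar> \<le> N * time_weight t"
  shows "\<bar>vx x t1 - hx x t1\<bar> \<le> 33 * B ^ 8 * (N + e) * time_weight t1"
    and "\<bar>Px x t1\<bar> \<le> 34 * B ^ 9 * (N + e) * time_weight t1"
proof -
  define w where "w = time_weight t1"
  have w: "w > 0" "w \<le> 1" using time_weight_pos time_weight_le_1 assms(2) by (auto simp: w_def)
  have zb: "\<bar>z x t1\<bar> \<le> 30 * B ^ 6 * (N + e) * w" unfolding w_def by (rule z_bound[OF assms])
  have Bp: "B ^ m \<le> B ^ n" if "m \<le> n" for m n using B that by (rule power_increasing[rotated])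
  have ew: "e * w \<ge> 0" "N * w \<ge> 0" using e_pos w assms by auto
  have zu: "\<bar>z x t1 + (u x t1 - p x t1)\<bar> \<le> 31 * B ^ 6 * ((N + e) * w)"
  proof -
    have "1 * (e * w) \<le> B ^ 6 * (e * w)" using ew B by (intro mult_right_mono) auto
    moreover have "B ^ 6 * (N * w) \<ge> 0" using ew B_pos by simp
    ultimately show ?thesis
      using zb u_near[OF assms(2), of x] unfolding w_def[symmetric] by (simp add: algebra_simps)
  qed
  have "\<bar>v x t1 * (1 / \<mu>) * (z x t1 + (u x t1 - p x t1))\<bar> \<le> B * B * (31 * B ^ 6 * ((N + e) * w))"
    by (intro abs_mult_mono abs_bounds coeff_bounds assms zu)
  also have "\<dots> = 31 * B ^ 8 * ((N + e) * w)" by algebra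
  finally have 1: "\<bar>v x t1 * (1 / \<mu>) * (z x t1 + (u x t1 - p x t1))\<bar> \<le> 31 * B ^ 8 * ((N + e) * w)" .
  have vh: "\<bar>v x t1 - h x t1\<bar> \<le> e * w"
    using v_near[OF assms(2), of x] e_eps_weight[OF assms(2)] unfolding w_def by linarith
  have "\<bar>2 * ((v x t1 - h x t1) * (p x t1 * (1 / \<kappa>)))\<bar> \<le> 2 * ((e * w) * ((B * w) * B))"
    using p[OF assms(2), of x] unfolding w_def[symmetric] by (intro abs_mult_mono vh coeff_bounds) auto
  also have "\<dots> = 2 * B ^ 2 * (e * w) * w" by algebra
  also have "\<dots> \<le> 2 * B ^ 2 * (e * w) * 1" using w ew B_pos by (intro mult_left_mono) auto
  also have "\<dots> \<le> 2 * B ^ 8 * (e * w) * 1" using ew Bp[of 2 8] by (intro mult_right_mono) auto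
  also have "\<dots> \<le> 2 * B ^ 8 * ((N + e) * w)" using assms(1) w B_pos by (simp add: algebra_simps)
  finally have 2: "\<bar>2 * ((v x t1 - h x t1) * (p x t1 * (1 / \<kappa>)))\<bar> \<le> 2 * B ^ 8 * ((N + e) * w)" .
  have vx_split: "vx x t1 - hx x t1 = v x t1 * (1 / \<mu>) * (z x t1 + (u x t1 - p x t1))
      + 2 * ((v x t1 - h x t1) * (p x t1 * (1 / \<kappa>)))"
    by (simp add: vx_eq[OF assms(2)])
  show "\<bar>vx x t1 - hx x t1\<bar> \<le> 33 * B ^ 8 * (N + e) * time_weight t1"
  proof -
    have *: "33 * B ^ 8 * (N + e) * w = 31 * B ^ 8 * ((N + e) * w) + 2 * B ^ 8 * ((N + e) * w)" by algebra
    show ?thesis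
      unfolding w_def[symmetric] vx_split * by (rule abs_add_mono[OF 1 2])
  qed
  have "\<bar>(Tx x t1 - hx x t1) * (1 / v x t1)\<bar> \<le> N * w * B"
    unfolding w_def using assms by (intro abs_mult_mono abs_bounds) auto
  also have "\<dots> \<le> B ^ 9 * (N * w)" using mult_right_mono[OF Bp[of 1 9] ew(2)] by (simp add: mult_ac)
  finally have 3: "\<bar>(Tx x t1 - hx x t1) * (1 / v x t1)\<bar> \<le> B ^ 9 * (N * w)" .
  have "\<bar>T x t1 * (1 / v x t1) * (1 / \<mu>) * (z x t1 + (u x t1 - p x t1))\<bar> \<le> B * B * B * (31 * B ^ 6 * ((N + e) * w))"
    by (intro abs_mult_mono abs_bounds coeff_bounds assms zu)
  also have "\<dots> = 31 * B ^ 9 * ((N + e) * w)" by algebra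
  finally have 4: "\<bar>T x t1 * (1 / v x t1) * (1 / \<mu>) * (z x t1 + (u x t1 - p x t1))\<bar> \<le> 31 * B ^ 9 * ((N + e) * w)" .
  have "2 * B ^ 3 * (e * w) \<le> 2 * B ^ 9 * (e * w)" using ew Bp[of 3 9] by (intro mult_right_mono) auto
  then have 5: "\<bar>2 * p x t1 * (h x t1 - T x t1) * (1 / v x t1) * (1 / \<kappa>)\<bar> \<le> 2 * B ^ 9 * (e * w)"
    using pressure_remainder_bound[OF assms(2), of x] unfolding w_def[symmetric] by (simp add: mult.assoc)
  have "B ^ 9 * (N * w) \<ge> 0" "B ^ 9 * (e * w) \<ge> 0" using ew B_pos by auto
  then have "B ^ 9 * (N * w) + 31 * B ^ 9 * ((N + e) * w) + 2 * B ^ 9 * (e * w) \<le> 34 * B ^ 9 * (N + e) * w"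
    by (simp add: algebra_simps)
  then show "\<bar>Px x t1\<bar> \<le> 34 * B ^ 9 * (N + e) * time_weight t1"
    unfolding Px_eq[OF assms(2)] w_def[symmetric]
    by (rule order_trans[rotated]) (intro abs_add_mono abs_diff_mono 3 4 5)
qed

section \<open>Lower-order terms of the parabolic equations\<close>

definition FT :: "real \<Rightarrow> real \<Rightarrow> real" where
  "FT x t = \<kappa> * hxx x t / v x t - \<kappa> * Tx x t * vx x t / (v x t)\<^sup>2 - T x t / v x t * ux x t
     + \<epsilon>\<^sup>2 * \<mu> * (ux x t)\<^sup>2 / v x t - px x t"

definition Fu :: "real \<Rightarrow> real \<Rightarrow> real" where
  "Fu x t = \<mu> * pxx x t / v x t - \<mu> * ux x t * vx x t / (v x t)\<^sup>2 - Px x t / \<epsilon>\<^sup>2 - pt x t"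

lemma hx_x: "t \<ge> 0 \<Longrightarrow> ((\<lambda>y. hx y t) has_real_derivative hxx x t) (at x)"
  unfolding hx_def hxx_def using kap_pos
  by (auto intro!: derivative_eq_intros h_x p_x simp: field_simps)

text \<open>The diffusion is arranged to act on T - h and u - p, the quantities known to be small.
  The price is that \<open>FT\<close> and \<open>Fu\<close> contain the second space derivative and
  the time derivative of the profile, which are bounded but carry no factor e.\<close>

lemma heat_equations:
  assumes "t > 0"
  shows "Tt x t - px x t = \<kappa> / v x t * (Txx x t - hxx x t) + FT x t"
    and "ut x t - pt x t = \<mu> / v x t * (uxx x t - pxx x t) + Fu x t"
proof -
  show "Tt x t - px x t = \<kappa> / v x t * (Txx x t - hxx x t) + FT x t"
    by (simp add: energy[OF assms] FT_def algebra_simps diff_divide_distrib)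
  have "ut x t = \<mu> * (uxx x t / v x t - ux x t * vx x t / (v x t)\<^sup>2) - Px x t / \<epsilon>\<^sup>2"
    using momentum[OF assms, of x] by (simp add: Px_def)
  then show "ut x t - pt x t = \<mu> / v x t * (uxx x t - pxx x t) + Fu x t"
    by (simp add: Fu_def algebra_simps diff_divide_distrib)
qed

text \<open>\<open>D\<close> is the inverse of the relative distance to the lateral boundary of a box.\<close>

lemma lower_order_bounds:
  assumes D: "D \<ge> 1" and \<Lambda>: "0 \<le> \<Lambda>" "\<Lambda> \<le> 1" and t1: "t1 \<ge> 0"
    and Txb: "\<And>t. 0 \<le> t \<Longrightarrow> t \<le> t1 \<Longrightarrow> \<bar>Tx x t - hx x t\<bar> \<le> \<Lambda> * D * time_weight t"
    and uxb: "\<epsilon> * \<bar>ux x t1 - px x t1\<bar> \<le> \<Lambda> * D * time_weight t1"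
  shows "\<bar>FT x t1\<bar> \<le> 216 * B ^ 14 * (\<Lambda> + e) / \<epsilon> * D\<^sup>2 * time_weight t1"
    and "\<bar>Fu x t1\<bar> \<le> 104 * B ^ 12 * (\<Lambda> + e) / \<epsilon>\<^sup>2 * D\<^sup>2 * time_weight t1"
proof -
  define w where "w = time_weight t1"
  have w: "w > 0" "w \<le> 1" using time_weight_pos time_weight_le_1 t1 by (auto simp: w_def)
  \<comment> \<open>\<open>E \<ge> 1\<close> because \<epsilon> \<le> e. Terms without a small
    factor, such as the one with \<open>hxx\<close>, are therefore still bounded by a multiple of
    (\<Lambda> + e) / \<epsilon>.\<close>
  define E where "E = (\<Lambda> + e) / \<epsilon>"
  have E: "E \<ge> 1" using eps \<Lambda> by (auto simp: E_def field_simps)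
  have Bp: "B ^ m \<le> B ^ n" if "m \<le> n" for m n using B that by (rule power_increasing[rotated])
  have B1: "1 \<le> B ^ n" for n using B by simp
  \<comment> \<open>A product of two gradients costs D^2 and the square of the weight. All other
    terms are brought to the same form by D \<ge> 1, and one of the two weights is dropped.\<close>
  have DD: "1 \<le> D\<^sup>2" "D \<le> D\<^sup>2" "w * w \<le> w" "D\<^sup>2 \<ge> 0"
    using D w mult_mono[OF D D] by (auto simp: power2_eq_square mult_le_one)
  have ND: "\<Lambda> * D \<ge> 0" using \<Lambda> D by simp
  have LD: "\<Lambda> * D + e \<le> (\<Lambda> + e) * D" using mult_left_mono[OF D, of e] e_pos by (simp add: algebra_simps)
  have L2: "(\<Lambda> + e) * D \<le> 2 * D" using e_le_1 \<Lambda> D by (intro mult_right_mono) auto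
  note tx = Txb[OF t1 order_refl, folded w_def]
  note vb = vx_bound(1)[OF ND t1 Txb, folded w_def]
  note Pb = vx_bound(2)[OF ND t1 Txb, folded w_def]
  note hb = hx_bound[OF t1, of x, folded w_def]
  have vx: "\<bar>vx x t1\<bar> \<le> 68 * B ^ 8 * D * w"
  proof -
    have "33 * B ^ 8 * (\<Lambda> * D + e) * w \<le> 33 * B ^ 8 * (2 * D) * w"
      using LD L2 B_pos w by (intro mult_right_mono mult_left_mono) auto
    moreover have "2 * B ^ 3 * w \<le> 2 * (B ^ 8 * D) * w"
      using mult_mono[OF Bp[of 3 8] D] B_pos w by (intro mult_right_mono mult_left_mono) auto
    ultimately show ?thesis using vb hb by (simp add: algebra_simps)
  qed
  have Tx: "\<bar>Tx x t1\<bar> \<le> 3 * B ^ 3 * D * w"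
  proof -
    have "\<Lambda> * D * w \<le> B ^ 3 * D * w" using \<Lambda> B1[of 3] D w by (intro mult_right_mono) auto
    moreover have "2 * B ^ 3 * w \<le> 2 * (B ^ 3 * D) * w"
      using mult_mono[OF Bp[of 3 3] D] B_pos w by (intro mult_right_mono mult_left_mono) auto
    ultimately show ?thesis using tx hb by (simp add: algebra_simps)
  qed
  have eux: "\<bar>\<epsilon> * ux x t1\<bar> \<le> (\<Lambda> + B * e) * D * w"
  proof -
    have "\<epsilon> * \<bar>px x t1\<bar> \<le> e * (B * w)"
      using eps e_pos px[OF t1, of x] B_pos w unfolding w_def by (intro mult_mono) auto
    also have "\<dots> \<le> e * (B * w) * D" using mult_left_mono[OF D, of "e * (B * w)"] e_pos B_pos w by simp
    finally have "\<epsilon> * \<bar>px x t1\<bar> \<le> B * e * D * w" by (simp add: mult_ac)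
    moreover have "\<bar>\<epsilon> * ux x t1\<bar> \<le> \<epsilon> * \<bar>ux x t1 - px x t1\<bar> + \<epsilon> * \<bar>px x t1\<bar>"
      using eps by (simp add: abs_mult distrib_left[symmetric])
    ultimately show ?thesis using uxb unfolding w_def[symmetric] by (simp add: algebra_simps)
  qed
  have ux: "\<bar>ux x t1\<bar> \<le> B * E * D * w"
  proof -
    have "\<Lambda> + B * e \<le> B * (\<Lambda> + e)" using mult_right_mono[OF B \<Lambda>(1)] by (simp add: algebra_simps)
    then have "(\<Lambda> + B * e) * D * w \<le> B * (\<Lambda> + e) * D * w" using D w by (intro mult_right_mono) auto
    then have "\<bar>\<epsilon> * ux x t1\<bar> \<le> B * (\<Lambda> + e) * D * w" using eux by simp
    then show ?thesis using eps by (simp add: E_def abs_mult field_simps)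
  qed
  have eux': "\<bar>\<epsilon> * ux x t1\<bar> \<le> 2 * B * D * w"
  proof -
    have "B * e \<le> B * 1" using e_le_1 B_pos by (intro mult_left_mono) auto
    then have "\<Lambda> + B * e \<le> 2 * B" using \<Lambda> B by linarith
    then have "(\<Lambda> + B * e) * D * w \<le> 2 * B * D * w" using D w by (intro mult_right_mono) auto
    then show ?thesis using eux by simp
  qed
  have ED: "w \<le> E * D\<^sup>2 * w" "D\<^sup>2 * w \<le> E * D\<^sup>2 * w" "D * w \<le> D\<^sup>2 * w"
  proof -
    have "1 * 1 \<le> E * D\<^sup>2" using E DD by (intro mult_mono) auto
    then have "1 * w \<le> E * D\<^sup>2 * w" using w by (intro mult_right_mono) auto
    then show "w \<le> E * D\<^sup>2 * w" by simp
    show "D\<^sup>2 * w \<le> E * D\<^sup>2 * w" "D * w \<le> D\<^sup>2 * w" using w DD mult_right_mono[OF E DD(4)] by (auto intro!: mult_right_mono)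
  qed
  define W where "W = E * D\<^sup>2 * w"
  have W: "W \<ge> 0" using E DD w by (simp add: W_def)
  note t0 = abs_bounds[OF t1, of x]
  have 1: "\<bar>\<kappa> * hxx x t1 * (1 / v x t1)\<bar> \<le> 6 * B ^ 14 * W"
  proof -
    have "\<bar>\<kappa> * hxx x t1 * (1 / v x t1)\<bar> \<le> B * (6 * B ^ 5 * w) * B"
      unfolding w_def by (intro abs_mult_mono coeff_bounds t0 hxx_bound t1)
    also have "\<dots> = 6 * B ^ 7 * w" by algebra
    also have "\<dots> \<le> 6 * B ^ 14 * W" using Bp[of 7 14] ED W_def w B_pos by (intro mult_mono) auto
    finally show ?thesis .
  qed
  have 2: "\<bar>\<kappa> * Tx x t1 * vx x t1 * ((1 / v x t1) * (1 / v x t1))\<bar> \<le> 204 * B ^ 14 * W"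
  proof -
    have "\<bar>\<kappa> * Tx x t1 * vx x t1 * ((1 / v x t1) * (1 / v x t1))\<bar> \<le> B * (3 * B ^ 3 * D * w) * (68 * B ^ 8 * D * w) * (B * B)"
      by (intro abs_mult_mono coeff_bounds t0 Tx vx)
    also have "\<dots> = 204 * B ^ 14 * (D\<^sup>2 * (w * w))" by algebra
    also have "\<dots> \<le> 204 * B ^ 14 * (D\<^sup>2 * w)" using B_pos DD by (intro mult_left_mono) auto
    also have "\<dots> \<le> 204 * B ^ 14 * W" using ED W_def B_pos by (intro mult_left_mono) auto
    finally show ?thesis .
  qed
  have 3: "\<bar>T x t1 * (1 / v x t1) * ux x t1\<bar> \<le> B ^ 14 * W"
  proof -
    have "\<bar>T x t1 * (1 / v x t1) * ux x t1\<bar> \<le> B * B * (B * E * D * w)"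
      by (intro abs_mult_mono t0 ux)
    also have "\<dots> = B ^ 3 * (E * (D * w))" by algebra
    also have "\<dots> \<le> B ^ 14 * (E * (D\<^sup>2 * w))" using Bp[of 3 14] ED E w D B_pos by (intro mult_mono) auto
    finally show ?thesis by (simp add: W_def mult_ac)
  qed
  have 4: "\<bar>\<mu> * ((\<epsilon> * ux x t1) * (\<epsilon> * ux x t1)) * (1 / v x t1)\<bar> \<le> 4 * B ^ 14 * W"
  proof -
    have "\<bar>\<mu> * ((\<epsilon> * ux x t1) * (\<epsilon> * ux x t1)) * (1 / v x t1)\<bar> \<le> B * ((2 * B * D * w) * (2 * B * D * w)) * B"
      by (intro abs_mult_mono coeff_bounds t0 eux')
    also have "\<dots> = 4 * B ^ 4 * (D\<^sup>2 * (w * w))" by algebra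
    also have "\<dots> \<le> 4 * B ^ 4 * (D\<^sup>2 * w)" using B_pos DD by (intro mult_left_mono) auto
    also have "\<dots> \<le> 4 * B ^ 14 * W" using ED W_def B_pos Bp[of 4 14] w by (intro mult_mono) auto
    finally show ?thesis .
  qed
  have 5: "\<bar>px x t1\<bar> \<le> B ^ 14 * W" "\<bar>pt x t1\<bar> \<le> B ^ 12 * W"
  proof -
    have wW: "w \<le> W" using ED(1) by (simp add: W_def)
    have "B ^ 1 * w \<le> B ^ 14 * W" "B ^ 1 * w \<le> B ^ 12 * W"
      using wW w B_pos by (intro mult_mono Bp; simp)+
    then show "\<bar>px x t1\<bar> \<le> B ^ 14 * W" "\<bar>pt x t1\<bar> \<le> B ^ 12 * W"
      using px[OF t1, of x] pt[OF t1, of x] by (auto simp: w_def)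
  qed
  have FT: "FT x t1 = \<kappa> * hxx x t1 * (1 / v x t1) - \<kappa> * Tx x t1 * vx x t1 * ((1 / v x t1) * (1 / v x t1))
      - T x t1 * (1 / v x t1) * ux x t1 + \<mu> * ((\<epsilon> * ux x t1) * (\<epsilon> * ux x t1)) * (1 / v x t1) - px x t1"
    by (simp add: FT_def power2_eq_square mult_ac)
  have sum: "6 * B ^ 14 * W + 204 * B ^ 14 * W + B ^ 14 * W + 4 * B ^ 14 * W + B ^ 14 * W = 216 * (B ^ 14 * W)"
    by simp
  have "\<bar>FT x t1\<bar> \<le> 216 * (B ^ 14 * W)"
    using abs_diff_mono[OF abs_add_mono[OF abs_diff_mono[OF abs_diff_mono[OF 1 2] 3] 4] 5(1)]
    unfolding FT sum .
  then show "\<bar>FT x t1\<bar> \<le> 216 * B ^ 14 * (\<Lambda> + e) / \<epsilon> * D\<^sup>2 * time_weight t1"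
    by (simp add: W_def E_def w_def)
  have 6: "\<bar>\<mu> * pxx x t1 * (1 / v x t1)\<bar> \<le> B ^ 12 * W"
  proof -
    have "\<bar>\<mu> * pxx x t1 * (1 / v x t1)\<bar> \<le> B * (B * w) * B"
      unfolding w_def by (intro abs_mult_mono coeff_bounds t0 pxx t1)
    also have "\<dots> = B ^ 3 * w" by algebra
    also have "\<dots> \<le> B ^ 12 * W" using Bp[of 3 12] ED W_def w B_pos by (intro mult_mono) auto
    finally show ?thesis .
  qed
  have 7: "\<bar>\<mu> * ux x t1 * vx x t1 * ((1 / v x t1) * (1 / v x t1))\<bar> \<le> 68 * B ^ 12 * W"
  proof -
    have "\<bar>\<mu> * ux x t1 * vx x t1 * ((1 / v x t1) * (1 / v x t1))\<bar> \<le> B * (B * E * D * w) * (68 * B ^ 8 * D * w) * (B * B)"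
      by (intro abs_mult_mono coeff_bounds t0 ux vx)
    also have "\<dots> = 68 * B ^ 12 * (E * D\<^sup>2 * (w * w))" by algebra
    also have "\<dots> \<le> 68 * B ^ 12 * (E * D\<^sup>2 * w)" using B_pos DD E by (intro mult_left_mono) auto
    finally show ?thesis by (simp add: W_def)
  qed
  \<comment> \<open>The stiff term: it sets the order (\<Lambda> + e) / \<epsilon>^2 of
    \<open>Fu\<close>, one power of 1 / \<epsilon> above \<open>FT\<close>. This is consistent with
    measuring \<epsilon> u_x rather than u_x.\<close>
  have 8: "\<bar>Px x t1 / \<epsilon>\<^sup>2\<bar> \<le> 34 * B ^ 12 * (W / \<epsilon>)"
  proof -
    have "\<bar>Px x t1\<bar> \<le> 34 * B ^ 9 * ((\<Lambda> * D + e) * w)" using Pb by (simp add: mult_ac)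
    also have "\<dots> \<le> 34 * B ^ 12 * (((\<Lambda> + e) * D) * w)"
      using Bp[of 9 12] LD w B_pos e_pos \<Lambda> D by (intro mult_mono mult_right_mono) auto
    also have "\<dots> = 34 * B ^ 12 * ((\<Lambda> + e) * (D * w))" by (simp add: mult_ac)
    also have "\<dots> \<le> 34 * B ^ 12 * ((\<Lambda> + e) * (D\<^sup>2 * w))"
      using ED B_pos e_pos \<Lambda> by (intro mult_left_mono) auto
    finally have "\<bar>Px x t1\<bar> / \<epsilon>\<^sup>2 \<le> 34 * B ^ 12 * ((\<Lambda> + e) * (D\<^sup>2 * w)) / \<epsilon>\<^sup>2"
      using eps by (intro divide_right_mono) auto
    then show ?thesis by (simp add: W_def E_def power2_eq_square mult_ac)
  qed
  have "W * \<epsilon> \<le> W * 1" using eps W by (intro mult_left_mono) auto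
  then have We: "W \<le> W / \<epsilon>" using eps by (simp add: field_simps)
  have We': "B ^ 12 * W \<le> B ^ 12 * (W / \<epsilon>)" using We B_pos by (intro mult_left_mono) auto
  have Fu: "Fu x t1 = \<mu> * pxx x t1 * (1 / v x t1) - \<mu> * ux x t1 * vx x t1 * ((1 / v x t1) * (1 / v x t1))
      - Px x t1 / \<epsilon>\<^sup>2 - pt x t1"
    by (simp add: Fu_def power2_eq_square mult_ac)
  have *: "a + 68 * a + 34 * b + a \<le> 104 * b" if "a \<le> b" for a b :: real
    using that by simp
  have "B ^ 12 * W + 68 * B ^ 12 * W + 34 * B ^ 12 * (W / \<epsilon>) + B ^ 12 * W \<le> 104 * (B ^ 12 * (W / \<epsilon>))"
    using *[OF We'] by (simp only: mult.assoc)
  then have "\<bar>Fu x t1\<bar> \<le> 104 * (B ^ 12 * (W / \<epsilon>))"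
    using abs_diff_mono[OF abs_diff_mono[OF abs_diff_mono[OF 6 7] 8] 5(2)] unfolding Fu by (rule order_trans[rotated])
  then show "\<bar>Fu x t1\<bar> \<le> 104 * B ^ 12 * (\<Lambda> + e) / \<epsilon>\<^sup>2 * D\<^sup>2 * time_weight t1"
    by (simp add: W_def E_def w_def power2_eq_square)
qed

text \<open>The initial deviation T - h is -\<epsilon>^2 p^2 / 2. Its Lipschitz bound replaces a
  window of full height in the interior gradient estimate at points so close to t = 0 that the
  window is cut off.\<close>

lemma zeta_init_lipschitz:
  "\<bar>(T x 0 - h x 0) - (T y 0 - h y 0)\<bar> \<le> \<epsilon>\<^sup>2 * B\<^sup>2 * \<bar>x - y\<bar>"
proof -
  have w0: "time_weight 0 = 1" by (simp add: time_weight_def)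
  have "norm (p x 0 - p y 0) \<le> B * norm (x - y)"
    by (rule field_differentiable_bound[of UNIV "\<lambda>x. p x 0" "\<lambda>x. px x 0"])
      (use p_x[of 0] px[of 0] w0 in auto)
  then have 1: "\<bar>p x 0 - p y 0\<bar> \<le> B * \<bar>x - y\<bar>" by simp
  have 2: "\<bar>p x 0 + p y 0\<bar> \<le> 2 * B" using p[of 0 x] p[of 0 y] w0 by auto
  have "\<bar>(\<epsilon>\<^sup>2 / 2) * ((p x 0 - p y 0) * (p x 0 + p y 0))\<bar> \<le> (\<epsilon>\<^sup>2 / 2) * ((B * \<bar>x - y\<bar>) * (2 * B))"
    by (intro abs_mult_mono 1 2) auto
  moreover have "(T x 0 - h x 0) - (T y 0 - h y 0) = - ((\<epsilon>\<^sup>2 / 2) * ((p x 0 - p y 0) * (p x 0 + p y 0)))"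
    by (simp add: init algebra_simps power2_eq_square)
  moreover have "(\<epsilon>\<^sup>2 / 2) * ((B * \<bar>x - y\<bar>) * (2 * B)) = \<epsilon>\<^sup>2 * B\<^sup>2 * \<bar>x - y\<bar>"
    by (simp add: power2_eq_square)
  ultimately show ?thesis by (simp only: abs_minus_cancel)
qed

text \<open>The continuity argument has to start strictly below its threshold; B^2 e is smaller than
  \<Lambda>.\<close>

lemma gradients_init:
  shows "\<bar>Tx x 0 - hx x 0\<bar> \<le> B\<^sup>2 * e" and "ux x 0 = px x 0"
proof -
  have w0: "time_weight 0 = 1" by (simp add: time_weight_def)
  have "((\<lambda>y. p y 0) has_real_derivative ux x 0) (at x)" using u_x[of 0 x] by (simp add: init)
  then show "ux x 0 = px x 0" using p_x[of 0 x] DERIV_unique by auto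
  have "((\<lambda>y. h y 0 - \<epsilon>\<^sup>2 * (p y 0)\<^sup>2 / 2) has_real_derivative hx x 0 - \<epsilon>\<^sup>2 * (p x 0 * px x 0)) (at x)"
    using h_x[of 0 x] unfolding hx_def by (auto intro!: derivative_eq_intros p_x)
  moreover have "((\<lambda>y. h y 0 - \<epsilon>\<^sup>2 * (p y 0)\<^sup>2 / 2) has_real_derivative Tx x 0) (at x)"
    using T_x[of 0 x] by (simp add: init)
  ultimately have "Tx x 0 - hx x 0 = - (\<epsilon>\<^sup>2 * (p x 0 * px x 0))" using DERIV_unique by fastforce
  moreover have "\<bar>\<epsilon>\<^sup>2 * (p x 0 * px x 0)\<bar> \<le> e * (B * B)"
  proof (intro abs_mult_mono)
    show "\<bar>\<epsilon>\<^sup>2\<bar> \<le> e" using eps by (simp add: power2_eq_square order_trans[OF mult_left_le])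
  qed (use p[of 0 x] px[of 0 x] w0 in auto)
  ultimately show "\<bar>Tx x 0 - hx x 0\<bar> \<le> B\<^sup>2 * e" by (simp add: power2_eq_square mult.commute)
qed

text \<open>On neighbourhoods of radius \<open>\<epsilon> / (55296 B ^ 16)\<close>, relative to the box, the smallness of the
  solution contributes at most \<open>48 * 55296 B ^ 18 e\<close> to the gradient bound, and the lower order
  terms contribute \<open>(\<Lambda> + e) / 4\<close>; with room for the initial data, the sum is below \<open>\<Lambda>\<close>.\<close>

definition \<Lambda> :: real where "\<Lambda> = 4000000 * B ^ 18 * e"

definition box_dist :: "real \<Rightarrow> real \<Rightarrow> real" where "box_dist X x = 1 - \<bar>x - X\<bar> / \<epsilon>"

section \<open>Self-improving gradient bounds and the continuity argument\<close>

lemma \<Lambda>: "0 < \<Lambda>" "\<Lambda> \<le> 1"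
  using e_pos B_pos e_small by (auto simp: \<Lambda>_def)

text \<open>Self-improvement: weak inequalities throughout the box up to time \<open>t0\<close>
  return as strict ones at a point inside it. The hypothesis covers all earlier times because v_x is
  driven by the history of T_x.\<close>

lemma gradient_step:
  assumes d0: "box_dist X x0 > 0" and t0: "t0 > 0"
    and hyp: "\<And>x t. box_dist X x > 0 \<Longrightarrow> 0 \<le> t \<Longrightarrow> t \<le> t0 \<Longrightarrow>
      box_dist X x * \<bar>Tx x t - hx x t\<bar> \<le> \<Lambda> * time_weight t \<and>
      box_dist X x * (\<epsilon> * \<bar>ux x t - px x t\<bar>) \<le> \<Lambda> * time_weight t"
  shows "box_dist X x0 * \<bar>Tx x0 t0 - hx x0 t0\<bar> < \<Lambda> * time_weight t0"
    and "box_dist X x0 * (\<epsilon> * \<bar>ux x0 t0 - px x0 t0\<bar>) < \<Lambda> * time_weight t0"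
proof -
  define w where "w = time_weight t0"
  have w: "w > 0" "w \<le> 1" using time_weight_pos time_weight_le_1 t0 by (auto simp: w_def)
  define d where "d = box_dist X x0"
  have d: "0 < d" "d \<le> 1" using d0 eps by (auto simp: d_def box_dist_def)
  \<comment> \<open>Solves 8 B^2 r (1728 B^14) = 1/4. Here 8 B^2 is the factor 8 / a0 of the
    gradient estimate with a0 = 1 / B^2, and 1728 = 216 * 4 * 2, where D^2 = 4 / d^2 and the weights
    in a window are at most 2 w.\<close>
  define r where "r = 1 / (55296 * B ^ 16)"
  have "1 \<le> B ^ 16" using B by simp
  then have "2 \<le> 55296 * B ^ 16" by linarith
  then have r: "r > 0" "r \<le> 1 / 2" using B_pos by (auto simp: r_def field_simps)
  \<comment> \<open>The factor \<open>d\<close> keeps the neighbourhood where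
    \<open>box_dist\<close> is at least d / 2. It also removes \<open>d\<close> from the result: the
    forcing is of size 1 / d^2, and \<rho> together with the outer weight contributes d^2, while d
    (m / \<rho>) does not depend on \<open>d\<close>.\<close>
  define \<rho> where "\<rho> = r * \<epsilon> * d"
  have rho: "\<rho> > 0" using r eps d by (simp add: \<rho>_def)
  have "r * \<epsilon> * d \<le> 1 / 2 * 1 * 1" using r eps d by (intro mult_mono) auto
  then have "\<rho>\<^sup>2 \<le> (1 / 2)\<^sup>2" using rho by (intro power_mono) (auto simp: \<rho>_def)
  then have rho2: "\<rho>\<^sup>2 \<le> 1 / 4" by (simp add: power2_eq_square)
  \<comment> \<open>Either the window has full parabolic height \<rho>^2, or it starts at t = 0,
    where the initial data supply the Lipschitz bound.\<close>
  define ts where "ts = max 0 (t0 - \<rho>\<^sup>2)"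
  have ts: "0 \<le> ts" "ts < t0" using t0 rho by (auto simp: ts_def)
  have tw: "time_weight t \<le> 2 * w" if "ts \<le> t" for t
    unfolding w_def using that ts t0 rho2 by (intro time_weight_mono_window) (auto simp: ts_def)
  define D where "D = 2 / d"
  have D: "D \<ge> 1" using d by (simp add: D_def)
  have near: "box_dist X x \<ge> d / 2" if "\<bar>x - x0\<bar> < \<rho>" for x
  proof -
    have "\<bar>x - X\<bar> \<le> \<bar>x0 - X\<bar> + r * \<epsilon> * d" using that by (auto simp: \<rho>_def)
    then have "\<bar>x - X\<bar> / \<epsilon> \<le> (\<bar>x0 - X\<bar> + r * \<epsilon> * d) / \<epsilon>" using eps by (intro divide_right_mono) auto
    also have "\<dots> = \<bar>x0 - X\<bar> / \<epsilon> + r * d" using eps by (simp add: field_simps)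
    also have "r * d \<le> 1 / 2 * d" using r d by (intro mult_right_mono) auto
    finally have "\<bar>x - X\<bar> / \<epsilon> \<le> \<bar>x0 - X\<bar> / \<epsilon> + 1 / 2 * d" by simp
    moreover have "d = 1 - \<bar>x0 - X\<bar> / \<epsilon>" by (simp add: d_def box_dist_def)
    ultimately show ?thesis unfolding box_dist_def by linarith
  qed
  have scale: "b \<le> \<Lambda> * D * time_weight t" if "\<bar>x - x0\<bar> < \<rho>" "box_dist X x * b \<le> \<Lambda> * time_weight t" "b \<ge> 0" for x t b
  proof -
    have "d / 2 * b \<le> \<Lambda> * time_weight t"
      using mult_right_mono[OF near[OF that(1)] that(3)] that(2) by linarith
    then show ?thesis using d by (simp add: D_def field_simps)
  qed
  have low: "\<bar>FT x t\<bar> \<le> 1728 * B ^ 14 * (\<Lambda> + e) / \<epsilon> / d\<^sup>2 * w \<and>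
      \<bar>Fu x t\<bar> \<le> 832 * B ^ 12 * (\<Lambda> + e) / \<epsilon>\<^sup>2 / d\<^sup>2 * w" if "\<bar>x - x0\<bar> < \<rho>" "ts < t" "t \<le> t0" for x t
  proof -
    have pd: "box_dist X x > 0" using near[OF that(1)] d by linarith
    have t: "t \<ge> 0" using that ts by simp
    have "\<bar>Tx x s - hx x s\<bar> \<le> \<Lambda> * D * time_weight s" if "0 \<le> s" "s \<le> t" for s
      using hyp[OF pd, of s] that \<open>t \<le> t0\<close> by (intro scale[OF \<open>\<bar>x - x0\<bar> < \<rho>\<close>]) auto
    moreover have "\<epsilon> * \<bar>ux x t - px x t\<bar> \<le> \<Lambda> * D * time_weight t"
      using hyp[OF pd t] that eps by (intro scale[OF \<open>\<bar>x - x0\<bar> < \<rho>\<close>]) auto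
    ultimately have
      1: "\<bar>FT x t\<bar> \<le> 216 * B ^ 14 * (\<Lambda> + e) / \<epsilon> * D\<^sup>2 * time_weight t" and
      2: "\<bar>Fu x t\<bar> \<le> 104 * B ^ 12 * (\<Lambda> + e) / \<epsilon>\<^sup>2 * D\<^sup>2 * time_weight t"
      using lower_order_bounds[OF D _ _ t, of \<Lambda> x] \<Lambda> by auto
    have "216 * B ^ 14 * (\<Lambda> + e) / \<epsilon> * D\<^sup>2 * time_weight t \<le> 216 * B ^ 14 * (\<Lambda> + e) / \<epsilon> * D\<^sup>2 * (2 * w)"
      "104 * B ^ 12 * (\<Lambda> + e) / \<epsilon>\<^sup>2 * D\<^sup>2 * time_weight t \<le> 104 * B ^ 12 * (\<Lambda> + e) / \<epsilon>\<^sup>2 * D\<^sup>2 * (2 * w)"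
      by (intro mult_left_mono tw; use that B_pos \<Lambda> e_pos eps in simp)+
    then show ?thesis using 1 2 by (simp add: D_def power_divide)
  qed
  have box_cont: "continuous_on ({x0-\<rho>..x0+\<rho>} \<times> {ts..t0}) (\<lambda>(x, t). f x t - g x t)"
    if "continuous_on (UNIV \<times> {0..}) (\<lambda>(x, t). f x t)" "continuous_on (UNIV \<times> {0..}) (\<lambda>(x, t). g x t)"
    for f g :: "real \<Rightarrow> real \<Rightarrow> real"
    using continuous_on_diff[OF that] ts
    by (auto simp: case_prod_unfold intro!: continuous_on_subset[of "UNIV \<times> {0..}"])
  have a0: "1 / B\<^sup>2 \<le> \<kappa> / v x t" "1 / B\<^sup>2 \<le> \<mu> / v x t" if "ts < t" for x t
  proof -
    have "t \<ge> 0" using that ts by simp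
    then have iv: "1 / B \<le> 1 / v x t"
      using v[of t x] pos(1)[of t x] B_pos by (simp add: field_simps)
    have "(1 / B) * (1 / B) \<le> \<kappa> * (1 / v x t)" "(1 / B) * (1 / B) \<le> \<mu> * (1 / v x t)"
      by (intro mult_mono mu kap iv; use mu_pos kap_pos B_pos in simp)+
    then show "1 / B\<^sup>2 \<le> \<kappa> / v x t" "1 / B\<^sup>2 \<le> \<mu> / v x t" by (auto simp: power2_eq_square)
  qed
  have a0p: "1 / B\<^sup>2 > 0" using B_pos by simp
  have eps2: "\<epsilon>\<^sup>2 \<le> e" using eps by (simp add: power2_eq_square order_trans[OF mult_left_le])
  have r_eq: "8 * B\<^sup>2 * (r * (1728 * B ^ 14)) = 1 / 4" "8 * B\<^sup>2 * (r * (832 * B ^ 12)) \<le> 1 / 4"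
  proof -
    show "8 * B\<^sup>2 * (r * (1728 * B ^ 14)) = 1 / 4"
      using B_pos by (simp add: r_def field_simps power_add[symmetric])
    have "8 * B\<^sup>2 * (r * (832 * B ^ 12)) \<le> 8 * B\<^sup>2 * (r * (1728 * B ^ 14))"
      using B r power_increasing[of 12 14 B] by (intro mult_left_mono mult_mono) auto
    then show "8 * B\<^sup>2 * (r * (832 * B ^ 12)) \<le> 1 / 4" using \<open>8 * B\<^sup>2 * (r * (1728 * B ^ 14)) = 1 / 4\<close> by simp
  qed
  have total: "2 * e * B\<^sup>2 + 16 * (2 * e / r) + 8 * (2 * e / r) * B\<^sup>2 + (\<Lambda> + e) / 4 < \<Lambda>"
  proof -
    have Bp: "B ^ m \<le> B ^ n" if "m \<le> n" for m n using B that by (rule power_increasing[rotated])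
    have er: "2 * e / r = 110592 * (e * B ^ 16)" by (simp add: r_def)
    have le: "e * B\<^sup>2 \<le> e * B ^ 18" "e * B ^ 16 \<le> e * B ^ 18" "e \<le> e * B ^ 18"
      using e_pos Bp[of 16 18] Bp[of 2 18] Bp[of 0 18] by auto
    have *: "2 * a + 16 * (110592 * b) + 8 * (110592 * c) + (4000000 * c + f) / 4 < 4000000 * c"
      if "a \<le> c" "b \<le> c" "f \<le> c" "0 < f" for a b c f :: real
      using that by argo
    have "8 * (110592 * (e * B ^ 16)) * B\<^sup>2 = 8 * (110592 * (e * B ^ 18))"
      by (simp add: power_add[symmetric] mult.assoc)
    moreover have "2 * e * B\<^sup>2 = 2 * (e * B\<^sup>2)" "\<Lambda> = 4000000 * (e * B ^ 18)" by (simp_all add: \<Lambda>_def)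
    ultimately show ?thesis using *[OF le e_pos] by (simp only: er)
  qed
  \<comment> \<open>If the window starts at t = 0, then w \<ge> 1/2, so L \<ge> e B^2 \<ge>
    \<epsilon>^2 B^2 dominates the Lipschitz constant of the initial deviation.\<close>
  define L where "L = 2 * e * B\<^sup>2 * w"
  have L: "L \<ge> 0" using e_pos w by (simp add: L_def)
  define m where "m = 2 * e * \<epsilon> * w"
  have m: "m \<ge> 0" using e_pos w eps by (simp add: m_def)
  define \<Phi> where "\<Phi> = 1728 * B ^ 14 * (\<Lambda> + e) / \<epsilon> / d\<^sup>2 * w"
  have \<Phi>: "\<Phi> > 0" using B_pos \<Lambda> e_pos w eps d by (simp add: \<Phi>_def)
  have T0: "\<bar>Tx x0 t0 - hx x0 t0\<bar> \<le> L + 16 * m / \<rho> + 8 * (\<rho> * \<Phi> + m / \<rho>) / (1 / B\<^sup>2)"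
  proof (rule interior_gradient_bound[OF rho a0p L m \<Phi> ts(2), where f = "\<lambda>x t. T x t - h x t"
        and fx = "\<lambda>x t. Tx x t - hx x t" and fxx = "\<lambda>x t. Txx x t - hxx x t" and ft = "\<lambda>x t. Tt x t - px x t"
        and a = "\<lambda>x t. \<kappa> / v x t" and F = FT])
    show "continuous_on ({x0-\<rho>..x0+\<rho>} \<times> {ts..t0}) (\<lambda>(x, t). T x t - h x t)" by (intro box_cont conts)
    show "((\<lambda>y. T y t - h y t) has_real_derivative Tx x t - hx x t) (at x)" if "ts < t" for x t
      unfolding hx_def using that ts by (intro DERIV_diff T_x h_x) auto
    show "((\<lambda>y. Tx y t - hx y t) has_real_derivative Txx x t - hxx x t) (at x)" if "ts < t" for x t
      using that ts by (intro DERIV_diff T_xx hx_x) auto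
    show "((\<lambda>s. T x s - h x s) has_real_derivative Tt x t - px x t) (at t)" if "ts < t" for x t
      using that ts by (intro DERIV_diff T_t h_t) auto
    show "Tt x t - px x t = \<kappa> / v x t * (Txx x t - hxx x t) + FT x t" if "ts < t" for x t
      using that ts by (intro heat_equations) auto
    show "1 / B\<^sup>2 \<le> \<kappa> / v x t" if "ts < t" for x t using a0 that by auto
    show "\<bar>FT x t\<bar> \<le> \<Phi>" if "\<bar>x - x0\<bar> < \<rho>" "ts < t" "t \<le> t0" for x t
      using low[OF that] by (simp add: \<Phi>_def)
    show "\<bar>T x t - h x t\<bar> \<le> m" if "ts \<le> t" for x t
    proof -
      have "e * \<epsilon> * time_weight t \<le> e * \<epsilon> * (2 * w)" using tw[OF that] e_pos eps by (intro mult_left_mono) auto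
      then show ?thesis using T_near[of t x] that ts by (simp add: m_def)
    qed
    show "ts \<le> t0 - \<rho>\<^sup>2 \<or> (\<forall>x y. \<bar>x - x0\<bar> \<le> \<rho> \<longrightarrow> \<bar>y - x0\<bar> \<le> \<rho> \<longrightarrow>
        \<bar>T x ts - h x ts - (T y ts - h y ts)\<bar> \<le> L * \<bar>x - y\<bar>)"
    proof (cases "ts = 0")
      case True
      have "1 \<le> 2 * w" using tw[of 0] True by (simp add: time_weight_def)
      then have "\<epsilon>\<^sup>2 * B\<^sup>2 * 1 \<le> e * B\<^sup>2 * (2 * w)" using eps2 e_pos by (intro mult_mono) auto
      then have "\<epsilon>\<^sup>2 * B\<^sup>2 \<le> L" by (simp add: L_def mult_ac)
      then have "\<bar>T x ts - h x ts - (T y ts - h y ts)\<bar> \<le> L * \<bar>x - y\<bar>" for x y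
        using zeta_init_lipschitz[of x y] mult_right_mono[of "\<epsilon>\<^sup>2 * B\<^sup>2" L "\<bar>x - y\<bar>"] True by simp
      then show ?thesis by blast
    qed (auto simp: ts_def max_def split: if_splits)
  qed
  have m_rho: "d * (m / \<rho>) = 2 * e / r * w" using d r eps by (simp add: m_def \<rho>_def)
  have "d * (\<rho> * \<Phi>) = r * (1728 * B ^ 14) * ((\<Lambda> + e) * w)"
    using d eps by (simp add: \<rho>_def \<Phi>_def field_simps power2_eq_square)
  then have "8 * B\<^sup>2 * (d * (\<rho> * \<Phi>)) = 8 * B\<^sup>2 * (r * (1728 * B ^ 14)) * ((\<Lambda> + e) * w)" by (simp add: mult_ac)
  then have rPhi: "8 * B\<^sup>2 * (d * (\<rho> * \<Phi>)) = (\<Lambda> + e) / 4 * w" by (simp only: r_eq)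
  have "d * \<bar>Tx x0 t0 - hx x0 t0\<bar> \<le> d * (L + 16 * m / \<rho> + 8 * (\<rho> * \<Phi> + m / \<rho>) / (1 / B\<^sup>2))"
    using T0 d by (intro mult_left_mono) auto
  also have "\<dots> = d * L + 16 * (d * (m / \<rho>)) + 8 * (d * (m / \<rho>)) * B\<^sup>2 + 8 * B\<^sup>2 * (d * (\<rho> * \<Phi>))"
    by (simp add: algebra_simps)
  also have "\<dots> = d * L + 16 * (2 * e / r * w) + 8 * (2 * e / r * w) * B\<^sup>2 + (\<Lambda> + e) / 4 * w"
    by (simp only: m_rho rPhi)
  also have "\<dots> \<le> 1 * L + 16 * (2 * e / r * w) + 8 * (2 * e / r * w) * B\<^sup>2 + (\<Lambda> + e) / 4 * w"
    using mult_right_mono[OF d(2) L] by simp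
  also have "\<dots> = (2 * e * B\<^sup>2 + 16 * (2 * e / r) + 8 * (2 * e / r) * B\<^sup>2 + (\<Lambda> + e) / 4) * w"
    unfolding L_def by algebra
  also have "\<dots> < \<Lambda> * w" using total w by (intro mult_strict_right_mono) auto
  finally show "box_dist X x0 * \<bar>Tx x0 t0 - hx x0 t0\<bar> < \<Lambda> * time_weight t0" by (simp add: d_def w_def)
  define m' where "m' = 2 * e * w"
  have m': "m' \<ge> 0" using e_pos w eps by (simp add: m'_def)
  define \<Phi>' where "\<Phi>' = 832 * B ^ 12 * (\<Lambda> + e) / \<epsilon>\<^sup>2 / d\<^sup>2 * w"
  have \<Phi>': "\<Phi>' > 0" using B_pos \<Lambda> e_pos w eps d by (simp add: \<Phi>'_def)
  \<comment> \<open>Initially u = p, so 0 is an admissible Lipschitz constant for the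
    deviation.\<close>
  have u0: "\<bar>ux x0 t0 - px x0 t0\<bar> \<le> 0 + 16 * m' / \<rho> + 8 * (\<rho> * \<Phi>' + m' / \<rho>) / (1 / B\<^sup>2)"
  proof (rule interior_gradient_bound[OF rho a0p order_refl m' \<Phi>' ts(2), where f = "\<lambda>x t. u x t - p x t"
        and fx = "\<lambda>x t. ux x t - px x t" and fxx = "\<lambda>x t. uxx x t - pxx x t" and ft = "\<lambda>x t. ut x t - pt x t"
        and a = "\<lambda>x t. \<mu> / v x t" and F = Fu])
    show "continuous_on ({x0-\<rho>..x0+\<rho>} \<times> {ts..t0}) (\<lambda>(x, t). u x t - p x t)" by (intro box_cont conts)
    show "((\<lambda>y. u y t - p y t) has_real_derivative ux x t - px x t) (at x)" if "ts < t" for x t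
      using that ts by (intro DERIV_diff u_x p_x) auto
    show "((\<lambda>y. ux y t - px y t) has_real_derivative uxx x t - pxx x t) (at x)" if "ts < t" for x t
      using that ts by (intro DERIV_diff u_xx p_xx) auto
    show "((\<lambda>s. u x s - p x s) has_real_derivative ut x t - pt x t) (at t)" if "ts < t" for x t
      using that ts by (intro DERIV_diff u_t p_t) auto
    show "ut x t - pt x t = \<mu> / v x t * (uxx x t - pxx x t) + Fu x t" if "ts < t" for x t
      using that ts by (intro heat_equations) auto
    show "1 / B\<^sup>2 \<le> \<mu> / v x t" if "ts < t" for x t using a0 that by auto
    show "\<bar>Fu x t\<bar> \<le> \<Phi>'" if "\<bar>x - x0\<bar> < \<rho>" "ts < t" "t \<le> t0" for x t
      using low[OF that] by (simp add: \<Phi>'_def)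
    show "\<bar>u x t - p x t\<bar> \<le> m'" if "ts \<le> t" for x t
    proof -
      have "e * time_weight t \<le> e * (2 * w)" using tw[OF that] e_pos eps by (intro mult_left_mono) auto
      then show ?thesis using u_near[of t x] that ts by (simp add: m'_def)
    qed
    show "ts \<le> t0 - \<rho>\<^sup>2 \<or> (\<forall>x y. \<bar>x - x0\<bar> \<le> \<rho> \<longrightarrow> \<bar>y - x0\<bar> \<le> \<rho> \<longrightarrow>
        \<bar>u x ts - p x ts - (u y ts - p y ts)\<bar> \<le> 0 * \<bar>x - y\<bar>)"
      by (cases "ts = 0") (auto simp: ts_def init max_def split: if_splits)
  qed
  \<comment> \<open>u - p is bounded by e where T - h is bounded by e \<epsilon>. The extra factor
    \<epsilon> on u_x compensates this, and the sum estimated in \<open>total\<close> serves for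
    both gradients.\<close>
  have m_rho': "d * (\<epsilon> * (m' / \<rho>)) = 2 * e / r * w" using d r eps by (simp add: m'_def \<rho>_def)
  have "d * (\<epsilon> * (\<rho> * \<Phi>')) = r * (832 * B ^ 12) * ((\<Lambda> + e) * w)"
    using d eps by (simp add: \<rho>_def \<Phi>'_def field_simps power2_eq_square)
  then have "8 * B\<^sup>2 * (d * (\<epsilon> * (\<rho> * \<Phi>'))) = 8 * B\<^sup>2 * (r * (832 * B ^ 12)) * ((\<Lambda> + e) * w)" by (simp add: mult_ac)
  also have "\<dots> \<le> 1 / 4 * ((\<Lambda> + e) * w)" using r_eq(2) \<Lambda> e_pos w by (intro mult_right_mono) auto
  finally have rPhi': "8 * B\<^sup>2 * (d * (\<epsilon> * (\<rho> * \<Phi>'))) \<le> (\<Lambda> + e) / 4 * w" by simp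
  have "d * (\<epsilon> * \<bar>ux x0 t0 - px x0 t0\<bar>) \<le> d * (\<epsilon> * (0 + 16 * m' / \<rho> + 8 * (\<rho> * \<Phi>' + m' / \<rho>) / (1 / B\<^sup>2)))"
    using u0 d eps by (intro mult_left_mono) auto
  also have "\<dots> = 16 * (d * (\<epsilon> * (m' / \<rho>))) + 8 * (d * (\<epsilon> * (m' / \<rho>))) * B\<^sup>2 + 8 * B\<^sup>2 * (d * (\<epsilon> * (\<rho> * \<Phi>')))"
    by (simp add: algebra_simps)
  also have "\<dots> \<le> 16 * (2 * e / r * w) + 8 * (2 * e / r * w) * B\<^sup>2 + (\<Lambda> + e) / 4 * w"
    using rPhi' by (simp only: m_rho' add_left_mono)
  also have "\<dots> \<le> L + 16 * (2 * e / r * w) + 8 * (2 * e / r * w) * B\<^sup>2 + (\<Lambda> + e) / 4 * w"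
    using L by linarith
  also have "\<dots> = (2 * e * B\<^sup>2 + 16 * (2 * e / r) + 8 * (2 * e / r) * B\<^sup>2 + (\<Lambda> + e) / 4) * w"
    unfolding L_def by algebra
  also have "\<dots> < \<Lambda> * w" using total w by (intro mult_strict_right_mono) auto
  finally show "box_dist X x0 * (\<epsilon> * \<bar>ux x0 t0 - px x0 t0\<bar>) < \<Lambda> * time_weight t0" by (simp add: d_def w_def)
qed

text \<open>At the first time at which one of the two weighted gradients reaches the threshold, the
  hypothesis of the previous lemma holds, and its conclusion is a contradiction.\<close>

theorem temperature_gradient_near:
  assumes "t \<ge> 0"
  shows "\<bar>Tx x t - hx x t\<bar> \<le> \<Lambda> * time_weight t"
proof (rule ccontr)
  assume contra: "\<not> ?thesis"
  define K where "K = {x-\<epsilon>..x+\<epsilon>} \<times> {0..t}"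
  define f1 where "f1 = (\<lambda>(y, s). box_dist x y * \<bar>Tx y s - hx y s\<bar>)"
  define f2 where "f2 = (\<lambda>(y, s). box_dist x y * (\<epsilon> * \<bar>ux y s - px y s\<bar>))"
  define b where "b = (\<lambda>(y :: real, s). \<Lambda> * time_weight s)"
  have Ksub: "K \<subseteq> UNIV \<times> {0..}" by (auto simp: K_def)
  note cs = conts[THEN continuous_on_subset[OF _ Ksub], unfolded case_prod_unfold]
  have c1: "continuous_on K f1"
    unfolding f1_def box_dist_def hx_def case_prod_unfold using eps kap_pos by (intro continuous_intros cs) auto
  have c2: "continuous_on K f2"
    unfolding f2_def box_dist_def case_prod_unfold using eps by (intro continuous_intros cs) auto
  have cb: "continuous_on K b"
    unfolding b_def time_weight_def case_prod_unfold by (intro continuous_intros) (auto simp: K_def)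
  have "compact K" by (auto simp: K_def intro!: compact_Times)
  have clK: "closed K" using \<open>compact K\<close> by (rule compact_imp_closed)
  \<comment> \<open>The contact set of either weighted gradient with the threshold. Being compact,
    it has an earliest time; it contains (x, t) because the weight equals 1 at the centre of the
    box.\<close>
  define Q where "Q = {q \<in> K. b q \<le> f1 q} \<union> {q \<in> K. b q \<le> f2 q}"
  have "closed Q" unfolding Q_def by (intro closed_Un continuous_on_closed_Collect_le c1 c2 cb clK)
  then have "compact Q" using compact_Int_closed[OF \<open>compact K\<close>, of Q] by (auto simp: Q_def Int_absorb1 inf_commute)
  have "(x, t) \<in> Q" using contra eps assms by (auto simp: Q_def K_def f1_def b_def box_dist_def)
  then have "Q \<noteq> {}" by blast
  from continuous_attains_inf[OF \<open>compact Q\<close> this continuous_on_snd[OF continuous_on_id]]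
  obtain x1 t1 where Q: "(x1, t1) \<in> Q" and min: "\<And>y s. (y, s) \<in> Q \<Longrightarrow> t1 \<le> s" by force
  have t1: "0 \<le> t1" "t1 \<le> t" and x1: "\<bar>x1 - x\<bar> \<le> \<epsilon>" using Q by (auto simp: Q_def K_def abs_le_iff)
  have less: "f1 (y, s) < b (y, s) \<and> f2 (y, s) < b (y, s)" if "\<bar>y - x\<bar> \<le> \<epsilon>" "0 \<le> s" "s < t1" for y s
  proof -
    have "(y, s) \<notin> Q" "(y, s) \<in> K" using min[of y s] that t1 by (auto simp: K_def abs_le_iff)
    then show ?thesis by (auto simp: Q_def not_le)
  qed
  have bpos: "b (y, s) > 0" if "s \<ge> 0" for y s using \<Lambda> time_weight_pos[OF that] by (simp add: b_def)
  have "t1 \<noteq> 0"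
  proof
    assume "t1 = 0"
    have "box_dist x x1 * \<bar>Tx x1 0 - hx x1 0\<bar> \<le> 1 * (B\<^sup>2 * e)"
      using eps x1 gradients_init(1) by (intro mult_mono) (auto simp: box_dist_def)
    also have "\<dots> < \<Lambda>"
    proof -
      have "B\<^sup>2 * e \<le> B ^ 18 * e" using B e_pos by (intro mult_right_mono power_increasing) auto
      moreover have "B\<^sup>2 * e > 0" using B_pos e_pos by simp
      ultimately show ?thesis by (simp add: \<Lambda>_def)
    qed
    finally have "f1 (x1, 0) < b (x1, 0)" by (simp add: f1_def b_def time_weight_def)
    moreover have "f2 (x1, 0) < b (x1, 0)" using bpos[of 0 x1] by (simp add: f2_def gradients_init)
    ultimately show False using Q \<open>t1 = 0\<close> by (auto simp: Q_def)
  qed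
  then have t1p: "t1 > 0" using t1 by simp
  \<comment> \<open>At \<open>t1\<close> strictness may fail, but the weak inequality survives at
    every y of the box as the limit from earlier times.\<close>
  have le: "f1 (y, s) \<le> b (y, s) \<and> f2 (y, s) \<le> b (y, s)" if y: "\<bar>y - x\<bar> \<le> \<epsilon>" and s: "0 \<le> s" "s \<le> t1" for y s
  proof (cases "s = t1")
    case True
    have slice: "continuous_on {0..t1} (\<lambda>s. g (y, s))" if "continuous_on K g" for g :: "real \<times> real \<Rightarrow> real"
      using y t1 by (intro continuous_on_compose2[OF that]) (auto simp: K_def abs_le_iff intro!: continuous_intros)
    have t1c: "t1 \<in> closure {0..<t1}" using t1p by simp
    have sub: "closure {0..<t1} = {0..t1}" using t1p by simp
    have "f1 (y, t1) - b (y, t1) \<le> 0"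
      by (rule continuous_le_on_closure[OF _ t1c, of "\<lambda>s. f1 (y, s) - b (y, s)"])
        (use less[OF y] in \<open>auto simp: sub less_imp_le intro!: continuous_intros slice c1 cb\<close>)
    moreover have "f2 (y, t1) - b (y, t1) \<le> 0"
      by (rule continuous_le_on_closure[OF _ t1c, of "\<lambda>s. f2 (y, s) - b (y, s)"])
        (use less[OF y] in \<open>auto simp: sub less_imp_le intro!: continuous_intros slice c2 cb\<close>)
    ultimately show ?thesis using True by simp
  qed (use less[OF y] s in \<open>auto simp: less_imp_le\<close>)
  have "f1 (x1, t1) \<ge> b (x1, t1) \<or> f2 (x1, t1) \<ge> b (x1, t1)" using Q by (auto simp: Q_def)
  \<comment> \<open>On the lateral boundary both weighted gradients vanish while the threshold is
    positive, so contact happens inside the box.\<close>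
  then have ne: "box_dist x x1 \<noteq> 0" using bpos[of t1 x1] t1 by (auto simp: f1_def f2_def)
  moreover have "box_dist x x1 \<ge> 0" using x1 eps by (simp add: box_dist_def)
  ultimately have bd: "box_dist x x1 > 0" by simp
  have hyp: "box_dist x y * \<bar>Tx y s - hx y s\<bar> \<le> \<Lambda> * time_weight s \<and>
      box_dist x y * (\<epsilon> * \<bar>ux y s - px y s\<bar>) \<le> \<Lambda> * time_weight s"
    if "box_dist x y > 0" "0 \<le> s" "s \<le> t1" for y s
  proof -
    have "\<bar>y - x\<bar> \<le> \<epsilon>" using that(1) eps by (simp add: box_dist_def)
    then show ?thesis using le[OF _ that(2,3)] by (simp add: f1_def f2_def b_def)
  qed
  show False
    using gradient_step[OF bd t1p hyp] \<open>f1 (x1, t1) \<ge> b (x1, t1) \<or> f2 (x1, t1) \<ge> b (x1, t1)\<close>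
    by (simp add: f1_def f2_def b_def)
qed

end

section \<open>The self-similar profile and the expanded system\<close>

lemma self_similar_eq: "self_similar g x t = g (x * time_weight t)"
  by (simp add: self_similar_def time_weight_def)

lemma powr_minus_half: "t \<ge> 0 \<Longrightarrow> (1 + t) powr (-1/2) = time_weight t"
  using powr_minus[of "1 + t" "1/2"] by (simp add: time_weight_def powr_half_sqrt inverse_eq_divide)

section \<open>Derivatives of smooth functions and the expanded equations\<close>

lemma smooth_halfplane_derivatives:
  assumes "smooth_halfplane f"
  obtains fx fxx ft fxt where
    "\<And>x t. t \<ge> 0 \<Longrightarrow> ((\<lambda>y. f y t) has_real_derivative fx x t) (at x)"
    "\<And>x t. t \<ge> 0 \<Longrightarrow> ((\<lambda>y. fx y t) has_real_derivative fxx x t) (at x)"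
    "\<And>x t. t > 0 \<Longrightarrow> (f x has_real_derivative ft x t) (at t)"
    "\<And>x t. t > 0 \<Longrightarrow> (fx x has_real_derivative fxt x t) (at t)"
    "\<And>x t. t > 0 \<Longrightarrow> ((\<lambda>y. ft y t) has_real_derivative fxt x t) (at x)"
    "continuous_on (UNIV \<times> {0..}) (\<lambda>(x, t). f x t)"
    "continuous_on (UNIV \<times> {0..}) (\<lambda>(x, t). fx x t)"
proof -
  have C: "Ck_halfplane 0 f" "Ck_halfplane (Suc 0) f" "Ck_halfplane (Suc (Suc 0)) f"
    using assms by (auto simp: smooth_halfplane_def simp del: Ck_halfplane.simps)
  \<comment> \<open>Each positive order of \<open>Ck_halfplane\<close> provides its own witnesses
    and speaks of continuity only at the bottom. Continuity of the x-derivative is read off at order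
    1, continuity of the mixed derivatives at order 2, and uniqueness of derivatives identifies the
    x-derivatives.\<close>
  from C(2) obtain fx' where fx': "\<And>x t. t \<ge> 0 \<Longrightarrow> ((\<lambda>y. f y t) has_real_derivative fx' x t) (at x)"
    and cx': "continuous_on (UNIV \<times> {0..}) (\<lambda>(x, t). fx' x t)"
    by auto
  from C(3) obtain fx ft where
    fx: "\<And>x t. t \<ge> 0 \<Longrightarrow> ((\<lambda>y. f y t) has_real_derivative fx x t) (at x)" and
    ft: "\<And>x t. t \<ge> 0 \<Longrightarrow> (f x has_real_derivative ft x t) (at t within {0..})" and
    1: "Ck_halfplane (Suc 0) fx" and 2: "Ck_halfplane (Suc 0) ft"
    unfolding Ck_halfplane.simps(2)[of "Suc 0"] by blast
  from 1 obtain fxx fxt where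
    fxx: "\<And>x t. t \<ge> 0 \<Longrightarrow> ((\<lambda>y. fx y t) has_real_derivative fxx x t) (at x)" and
    fxt: "\<And>x t. t \<ge> 0 \<Longrightarrow> (fx x has_real_derivative fxt x t) (at t within {0..})" and
    cxt: "continuous_on (UNIV \<times> {0..}) (\<lambda>(x, t). fxt x t)"
    by auto
  from 2 obtain ftx where
    ftx: "\<And>x t. t \<ge> 0 \<Longrightarrow> ((\<lambda>y. ft y t) has_real_derivative ftx x t) (at x)" and
    ctx: "continuous_on (UNIV \<times> {0..}) (\<lambda>(x, t). ftx x t)"
    by auto
  have at: "at t within {0..} = at t" if "t > 0" for t :: real
    using that by (intro at_within_interior) simp
  have sub: "UNIV \<times> {0<..} \<subseteq> UNIV \<times> {0::real..}" by auto
  have eq: "fxt x t = ftx x t" if "t > 0" for x t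
  proof (rule mixed_partials_eq[where S = "UNIV \<times> {0<..}" and f = f and fx = fx and ft = ft and fxt = fxt and ftx = ftx])
    show "open (UNIV \<times> {0::real<..})" by (intro open_Times) auto
    show "(x, t) \<in> UNIV \<times> {0<..}" using that by simp
    show "((\<lambda>y. f y t) has_real_derivative fx x t) (at x)" if "(x, t) \<in> UNIV \<times> {0<..}" for x t
      using fx that by auto
    show "((\<lambda>s. f x s) has_real_derivative ft x t) (at t)" if "(x, t) \<in> UNIV \<times> {0<..}" for x t
      using ft[of t x] at[of t] that by auto
    show "((\<lambda>s. fx x s) has_real_derivative fxt x t) (at t)" if "(x, t) \<in> UNIV \<times> {0<..}" for x t
      using fxt[of t x] at[of t] that by auto
    show "((\<lambda>y. ft y t) has_real_derivative ftx x t) (at x)" if "(x, t) \<in> UNIV \<times> {0<..}" for x t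
      using ftx that by auto
    show "continuous_on (UNIV \<times> {0<..}) (\<lambda>(x, t). fxt x t)" "continuous_on (UNIV \<times> {0<..}) (\<lambda>(x, t). ftx x t)"
      using continuous_on_subset[OF cxt sub] continuous_on_subset[OF ctx sub] by auto
  qed
  have "continuous_on (UNIV \<times> {0..}) (\<lambda>(x, t). fx x t)"
  proof (rule continuous_on_eq[OF cx'])
    show "(\<lambda>(x, t). fx' x t) z = (\<lambda>(x, t). fx x t) z" if "z \<in> UNIV \<times> {0..}" for z
      using that DERIV_unique[OF fx' fx] by auto
  qed
  moreover have "(f x has_real_derivative ft x t) (at t)" "(fx x has_real_derivative fxt x t) (at t)"
    "((\<lambda>y. ft y t) has_real_derivative fxt x t) (at x)" if "t > 0" for x t
    using ft[of t x] fxt[of t x] ftx[of t x] at[OF that] eq[OF that, of x] that by auto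
  moreover have "continuous_on (UNIV \<times> {0..}) (\<lambda>(x, t). f x t)" using C(1) by simp
  ultimately show ?thesis using that[of fx fxx ft fxt] fx fxx by blast
qed

text \<open>The third equation is that of the internal energy: subtracting \<epsilon>^2 u times the
  momentum equation from the balance of total energy removes u_t and leaves the pressure work -P u_x
  and the viscous heating.\<close>

lemma low_mach_system_expanded:
  assumes sys: "low_mach_system \<mu> \<kappa> \<epsilon> v u T" and "\<epsilon> \<noteq> 0" and t: "t > 0" and v0: "\<And>x. v x t > 0"
    and vx: "\<And>x. ((\<lambda>y. v y t) has_real_derivative vx x t) (at x)"
    and ux: "\<And>x. ((\<lambda>y. u y t) has_real_derivative ux x t) (at x)"
    and uxx: "\<And>x. ((\<lambda>y. ux y t) has_real_derivative uxx x t) (at x)"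
    and Tx: "\<And>x. ((\<lambda>y. T y t) has_real_derivative Tx x t) (at x)"
    and Txx: "\<And>x. ((\<lambda>y. Tx y t) has_real_derivative Txx x t) (at x)"
    and vt: "\<And>x. (v x has_real_derivative vt x t) (at t)"
    and ut: "\<And>x. (u x has_real_derivative ut x t) (at t)"
    and Tt: "\<And>x. (T x has_real_derivative Tt x t) (at t)"
  shows "vt x t = ux x t"
    and "ut x t + (Tx x t / v x t - T x t * vx x t / (v x t)\<^sup>2) / \<epsilon>\<^sup>2
        = \<mu> * (uxx x t / v x t - ux x t * vx x t / (v x t)\<^sup>2)"
    and "Tt x t = \<kappa> * (Txx x t / v x t - Tx x t * vx x t / (v x t)\<^sup>2)
        - T x t / v x t * ux x t + \<epsilon>\<^sup>2 * \<mu> * (ux x t)\<^sup>2 / v x t"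
proof -
  have v0': "v x t \<noteq> 0" for x using v0[of x] by simp
  have d: "dx u y t = ux y t" "dx T y t = Tx y t" "dx v y t = vx y t" for y
    using DERIV_imp_deriv[OF ux] DERIV_imp_deriv[OF Tx] DERIV_imp_deriv[OF vx] by (auto simp: dx_def)
  have d': "dt v x t = vt x t" "dt u x t = ut x t"
    using DERIV_imp_deriv[OF vt] DERIV_imp_deriv[OF ut] by (auto simp: dt_def)
  have 1: "dx (\<lambda>x t. T x t / v x t) x t = Tx x t / v x t - T x t * vx x t / (v x t)\<^sup>2"
    unfolding dx_def using v0'
    by (intro DERIV_imp_deriv) (auto intro!: derivative_eq_intros Tx vx simp: field_simps power2_eq_square)
  have 2: "dx (\<lambda>x t. dx u x t / v x t) x t = uxx x t / v x t - ux x t * vx x t / (v x t)\<^sup>2"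
    unfolding dx_def[of "\<lambda>x t. dx u x t / v x t"] d using v0'
    by (intro DERIV_imp_deriv) (auto intro!: derivative_eq_intros uxx vx simp: field_simps power2_eq_square)
  have 3: "dt (\<lambda>x t. T x t + 1/2 * \<bar>\<epsilon> * u x t\<bar>\<^sup>2) x t = Tt x t + \<epsilon>\<^sup>2 * u x t * ut x t"
    unfolding dt_def power2_abs
    by (intro DERIV_imp_deriv) (auto intro!: derivative_eq_intros Tt ut simp: field_simps power2_eq_square)
  have 4: "dx (\<lambda>x t. T x t / v x t * u x t) x t
      = (Tx x t / v x t - T x t * vx x t / (v x t)\<^sup>2) * u x t + T x t / v x t * ux x t"
    unfolding dx_def using v0'
    by (intro DERIV_imp_deriv) (auto intro!: derivative_eq_intros Tx vx ux simp: field_simps power2_eq_square)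
  have 5: "dx (\<lambda>x t. 1 / v x t * dx T x t) x t = Txx x t / v x t - Tx x t * vx x t / (v x t)\<^sup>2"
    unfolding dx_def[of "\<lambda>x t. 1 / v x t * dx T x t"] d using v0'
    by (intro DERIV_imp_deriv) (auto intro!: derivative_eq_intros Txx vx simp: field_simps power2_eq_square)
  have 6: "dx (\<lambda>x t. \<mu> / v x t * u x t * dx u x t) x t
      = \<mu> * ((ux x t)\<^sup>2 / v x t + u x t * (uxx x t / v x t - ux x t * vx x t / (v x t)\<^sup>2))"
    unfolding dx_def[of "\<lambda>x t. \<mu> / v x t * u x t * dx u x t"] d using v0'
    by (intro DERIV_imp_deriv) (auto intro!: derivative_eq_intros uxx ux vx simp: field_simps power2_eq_square)
  have S: "vt x t = ux x t"
    "ut x t + 1 / \<epsilon>\<^sup>2 * (Tx x t / v x t - T x t * vx x t / (v x t)\<^sup>2)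
      = \<mu> * (uxx x t / v x t - ux x t * vx x t / (v x t)\<^sup>2)"
    "Tt x t + \<epsilon>\<^sup>2 * u x t * ut x t + ((Tx x t / v x t - T x t * vx x t / (v x t)\<^sup>2) * u x t + T x t / v x t * ux x t)
      = \<kappa> * (Txx x t / v x t - Tx x t * vx x t / (v x t)\<^sup>2)
        + \<epsilon>\<^sup>2 * (\<mu> * ((ux x t)\<^sup>2 / v x t + u x t * (uxx x t / v x t - ux x t * vx x t / (v x t)\<^sup>2)))"
    using sys[unfolded low_mach_system_def Let_def, rule_format, OF t, of x]
    unfolding 1 2 3 4 5 6 d d' by simp_all
  show "vt x t = ux x t" by (rule S)
  show mom: "ut x t + (Tx x t / v x t - T x t * vx x t / (v x t)\<^sup>2) / \<epsilon>\<^sup>2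
        = \<mu> * (uxx x t / v x t - ux x t * vx x t / (v x t)\<^sup>2)"
    using S(2) by simp
  define P where "P = Tx x t / v x t - T x t * vx x t / (v x t)\<^sup>2"
  have "\<epsilon>\<^sup>2 * u x t * (\<mu> * (uxx x t / v x t - ux x t * vx x t / (v x t)\<^sup>2)) = \<epsilon>\<^sup>2 * u x t * ut x t + P * u x t"
    unfolding mom[symmetric] P_def[symmetric] using \<open>\<epsilon> \<noteq> 0\<close> by (simp add: algebra_simps)
  then show "Tt x t = \<kappa> * (Txx x t / v x t - Tx x t * vx x t / (v x t)\<^sup>2)
        - T x t / v x t * ux x t + \<epsilon>\<^sup>2 * \<mu> * (ux x t)\<^sup>2 / v x t"
    using S(3) unfolding P_def[symmetric] by (simp add: algebra_simps)
qed

section \<open>The profile in the similarity variable: equation, decay and derivatives\<close>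

lemma DERIV_scaled:
  assumes "(f has_real_derivative D) (at (x * c))"
  shows "((\<lambda>y. f (y * c)) has_real_derivative c * D) (at x)"
proof -
  have "((\<lambda>y. y * c) has_real_derivative c) (at x)" by (auto intro!: derivative_eq_intros)
  from DERIV_chain2[OF assms this] show ?thesis by (simp add: mult.commute)
qed

locale profile =
  fixes \<kappa> Tm Tp :: real and That :: "real \<Rightarrow> real"
  assumes kappa: "\<kappa> > 0" and Tm: "Tm > 0" and Tp: "Tp > 0" and dp: "diffusion_profile \<kappa> Tm Tp That"
begin

definition q :: "real \<Rightarrow> real" where "q \<eta> = \<kappa> * deriv That \<eta> / (2 * That \<eta>)"

text \<open>The derivative of \<open>q\<close> as given by the profile equation, q' = -\<eta> That'
  / 2, with That' rewritten as 2 That q / \<kappa>. In this form every later derivative is bounded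
  through powers of \<eta> times \<open>q\<close>.\<close>

definition q1 :: "real \<Rightarrow> real" where "q1 \<eta> = - (\<eta> * That \<eta> * q \<eta> / \<kappa>)"

definition q2 :: "real \<Rightarrow> real" where
  "q2 \<eta> = - ((That \<eta> * q \<eta> + \<eta> * deriv That \<eta> * q \<eta> + \<eta> * That \<eta> * q1 \<eta>) / \<kappa>)"

lemma That_pos: "That \<eta> > 0"
  using dp by (simp add: diffusion_profile_def)

lemma DERIV_That: "(That has_real_derivative deriv That \<eta>) (at \<eta>)"
proof -
  have "That differentiable at \<eta>"
    using dp unfolding diffusion_profile_def by (auto simp: differentiable_on_def dest: spec[of _ 0])
  then show ?thesis by (simp add: DERIV_deriv_iff_real_differentiable)
qed

lemma DERIV_That': "(deriv That has_real_derivative deriv (deriv That) \<eta>) (at \<eta>)"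
proof -
  have "deriv That differentiable at \<eta>"
    using dp unfolding diffusion_profile_def by (auto simp: differentiable_on_def dest: spec[of _ 1])
  then show ?thesis by (simp add: DERIV_deriv_iff_real_differentiable)
qed

lemma That'_eq: "deriv That \<eta> = 2 * That \<eta> * q \<eta> / \<kappa>"
  using That_pos[of \<eta>] kappa by (simp add: q_def)

lemma self_similar_x:
  "((\<lambda>y. self_similar That y t) has_real_derivative time_weight t * deriv That (x * time_weight t)) (at x)"
  unfolding self_similar_eq by (rule DERIV_scaled[OF DERIV_That])

lemma dx_self_similar: "dx (self_similar That) x t = time_weight t * deriv That (x * time_weight t)"
  unfolding dx_def by (rule DERIV_imp_deriv[OF self_similar_x])

lemma u_profile_eq: "u_profile \<kappa> That x t = time_weight t * q (x * time_weight t)"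
  by (simp add: u_profile_def dx_self_similar q_def self_similar_eq)

text \<open>The quotient rule gives differentiability; the value comes from the diffusion equation
  at the single time t = 1, where x = \<eta> sqrt 2 reaches the prescribed \<eta>.\<close>

lemma DERIV_q: "(q has_real_derivative q1 \<eta>) (at \<eta>)"
proof -
  have ne: "That \<eta> \<noteq> 0" using That_pos[of \<eta>] by simp
  obtain D where D: "(q has_real_derivative D) (at \<eta>)"
  proof -
    have "(q has_real_derivative (\<kappa> * deriv (deriv That) \<eta> * (2 * That \<eta>) - \<kappa> * deriv That \<eta> * (2 * deriv That \<eta>))
        / (2 * That \<eta> * (2 * That \<eta>))) (at \<eta>)"
      unfolding q_def using ne by (auto intro!: derivative_eq_intros DERIV_That DERIV_That')
    then show ?thesis using that by blast
  qed
  define w where "w = time_weight 1"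
  have w: "w > 0" unfolding w_def by (simp add: time_weight_pos)
  define x where "x = \<eta> / w"
  have xw: "x * w = \<eta>" using w by (simp add: x_def)
  have "dt (self_similar That) x 1 = dx (\<lambda>x t. \<kappa> * dx (self_similar That) x t / (2 * self_similar That x t)) x 1"
    using dp by (simp add: diffusion_profile_def Let_def)
  moreover have "dt (self_similar That) x 1 = deriv That \<eta> * (x * - (w ^ 3 / 2))"
    unfolding dt_def self_similar_eq w_def
    by (rule DERIV_imp_deriv, rule DERIV_chain2[OF _ DERIV_cmult[OF DERIV_time_weight]])
      (use DERIV_That xw in \<open>auto simp: w_def\<close>)
  moreover have "dx (\<lambda>x t. \<kappa> * dx (self_similar That) x t / (2 * self_similar That x t)) x 1 = w * (D * w)"
  proof -
    have "(\<lambda>y. \<kappa> * dx (self_similar That) y 1 / (2 * self_similar That y 1)) = (\<lambda>y. w * q (y * w))"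
      using u_profile_eq by (auto simp: u_profile_def w_def)
    moreover have "((\<lambda>y. w * q (y * w)) has_real_derivative w * (D * w)) (at x)"
      using DERIV_cmult[OF DERIV_scaled, of q D x w w] D xw by (simp add: mult_ac)
    ultimately show ?thesis unfolding dx_def[of "\<lambda>x t. \<kappa> * dx (self_similar That) x t / (2 * self_similar That x t)"]
      using DERIV_imp_deriv by metis
  qed
  ultimately have "deriv That \<eta> * (x * - (w ^ 3 / 2)) = w * (D * w)" by simp
  then have "w * w * D = w * w * (- ((x * w) * deriv That \<eta> / 2))" by algebra
  then have "w * w * D = w * w * (- (\<eta> * deriv That \<eta> / 2))" by (simp only: xw)
  then have "D = - (\<eta> * deriv That \<eta> / 2)" using w by (metis mult_left_cancel mult_eq_0_iff less_irrefl)
  then have "D = q1 \<eta>" by (simp add: q1_def That'_eq)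
  then show ?thesis using D by simp
qed

lemma DERIV_q1: "(q1 has_real_derivative q2 \<eta>) (at \<eta>)"
  unfolding q1_def q2_def using kappa
  by (auto intro!: derivative_eq_intros DERIV_That DERIV_q simp: field_simps) (auto simp: q1_def field_simps)

lemma That_bounds: obtains a b where "0 < a" "\<And>\<eta>. a \<le> That \<eta>" "\<And>\<eta>. That \<eta> \<le> b"
proof -
  have lim: "(That \<longlongrightarrow> Tm) at_bot" "(That \<longlongrightarrow> Tp) at_top" using dp by (auto simp: diffusion_profile_def)
  have "eventually (\<lambda>\<eta>. Tm / 2 < That \<eta> \<and> That \<eta> < 2 * Tm) at_bot"
    using order_tendstoD(1)[OF lim(1), of "Tm / 2"] order_tendstoD(2)[OF lim(1), of "2 * Tm"] Tm
    by (intro eventually_conj) auto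
  then obtain l where l: "\<And>\<eta>. \<eta> \<le> l \<Longrightarrow> Tm / 2 < That \<eta> \<and> That \<eta> < 2 * Tm"
    unfolding eventually_at_bot_linorder by blast
  have "eventually (\<lambda>\<eta>. Tp / 2 < That \<eta> \<and> That \<eta> < 2 * Tp) at_top"
    using order_tendstoD(1)[OF lim(2), of "Tp / 2"] order_tendstoD(2)[OF lim(2), of "2 * Tp"] Tp
    by (intro eventually_conj) auto
  then obtain r where r: "\<And>\<eta>. \<eta> \<ge> r \<Longrightarrow> Tp / 2 < That \<eta> \<and> That \<eta> < 2 * Tp"
    unfolding eventually_at_top_linorder by blast
  have c: "continuous_on {l..max l r} That"
    using DERIV_That by (intro DERIV_continuous_on) (auto intro: has_field_derivative_at_within)
  have ne: "{l..max l r} \<noteq> {}" by simp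
  obtain y where y: "\<And>\<eta>. \<eta> \<in> {l..max l r} \<Longrightarrow> That y \<le> That \<eta>"
    using continuous_attains_inf[OF compact_Icc ne c] by blast
  obtain z where z: "\<And>\<eta>. \<eta> \<in> {l..max l r} \<Longrightarrow> That \<eta> \<le> That z"
    using continuous_attains_sup[OF compact_Icc ne c] by blast
  define a where "a = min (That y) (min (Tm / 2) (Tp / 2))"
  define b where "b = max (That z) (max (2 * Tm) (2 * Tp))"
  have "a \<le> That \<eta> \<and> That \<eta> \<le> b" for \<eta>
  proof -
    consider "\<eta> \<le> l" | "\<eta> \<ge> r" | "\<eta> \<in> {l..max l r}" by fastforce
    then show ?thesis using l[of \<eta>] r[of \<eta>] y[of \<eta>] z[of \<eta>] by cases (auto simp: a_def b_def)
  qed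
  then show ?thesis using that[of a b] Tm Tp That_pos by (auto simp: a_def)
qed

text \<open>q' = -\<eta> That q / \<kappa> is linear of first order, so \<open>q\<close> even decays
  like a Gaussian; the quadratic weight is enough for the bounds that follow. With s = a / (2
  \<kappa>) one has 2 s \<le> That / \<kappa>, which makes the square of q (1 + s \<eta>^2)
  nonincreasing away from 0.\<close>

lemma q_decay:
  assumes "0 < a" "\<And>\<eta>. a \<le> That \<eta>"
  shows "\<bar>q \<eta>\<bar> * (1 + a / (2 * \<kappa>) * \<eta>\<^sup>2) \<le> \<bar>q 0\<bar>"
proof -
  define s where "s = a / (2 * \<kappa>)"
  have s: "s > 0" using assms kappa by (simp add: s_def)
  define G where "G = (\<lambda>\<eta>. (q \<eta> * (1 + s * \<eta>\<^sup>2))\<^sup>2)"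
  define c where "c = (\<lambda>\<eta>. 2 * (q \<eta>)\<^sup>2 * (1 + s * \<eta>\<^sup>2) * (2 * s - That \<eta> / \<kappa> * (1 + s * \<eta>\<^sup>2)))"
  have G: "(G has_real_derivative c \<eta> * \<eta>) (at \<eta>)" for \<eta>
    unfolding G_def c_def using kappa
    by (auto intro!: derivative_eq_intros DERIV_q simp: q1_def field_simps power2_eq_square)
  have neg: "2 * s - That \<eta> / \<kappa> * (1 + s * \<eta>\<^sup>2) \<le> 0" for \<eta>
  proof -
    have "2 * s = a / \<kappa> * 1" by (simp add: s_def)
    also have "\<dots> \<le> That \<eta> / \<kappa> * (1 + s * \<eta>\<^sup>2)"
      using assms kappa s That_pos[of \<eta>] by (intro mult_mono divide_right_mono) auto
    finally show ?thesis by simp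
  qed
  have c: "c \<eta> \<le> 0" for \<eta>
    unfolding c_def using s neg by (intro mult_nonneg_nonpos) auto
  have "G \<eta> \<le> G 0"
  proof (cases "\<eta> \<ge> 0")
    case True
    show ?thesis
      by (rule DERIV_nonpos_imp_nonincreasing[OF True])
        (use G c in \<open>blast intro: mult_nonpos_nonneg\<close>)
  next
    case False
    then have "\<eta> \<le> 0" by simp
    then show ?thesis
      by (rule DERIV_nonneg_imp_nondecreasing)
        (use G c in \<open>blast intro: mult_nonpos_nonpos\<close>)
  qed
  then have "\<bar>q \<eta> * (1 + s * \<eta>\<^sup>2)\<bar> \<le> \<bar>q 0\<bar>" by (simp add: G_def abs_le_square_iff)
  then show ?thesis using s by (simp add: abs_mult s_def[symmetric])
qed

text \<open>No quantity here involves more than \<eta>^2 q, so quadratic decay suffices. The factor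
  2 in 2 / B \<le> That \<le> B / 2 leaves room for v and T, which are only close to the profile, to
  remain in [1/B, B]. The lower bound \<open>M\<close> lets the same \<open>B\<close> control the
  physical coefficients.\<close>

lemma profile_bounds:
  obtains B where "B \<ge> M" "\<And>\<eta>. 2 / B \<le> That \<eta>" "\<And>\<eta>. That \<eta> \<le> B / 2" "\<And>\<eta>. \<bar>q \<eta>\<bar> \<le> B" "\<And>\<eta>. \<bar>q1 \<eta>\<bar> \<le> B"
    "\<And>\<eta>. \<bar>q2 \<eta>\<bar> \<le> B" "\<And>\<eta>. \<bar>q \<eta> + \<eta> * q1 \<eta>\<bar> \<le> B"
proof -
  obtain a b where ab: "0 < a" "\<And>\<eta>. a \<le> That \<eta>" "\<And>\<eta>. That \<eta> \<le> b" using That_bounds by blast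
  define s where "s = a / (2 * \<kappa>)"
  have s: "s > 0" using ab kappa by (simp add: s_def)
  define R where "R = \<bar>q 0\<bar> * (1 + 1 / s)"
  have q: "\<bar>q \<eta>\<bar> * (1 + s * \<eta>\<^sup>2) \<le> \<bar>q 0\<bar>" for \<eta> using q_decay[OF ab(1,2)] by (simp add: s_def)
  have qs: "\<bar>q \<eta>\<bar> * (1 + \<eta>\<^sup>2) \<le> R" for \<eta>
  proof -
    have "\<bar>q \<eta>\<bar> * (1 + \<eta>\<^sup>2) \<le> \<bar>q \<eta>\<bar> * ((1 + s * \<eta>\<^sup>2) * (1 + 1 / s))"
      using s by (intro mult_left_mono) (auto simp: field_simps)
    also have "\<dots> \<le> R" using mult_right_mono[OF q[of \<eta>], of "1 + 1 / s"] s by (simp add: R_def mult.assoc)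
    finally show ?thesis .
  qed
  have R: "R \<ge> 0" using s by (simp add: R_def)
  have q0: "\<bar>q \<eta>\<bar> \<le> R" and qe: "\<bar>\<eta> * q \<eta>\<bar> \<le> R" and qee: "\<bar>\<eta> * (\<eta> * q \<eta>)\<bar> \<le> R" for \<eta>
  proof -
    have *: "\<bar>q \<eta>\<bar> * c \<le> R" if "c \<le> 1 + \<eta>\<^sup>2" for c
      using mult_left_mono[OF that, of "\<bar>q \<eta>\<bar>"] qs[of \<eta>] by simp
    have "\<bar>\<eta>\<bar> \<le> 1 + \<eta>\<^sup>2"
      using sum_squares_ge_zero[of "\<bar>\<eta>\<bar> - 1" 0] zero_le_power2[of \<eta>] by (simp add: algebra_simps power2_eq_square)
    then show "\<bar>q \<eta>\<bar> \<le> R" "\<bar>\<eta> * q \<eta>\<bar> \<le> R" "\<bar>\<eta> * (\<eta> * q \<eta>)\<bar> \<le> R"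
      using *[of 1] *[of "\<bar>\<eta>\<bar>"] *[of "\<bar>\<eta>\<bar> * \<bar>\<eta>\<bar>"] by (auto simp: abs_mult mult_ac power2_eq_square)
  qed
  have Tb: "\<bar>That \<eta>\<bar> \<le> b" for \<eta> using ab(3)[of \<eta>] That_pos[of \<eta>] by simp
  have b: "b > 0" using ab(3)[of 0] That_pos[of 0] by linarith
  have ki: "\<bar>1 / \<kappa>\<bar> \<le> 1 / \<kappa>" using kappa by simp
  have 1: "\<bar>q1 \<eta>\<bar> \<le> b * R * (1 / \<kappa>)" "\<bar>\<eta> * q1 \<eta>\<bar> \<le> b * R * (1 / \<kappa>)" for \<eta>
  proof -
    have "\<bar>That \<eta> * (\<eta> * q \<eta>) * (1 / \<kappa>)\<bar> \<le> b * R * (1 / \<kappa>)"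
      "\<bar>That \<eta> * (\<eta> * (\<eta> * q \<eta>)) * (1 / \<kappa>)\<bar> \<le> b * R * (1 / \<kappa>)"
      by (intro abs_mult_mono Tb qe qee ki)+
    moreover have "q1 \<eta> = - (That \<eta> * (\<eta> * q \<eta>) * (1 / \<kappa>))"
      "\<eta> * q1 \<eta> = - (That \<eta> * (\<eta> * (\<eta> * q \<eta>)) * (1 / \<kappa>))" by (auto simp: q1_def)
    ultimately show "\<bar>q1 \<eta>\<bar> \<le> b * R * (1 / \<kappa>)" "\<bar>\<eta> * q1 \<eta>\<bar> \<le> b * R * (1 / \<kappa>)"
      by (simp_all only: abs_minus_cancel)
  qed
  define R2 where "R2 = b * R * (1 / \<kappa>) + 2 * b * R * R * (1 / \<kappa>) * (1 / \<kappa>) + b * (b * R * (1 / \<kappa>)) * (1 / \<kappa>)"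
  have 2: "\<bar>q2 \<eta>\<bar> \<le> R2" for \<eta>
  proof -
    have "\<bar>That \<eta> * q \<eta> * (1 / \<kappa>)\<bar> \<le> b * R * (1 / \<kappa>)"
      "\<bar>2 * That \<eta> * q \<eta> * (\<eta> * q \<eta>) * (1 / \<kappa>) * (1 / \<kappa>)\<bar> \<le> 2 * b * R * R * (1 / \<kappa>) * (1 / \<kappa>)"
      "\<bar>That \<eta> * (\<eta> * q1 \<eta>) * (1 / \<kappa>)\<bar> \<le> b * (b * R * (1 / \<kappa>)) * (1 / \<kappa>)"
      by (intro abs_mult_mono Tb q0 qe 1 ki; simp)+
    moreover have "q2 \<eta> = - (That \<eta> * q \<eta> * (1 / \<kappa>) + 2 * That \<eta> * q \<eta> * (\<eta> * q \<eta>) * (1 / \<kappa>) * (1 / \<kappa>)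
        + That \<eta> * (\<eta> * q1 \<eta>) * (1 / \<kappa>))"
      using kappa by (simp add: q2_def That'_eq field_simps)
    ultimately show ?thesis unfolding R2_def by linarith
  qed
  have nn: "R2 \<ge> 0" "b * R * (1 / \<kappa>) \<ge> 0" using 2[of 0] 1[of 0] by linarith+
  define B where "B = max M (2 / a + 2 * b + R + b * R * (1 / \<kappa>) + R2)"
  have B: "B \<ge> M" "B \<ge> 2 / a" "B \<ge> 2 * b" "B \<ge> R + b * R * (1 / \<kappa>)" "B \<ge> R2" "B > 0"
  proof -
    have "2 / a > 0" using ab by simp
    then have "2 / a + 2 * b + R + b * R * (1 / \<kappa>) + R2 \<ge> max (2 / a) (max (2 * b) (max (R + b * R * (1 / \<kappa>)) R2))"
      using nn b R by auto
    then show "B \<ge> M" "B \<ge> 2 / a" "B \<ge> 2 * b" "B \<ge> R + b * R * (1 / \<kappa>)" "B \<ge> R2" by (auto simp: B_def)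
    then show "B > 0" using b by simp
  qed
  have "2 / B \<le> a" using B ab by (simp add: field_simps)
  then have "2 / B \<le> That \<eta>" for \<eta> using ab(2)[of \<eta>] by linarith
  moreover have "That \<eta> \<le> B / 2" for \<eta> using ab(3)[of \<eta>] B by linarith
  moreover have "\<bar>q \<eta>\<bar> \<le> B" "\<bar>q1 \<eta>\<bar> \<le> B" "\<bar>q2 \<eta>\<bar> \<le> B" "\<bar>q \<eta> + \<eta> * q1 \<eta>\<bar> \<le> B" for \<eta>
    using q0[of \<eta>] 1[of \<eta>] 2[of \<eta>] B R nn by linarith+
  ultimately show ?thesis using that B by blast
qed

lemma u_profile_x:
  "((\<lambda>y. u_profile \<kappa> That y t) has_real_derivative time_weight t ^ 2 * q1 (x * time_weight t)) (at x)"
  "((\<lambda>y. time_weight t ^ 2 * q1 (y * time_weight t)) has_real_derivative time_weight t ^ 3 * q2 (x * time_weight t)) (at x)"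
proof -
  have "((\<lambda>y. time_weight t * q (y * time_weight t)) has_real_derivative
      time_weight t * (time_weight t * q1 (x * time_weight t))) (at x)"
    "((\<lambda>y. time_weight t ^ 2 * q1 (y * time_weight t)) has_real_derivative
      time_weight t ^ 2 * (time_weight t * q2 (x * time_weight t))) (at x)"
    by (intro DERIV_cmult DERIV_scaled DERIV_q DERIV_q1)+
  then show "((\<lambda>y. u_profile \<kappa> That y t) has_real_derivative time_weight t ^ 2 * q1 (x * time_weight t)) (at x)"
    "((\<lambda>y. time_weight t ^ 2 * q1 (y * time_weight t)) has_real_derivative time_weight t ^ 3 * q2 (x * time_weight t)) (at x)"
    by (simp_all add: u_profile_eq power2_eq_square power3_eq_cube mult.assoc)
qed

text \<open>The time derivative of the first function is the x-derivative of the second: the profile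
  satisfies v_t = u_x exactly.\<close>

lemma profile_t:
  assumes "t > 0"
  shows "(self_similar That x has_real_derivative time_weight t ^ 2 * q1 (x * time_weight t)) (at t)"
    and "(u_profile \<kappa> That x has_real_derivative
      - (time_weight t ^ 3 / 2) * (q (x * time_weight t) + x * time_weight t * q1 (x * time_weight t))) (at t)"
proof -
  note dw = DERIV_time_weight[of t]
  have e: "self_similar That x = (\<lambda>t. That (x * time_weight t))"
    "u_profile \<kappa> That x = (\<lambda>t. time_weight t * q (x * time_weight t))"
    by (auto simp: self_similar_eq u_profile_eq)
  have "((\<lambda>t. That (x * time_weight t)) has_real_derivative
      deriv That (x * time_weight t) * (x * - (time_weight t ^ 3 / 2))) (at t)"
    using assms by (intro DERIV_chain2[OF DERIV_That] DERIV_cmult dw) simp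
  moreover have "deriv That (x * time_weight t) * (x * - (time_weight t ^ 3 / 2)) = time_weight t ^ 2 * q1 (x * time_weight t)"
    using kappa by (simp add: That'_eq q1_def power2_eq_square power3_eq_cube)
  ultimately show "(self_similar That x has_real_derivative time_weight t ^ 2 * q1 (x * time_weight t)) (at t)"
    by (simp add: e)
  have "((\<lambda>t. q (x * time_weight t)) has_real_derivative
      q1 (x * time_weight t) * (x * - (time_weight t ^ 3 / 2))) (at t)"
    using assms by (intro DERIV_chain2[OF DERIV_q] DERIV_cmult dw) simp
  from DERIV_mult[OF dw this] assms
  show "(u_profile \<kappa> That x has_real_derivative
      - (time_weight t ^ 3 / 2) * (q (x * time_weight t) + x * time_weight t * q1 (x * time_weight t))) (at t)"
    by (simp add: e algebra_simps power3_eq_cube)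
qed

lemma profile_continuous:
  "continuous_on (UNIV \<times> {0..}) (\<lambda>(x, t). self_similar That x t)"
  "continuous_on (UNIV \<times> {0..}) (\<lambda>(x, t). u_profile \<kappa> That x t)"
  "continuous_on (UNIV \<times> {0..}) (\<lambda>(x, t). time_weight t ^ 2 * q1 (x * time_weight t))"
proof -
  have w: "continuous_on (UNIV \<times> {0..}) (\<lambda>z :: real \<times> real. time_weight (snd z))"
    unfolding time_weight_def by (intro continuous_intros) auto
  have c: "continuous_on UNIV That" "continuous_on UNIV q" "continuous_on UNIV q1"
    using DERIV_That DERIV_q DERIV_q1 by (auto intro!: DERIV_continuous_on)
  have "continuous_on (UNIV \<times> {0..}) (\<lambda>z :: real \<times> real. f (fst z * time_weight (snd z)))"
    if "continuous_on UNIV f" for f :: "real \<Rightarrow> real"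
    by (intro continuous_on_compose2[OF that] continuous_intros w) auto
  note cc = c[THEN this]
  show "continuous_on (UNIV \<times> {0..}) (\<lambda>(x, t). self_similar That x t)"
    "continuous_on (UNIV \<times> {0..}) (\<lambda>(x, t). u_profile \<kappa> That x t)"
    "continuous_on (UNIV \<times> {0..}) (\<lambda>(x, t). time_weight t ^ 2 * q1 (x * time_weight t))"
    unfolding self_similar_eq u_profile_eq case_prod_unfold by (intro continuous_intros w cc)+
qed

end

section \<open>Conclusion\<close>

lemma profile_bounds_for_coefficients:
  assumes "profile \<kappa> Tm Tp That" and mu: "\<mu> > 0"
  obtains B where "B \<ge> 2" "1 / B \<le> \<mu>" "\<mu> \<le> B" "1 / B \<le> \<kappa>" "\<kappa> \<le> B"
    "\<And>\<eta>. 2 / B \<le> That \<eta>" "\<And>\<eta>. That \<eta> \<le> B / 2"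
    "\<And>\<eta>. \<bar>profile.q \<kappa> That \<eta>\<bar> \<le> B" "\<And>\<eta>. \<bar>profile.q1 \<kappa> That \<eta>\<bar> \<le> B"
    "\<And>\<eta>. \<bar>profile.q2 \<kappa> That \<eta>\<bar> \<le> B" "\<And>\<eta>. \<bar>profile.q \<kappa> That \<eta> + \<eta> * profile.q1 \<kappa> That \<eta>\<bar> \<le> B"
proof -
  interpret profile \<kappa> Tm Tp That by fact
  define M where "M = max 2 (max (max \<mu> (1 / \<mu>)) (max \<kappa> (1 / \<kappa>)))"
  obtain B where B: "B \<ge> M" "\<And>\<eta>. 2 / B \<le> That \<eta>" "\<And>\<eta>. That \<eta> \<le> B / 2" "\<And>\<eta>. \<bar>q \<eta>\<bar> \<le> B"
    "\<And>\<eta>. \<bar>q1 \<eta>\<bar> \<le> B" "\<And>\<eta>. \<bar>q2 \<eta>\<bar> \<le> B" "\<And>\<eta>. \<bar>q \<eta> + \<eta> * q1 \<eta>\<bar> \<le> B"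
    using profile_bounds[of M] by blast
  have b: "B \<ge> 2" "\<mu> \<le> B" "1 / \<mu> \<le> B" "\<kappa> \<le> B" "1 / \<kappa> \<le> B" using B(1) by (auto simp: M_def)
  then have "1 / B \<le> \<mu>" "1 / B \<le> \<kappa>" using mu kappa by (auto simp: field_simps)
  then show ?thesis using that[of B] b B by blast
qed

lemma temperature_gradient_estimate:
  assumes prof: "profile \<kappa> Tm Tp That"
    and B2: "B \<ge> 2" and mu: "1 / B \<le> \<mu>" "\<mu> \<le> B" and kap: "1 / B \<le> \<kappa>" "\<kappa> \<le> B"
    and Tb: "\<And>\<eta>. 2 / B \<le> That \<eta>" "\<And>\<eta>. That \<eta> \<le> B / 2"
    and qb: "\<And>\<eta>. \<bar>profile.q \<kappa> That \<eta>\<bar> \<le> B" "\<And>\<eta>. \<bar>profile.q1 \<kappa> That \<eta>\<bar> \<le> B"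
      "\<And>\<eta>. \<bar>profile.q2 \<kappa> That \<eta>\<bar> \<le> B" "\<And>\<eta>. \<bar>profile.q \<kappa> That \<eta> + \<eta> * profile.q1 \<kappa> That \<eta>\<bar> \<le> B"
    and eps: "0 < \<epsilon>" "\<epsilon> \<le> 1" "\<epsilon> \<le> e" and e_small: "4000000 * B ^ 18 * e \<le> 1"
    and sol: "global_smooth_solution \<mu> \<kappa> \<epsilon> That v u T"
    and v_near: "\<And>x t. t \<ge> 0 \<Longrightarrow> \<bar>v x t - self_similar That x t\<bar> \<le> e * \<epsilon> * time_weight t"
    and T_near: "\<And>x t. t \<ge> 0 \<Longrightarrow> \<bar>T x t - self_similar That x t\<bar> \<le> e * \<epsilon> * time_weight t"
    and u_near: "\<And>x t. t \<ge> 0 \<Longrightarrow> \<bar>u x t - u_profile \<kappa> That x t\<bar> \<le> e * time_weight t"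
    and t: "t \<ge> 0"
  shows "\<bar>dx T x t - dx (self_similar That) x t\<bar> \<le> 4000000 * B ^ 18 * e * time_weight t"
proof -
  interpret profile \<kappa> Tm Tp That by (rule prof)
  have sm: "smooth_halfplane v" "smooth_halfplane u" "smooth_halfplane T"
    and vpos: "\<And>x t. t \<ge> 0 \<Longrightarrow> v x t > 0" and sys: "low_mach_system \<mu> \<kappa> \<epsilon> v u T"
    and init: "\<And>x. v x 0 = v_profile That x 0" "\<And>x. u x 0 = u_profile \<kappa> That x 0"
      "\<And>x. T x 0 = T_profile \<kappa> \<epsilon> That x 0"
    using sol by (auto simp: global_smooth_solution_def)
  obtain vx vxx vt vxt where v:
    "\<And>x t. t \<ge> 0 \<Longrightarrow> ((\<lambda>y. v y t) has_real_derivative vx x t) (at x)"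
    "\<And>x t. t \<ge> 0 \<Longrightarrow> ((\<lambda>y. vx y t) has_real_derivative vxx x t) (at x)"
    "\<And>x t. t > 0 \<Longrightarrow> (v x has_real_derivative vt x t) (at t)"
    "\<And>x t. t > 0 \<Longrightarrow> (vx x has_real_derivative vxt x t) (at t)"
    "\<And>x t. t > 0 \<Longrightarrow> ((\<lambda>y. vt y t) has_real_derivative vxt x t) (at x)"
    "continuous_on (UNIV \<times> {0..}) (\<lambda>(x, t). v x t)"
    "continuous_on (UNIV \<times> {0..}) (\<lambda>(x, t). vx x t)"
    using smooth_halfplane_derivatives[OF sm(1)] by blast
  obtain ux uxx ut uxt where u:
    "\<And>x t. t \<ge> 0 \<Longrightarrow> ((\<lambda>y. u y t) has_real_derivative ux x t) (at x)"
    "\<And>x t. t \<ge> 0 \<Longrightarrow> ((\<lambda>y. ux y t) has_real_derivative uxx x t) (at x)"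
    "\<And>x t. t > 0 \<Longrightarrow> (u x has_real_derivative ut x t) (at t)"
    "\<And>x t. t > 0 \<Longrightarrow> (ux x has_real_derivative uxt x t) (at t)"
    "\<And>x t. t > 0 \<Longrightarrow> ((\<lambda>y. ut y t) has_real_derivative uxt x t) (at x)"
    "continuous_on (UNIV \<times> {0..}) (\<lambda>(x, t). u x t)"
    "continuous_on (UNIV \<times> {0..}) (\<lambda>(x, t). ux x t)"
    using smooth_halfplane_derivatives[OF sm(2)] by blast
  obtain Tx Txx Tt Txt where T:
    "\<And>x t. t \<ge> 0 \<Longrightarrow> ((\<lambda>y. T y t) has_real_derivative Tx x t) (at x)"
    "\<And>x t. t \<ge> 0 \<Longrightarrow> ((\<lambda>y. Tx y t) has_real_derivative Txx x t) (at x)"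
    "\<And>x t. t > 0 \<Longrightarrow> (T x has_real_derivative Tt x t) (at t)"
    "\<And>x t. t > 0 \<Longrightarrow> (Tx x has_real_derivative Txt x t) (at t)"
    "\<And>x t. t > 0 \<Longrightarrow> ((\<lambda>y. Tt y t) has_real_derivative Txt x t) (at x)"
    "continuous_on (UNIV \<times> {0..}) (\<lambda>(x, t). T x t)"
    "continuous_on (UNIV \<times> {0..}) (\<lambda>(x, t). Tx x t)"
    using smooth_halfplane_derivatives[OF sm(3)] by blast
  have eqs: "vt x t = ux x t"
    "ut x t + (Tx x t / v x t - T x t * vx x t / (v x t)\<^sup>2) / \<epsilon>\<^sup>2
        = \<mu> * (uxx x t / v x t - ux x t * vx x t / (v x t)\<^sup>2)"
    "Tt x t = \<kappa> * (Txx x t / v x t - Tx x t * vx x t / (v x t)\<^sup>2)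
        - T x t / v x t * ux x t + \<epsilon>\<^sup>2 * \<mu> * (ux x t)\<^sup>2 / v x t" if "t > 0" for x t
  proof -
    have t: "t \<ge> 0" using that by simp
    note expanded = low_mach_system_expanded[where v = v and vx = vx and u = u and ux = ux and uxx = uxx
        and T = T and Tx = Tx and Txx = Txx and vt = vt and ut = ut and Tt = Tt and t = t and x = x,
        OF sys _ that vpos[OF t] v(1)[OF t] u(1,2)[OF t] T(1,2)[OF t] v(3)[OF that] u(3)[OF that] T(3)[OF that]]
    show "vt x t = ux x t"
      "ut x t + (Tx x t / v x t - T x t * vx x t / (v x t)\<^sup>2) / \<epsilon>\<^sup>2
        = \<mu> * (uxx x t / v x t - ux x t * vx x t / (v x t)\<^sup>2)"
      "Tt x t = \<kappa> * (Txx x t / v x t - Tx x t * vx x t / (v x t)\<^sup>2)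
        - T x t / v x t * ux x t + \<epsilon>\<^sup>2 * \<mu> * (ux x t)\<^sup>2 / v x t"
      using expanded eps(1) by auto
  qed
  \<comment> \<open>The x-derivative of v_t = u_x, read as an equation for the time derivative of
    v_x by equality of the mixed derivatives.\<close>
  have vxt: "vxt x t = uxx x t" if "t > 0" for x t
  proof -
    have "((\<lambda>y. ux y t) has_real_derivative vxt x t) (at x)"
      using v(5)[OF that, of x] eqs(1)[OF that] by simp
    then show ?thesis using DERIV_unique u(2)[of t x] that by auto
  qed
  have e: "e > 0" "e \<le> 1 / B" "B ^ 3 * \<epsilon>\<^sup>2 \<le> 1"
  proof -
    show "e > 0" using eps by simp
    have Be: "B ^ n * e \<le> 1" if "n \<le> 18" for n
    proof -
      have "B ^ n * e \<le> B ^ 18 * e" using that B2 \<open>e > 0\<close> by (intro mult_right_mono power_increasing) auto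
      moreover have "B ^ 18 * e > 0" using B2 \<open>e > 0\<close> by simp
      ultimately show ?thesis using e_small by linarith
    qed
    show "e \<le> 1 / B" using Be[of 1] B2 by (simp add: field_simps)
    have "\<epsilon>\<^sup>2 \<le> e" using eps by (simp add: power2_eq_square order_trans[OF mult_left_le])
    then have "B ^ 3 * \<epsilon>\<^sup>2 \<le> B ^ 3 * e" using B2 by (intro mult_left_mono) auto
    then show "B ^ 3 * \<epsilon>\<^sup>2 \<le> 1" using Be[of 3] by simp
  qed
  have range: "1 / B \<le> y \<and> y \<le> B"
    if "t \<ge> 0" "\<bar>y - self_similar That x t\<bar> \<le> e * \<epsilon> * time_weight t" for x y t
  proof -
    note w = time_weight_pos[OF that(1)] time_weight_le_1[OF that(1)]
    have "e * \<epsilon> * time_weight t \<le> e * 1 * 1" using w eps e by (intro mult_mono) auto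
    then have 1: "\<bar>y - self_similar That x t\<bar> \<le> 1 / B" using that e by linarith
    have 2: "2 / B \<le> self_similar That x t" "self_similar That x t \<le> B / 2"
      using Tb by (auto simp: self_similar_eq)
    have "1 / B \<le> 1 / 2" using B2 by simp
    then have 3: "1 / B \<le> B / 2" using B2 by linarith
    have "2 / B = 1 / B + 1 / B" by simp
    then show ?thesis using 1 2 3 by linarith
  qed
  have wle: "c * time_weight t ^ n \<le> c * time_weight t" if "t \<ge> 0" "c \<ge> 0" "n \<ge> 1" for c t n
    using that time_weight_pos[OF that(1)] time_weight_le_1[OF that(1)] power_decreasing[of 1 n "time_weight t"]
    by (intro mult_left_mono) auto
  have B0: "B \<ge> 0" using B2 by simp
  have dxT: "dx T x t = Tx x t" using DERIV_imp_deriv[OF T(1)[OF t]] by (simp add: dx_def)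
  interpret near_profile \<mu> \<kappa> B \<epsilon> e "self_similar That" "u_profile \<kappa> That"
    "\<lambda>x t. time_weight t ^ 2 * q1 (x * time_weight t)" "\<lambda>x t. time_weight t ^ 3 * q2 (x * time_weight t)"
    "\<lambda>x t. - (time_weight t ^ 3 / 2) * (q (x * time_weight t) + x * time_weight t * q1 (x * time_weight t))"
    v vx u ux uxx ut T Tx Txx Tt
  proof
    show "0 < \<epsilon>" "\<epsilon> \<le> 1" "\<epsilon> \<le> e" "B ^ 3 * \<epsilon>\<^sup>2 \<le> 1" "4000000 * B ^ 18 * e \<le> 1" "1 \<le> B"
      "1 / B \<le> \<mu>" "\<mu> \<le> B" "1 / B \<le> \<kappa>" "\<kappa> \<le> B" using eps e e_small B2 mu kap by auto
    fix x t :: real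
    { assume t: "t \<ge> 0"
      note w = time_weight_pos[OF t]
      show "1 / B \<le> self_similar That x t \<and> self_similar That x t \<le> B"
        using range[OF t, of "self_similar That x t" x] e eps w by simp
      show "1 / B \<le> v x t \<and> v x t \<le> B" "1 / B \<le> T x t \<and> T x t \<le> B"
        using range[OF t v_near[OF t]] range[OF t T_near[OF t]] by auto
      show "\<bar>u_profile \<kappa> That x t\<bar> \<le> B * time_weight t"
        using qb(1) w by (simp add: u_profile_eq abs_mult mult.commute)
      have "\<bar>time_weight t ^ 2 * q1 (x * time_weight t)\<bar> \<le> B * time_weight t ^ 2"
        using qb(2) w by (simp add: abs_mult mult.commute)
      then show "\<bar>time_weight t ^ 2 * q1 (x * time_weight t)\<bar> \<le> B * time_weight t"
        using wle[OF t B0, of 2] by simp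
      have "\<bar>time_weight t ^ 3 * q2 (x * time_weight t)\<bar> \<le> B * time_weight t ^ 3"
        using qb(3) w by (simp add: abs_mult mult.commute)
      then show "\<bar>time_weight t ^ 3 * q2 (x * time_weight t)\<bar> \<le> B * time_weight t"
        using wle[OF t B0, of 3] by simp
      have "\<bar>- (time_weight t ^ 3 / 2) * (q (x * time_weight t) + x * time_weight t * q1 (x * time_weight t))\<bar>
          \<le> time_weight t ^ 3 * B"
        using w by (intro abs_mult_mono qb) auto
      then show "\<bar>- (time_weight t ^ 3 / 2) * (q (x * time_weight t) + x * time_weight t * q1 (x * time_weight t))\<bar>
          \<le> B * time_weight t"
        using wle[OF t B0, of 3] by (simp add: mult.commute)
      show "\<bar>v x t - self_similar That x t\<bar> \<le> e * \<epsilon> * time_weight t"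
        "\<bar>T x t - self_similar That x t\<bar> \<le> e * \<epsilon> * time_weight t"
        "\<bar>u x t - u_profile \<kappa> That x t\<bar> \<le> e * time_weight t"
        using v_near T_near u_near t by auto
      show "((\<lambda>y. self_similar That y t) has_real_derivative
          2 * self_similar That x t * u_profile \<kappa> That x t / \<kappa>) (at x)"
        using self_similar_x[of t x] by (simp add: That'_eq u_profile_eq self_similar_eq mult_ac)
    }
    show "((\<lambda>y. u_profile \<kappa> That y t) has_real_derivative time_weight t ^ 2 * q1 (x * time_weight t)) (at x)"
      "((\<lambda>y. time_weight t ^ 2 * q1 (y * time_weight t)) has_real_derivative time_weight t ^ 3 * q2 (x * time_weight t)) (at x)"
      by (rule u_profile_x)+
    show "v x 0 = self_similar That x 0" "u x 0 = u_profile \<kappa> That x 0"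
      "T x 0 = self_similar That x 0 - \<epsilon>\<^sup>2 * (u_profile \<kappa> That x 0)\<^sup>2 / 2"
      by (simp_all add: init v_profile_def T_profile_def power_mult_distrib)
  qed (use v u T eqs vxt profile_t profile_continuous in auto)
  have "dx (self_similar That) x t = hx x t"
    by (simp add: dx_self_similar hx_def That'_eq u_profile_eq self_similar_eq)
  then show ?thesis using temperature_gradient_near[OF t, of x] dxT by (simp add: \<Lambda>_def)
qed

text \<open>\<open>C1\<close> comes from bounds on the profile and the coefficients alone and is
  fixed before the small-data constants and \<eta>0; every other constant is absorbed by the
  smallness of \<epsilon>1.\<close>

theorem corollary1p3:
  fixes \<mu> \<kappa> Tm Tp \<delta> :: real and That :: "real \<Rightarrow> real"
  assumes "\<mu> > 0" and "\<kappa> > 0"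
    and "0 < Tm" and "Tm < Tp"
    and "\<delta> = \<bar>Tp - Tm\<bar>"
    and "diffusion_profile \<kappa> Tm Tp That"
  shows "\<exists>C1>0. \<forall>\<delta>0 \<epsilon>0. small_data_constants \<mu> \<kappa> Tm \<delta>0 \<epsilon>0 \<and> \<delta> \<le> \<delta>0 \<longrightarrow>
    (\<forall>\<eta>0>0. \<exists>\<epsilon>1>0. \<epsilon>1 \<le> \<epsilon>0 \<and>
      (\<forall>c>0. (\<forall>\<eta>. \<bar>\<eta>\<bar> \<le> \<eta>0 \<longrightarrow> deriv That \<eta> > c * \<delta> \<and> c * \<delta> > 0) \<longrightarrow>
        (\<forall>\<epsilon> v u T. 0 < \<epsilon> \<and> \<epsilon> \<le> \<epsilon>1 \<and> global_smooth_solution \<mu> \<kappa> \<epsilon> That v u T \<longrightarrow>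
          (\<forall>x t. t \<ge> 0 \<and> \<bar>x\<bar> \<le> \<eta>0 * sqrt (1 + t) \<longrightarrow>
            (0 < c * \<delta> / (C1 * sqrt (1 + t)) \<and>
             c * \<delta> / (C1 * sqrt (1 + t)) < 1 / C1 * dx (self_similar That) x t \<and>
             1 / C1 * dx (self_similar That) x t \<le> u x t \<and>
             u x t \<le> C1 * dx (self_similar That) x t) \<and>
            (0 < 1/2 * dx (self_similar That) x t \<and>
             1/2 * dx (self_similar That) x t \<le> dx T x t \<and>
             dx T x t \<le> 3/2 * dx (self_similar That) x t) \<and>
            (2 / (3 * C1) * dx T x t \<le> u x t \<and>
             u x t \<le> 2 * C1 * dx T x t)))))"
proof -
  have prof: "profile \<kappa> Tm Tp That" using assms by unfold_locales auto
  interpret profile \<kappa> Tm Tp That by (rule prof)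
  obtain B where B: "B \<ge> 2" and mu: "1 / B \<le> \<mu>" "\<mu> \<le> B" and kap: "1 / B \<le> \<kappa>" "\<kappa> \<le> B"
    and Tb: "\<And>\<eta>. 2 / B \<le> That \<eta>" "\<And>\<eta>. That \<eta> \<le> B / 2"
    and qb: "\<And>\<eta>. \<bar>q \<eta>\<bar> \<le> B" "\<And>\<eta>. \<bar>q1 \<eta>\<bar> \<le> B" "\<And>\<eta>. \<bar>q2 \<eta>\<bar> \<le> B" "\<And>\<eta>. \<bar>q \<eta> + \<eta> * q1 \<eta>\<bar> \<le> B"
    using profile_bounds_for_coefficients[OF prof assms(1)] by blast
  \<comment> \<open>1 / B^2 \<le> \<kappa> / (2 That) \<le> B^2 compares \<open>q\<close> with That'
    with constant C1 / 2; the remaining factor 2 absorbs the deviation of u from its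
    profile.\<close>
  define C1 where "C1 = 2 * B\<^sup>2"
  have C1: "C1 \<ge> 8" "C1 > 0" using power_mono[OF B, of 2] by (auto simp: C1_def)
  have ratio: "2 / C1 * deriv That \<eta> \<le> q \<eta> \<and> q \<eta> \<le> C1 / 2 * deriv That \<eta>" if "deriv That \<eta> > 0" for \<eta>
  proof -
    have "1 / B\<^sup>2 \<le> \<kappa> / (2 * That \<eta>)"
      using mult_mono[OF kap(1), of "1 / B" "1 / (2 * That \<eta>)"] Tb(2)[of \<eta>] That_pos[of \<eta>] B kappa
      by (simp add: field_simps power2_eq_square)
    then have "1 / B\<^sup>2 * deriv That \<eta> \<le> \<kappa> / (2 * That \<eta>) * deriv That \<eta>" using that by (intro mult_right_mono) auto
    moreover have "\<kappa> / (2 * That \<eta>) \<le> B\<^sup>2"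
      using mult_mono[OF kap(2), of "1 / (2 * That \<eta>)" B] Tb(1)[of \<eta>] That_pos[of \<eta>] B kappa
      by (simp add: field_simps power2_eq_square)
    then have "\<kappa> / (2 * That \<eta>) * deriv That \<eta> \<le> B\<^sup>2 * deriv That \<eta>" using that by (intro mult_right_mono) auto
    ultimately show ?thesis by (simp add: q_def C1_def)
  qed
  show ?thesis
  proof (rule exI[of _ C1], intro conjI allI impI)
    show "C1 > 0" by (rule C1)
    fix \<delta>0 \<epsilon>0 \<eta>0 :: real
    assume sd: "small_data_constants \<mu> \<kappa> Tm \<delta>0 \<epsilon>0 \<and> \<delta> \<le> \<delta>0" and eta0: "\<eta>0 > 0"
    then obtain C C0 where eps0: "\<epsilon>0 > 0" and C: "C > 0" and sol0:
      "\<And>Tp That \<epsilon>. Tp > 0 \<and> \<bar>Tp - Tm\<bar> \<le> \<delta>0 \<and> diffusion_profile \<kappa> Tm Tp That \<and> 0 < \<epsilon> \<and> \<epsilon> \<le> \<epsilon>0 \<Longrightarrow>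
        (\<exists>v u T. global_smooth_solution \<mu> \<kappa> \<epsilon> That v u T \<and>
           decay_estimates C C0 \<bar>Tp - Tm\<bar> \<kappa> \<epsilon> That v u T \<and>
           (\<forall>v' u' T'. global_smooth_solution \<mu> \<kappa> \<epsilon> That v' u' T' \<longrightarrow>
              (\<forall>x. \<forall>t\<ge>0. v' x t = v x t \<and> u' x t = u x t \<and> T' x t = T x t)))"
      unfolding small_data_constants_def by blast
    show "\<exists>\<epsilon>1>0. \<epsilon>1 \<le> \<epsilon>0 \<and>
      (\<forall>c>0. (\<forall>\<eta>. \<bar>\<eta>\<bar> \<le> \<eta>0 \<longrightarrow> deriv That \<eta> > c * \<delta> \<and> c * \<delta> > 0) \<longrightarrow>
        (\<forall>\<epsilon> v u T. 0 < \<epsilon> \<and> \<epsilon> \<le> \<epsilon>1 \<and> global_smooth_solution \<mu> \<kappa> \<epsilon> That v u T \<longrightarrow>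
          (\<forall>x t. t \<ge> 0 \<and> \<bar>x\<bar> \<le> \<eta>0 * sqrt (1 + t) \<longrightarrow>
            (0 < c * \<delta> / (C1 * sqrt (1 + t)) \<and>
             c * \<delta> / (C1 * sqrt (1 + t)) < 1 / C1 * dx (self_similar That) x t \<and>
             1 / C1 * dx (self_similar That) x t \<le> u x t \<and>
             u x t \<le> C1 * dx (self_similar That) x t) \<and>
            (0 < 1/2 * dx (self_similar That) x t \<and>
             1/2 * dx (self_similar That) x t \<le> dx T x t \<and>
             dx T x t \<le> 3/2 * dx (self_similar That) x t) \<and>
            (2 / (3 * C1) * dx T x t \<le> u x t \<and>
             u x t \<le> 2 * C1 * dx T x t))))"
    \<comment> \<open>\<epsilon>1 is chosen before c, so it needs a lower bound \<open>m\<close> of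
      That' independent of c. If none exists, no c satisfies its hypothesis, since c \<delta> would
      be such a bound, and any \<epsilon>1 will do.\<close>
    proof (cases "\<exists>m>0. \<forall>\<eta>. \<bar>\<eta>\<bar> \<le> \<eta>0 \<longrightarrow> deriv That \<eta> > m")
      case False
      then have "\<not> (\<forall>\<eta>. \<bar>\<eta>\<bar> \<le> \<eta>0 \<longrightarrow> deriv That \<eta> > c * \<delta> \<and> c * \<delta> > 0)" for c
        using eta0 by (metis abs_zero less_imp_le)
      then show ?thesis using eps0 by (intro exI[of _ \<epsilon>0] conjI) (simp, simp, blast)
    next
      case True
      then obtain m where m: "m > 0" "\<And>\<eta>. \<bar>\<eta>\<bar> \<le> \<eta>0 \<Longrightarrow> deriv That \<eta> > m" by blast
      \<comment> \<open>The summand 1 guarantees \<epsilon> \<le> K \<epsilon>^(1/4) however small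
        \<delta> is.\<close>
      define K where "K = C * \<delta> powr (1/4) + 1"
      have K: "K \<ge> 1" using C by (simp add: K_def)
      \<comment> \<open>For e \<le> es the bound 4000000 B^18 e on the gradient deviation is at most
        half of min 1 m: at most 1, as the local estimate demands, and at most half of
        That'.\<close>
      define es where "es = min 1 m / (8000000 * B ^ 18)"
      have B18: "B ^ 18 \<ge> 1" "B\<^sup>2 \<le> B ^ 18" using B by (auto intro: power_increasing)
      have "8000000 * B ^ 18 > 0" "min 1 m > 0" using m B18 by auto
      then have es: "es > 0" unfolding es_def by (rule divide_pos_pos[rotated])
      have es': "4000000 * B ^ 18 * es = min 1 m / 2" using B by (simp add: es_def)
      \<comment> \<open>The fourth power inverts e = K \<epsilon>^(1/4), so that e \<le> es.\<close>
      define \<epsilon>1 where "\<epsilon>1 = min \<epsilon>0 (min 1 ((es / K) ^ 4))"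
      have eps1: "\<epsilon>1 > 0" "\<epsilon>1 \<le> \<epsilon>0" using eps0 es K by (auto simp: \<epsilon>1_def)
      show ?thesis
      proof (rule exI[of _ \<epsilon>1], intro conjI eps1 allI impI)
        fix c \<epsilon> :: real and v u T :: spacetime_fun and x t :: real
        assume c: "0 < c" "\<forall>\<eta>. \<bar>\<eta>\<bar> \<le> \<eta>0 \<longrightarrow> c * \<delta> < deriv That \<eta> \<and> 0 < c * \<delta>"
          and s: "0 < \<epsilon> \<and> \<epsilon> \<le> \<epsilon>1 \<and> global_smooth_solution \<mu> \<kappa> \<epsilon> That v u T"
          and xt: "0 \<le> t \<and> \<bar>x\<bar> \<le> \<eta>0 * sqrt (1 + t)"
        then have t: "t \<ge> 0" and eps: "0 < \<epsilon>" "\<epsilon> \<le> 1" "\<epsilon> \<le> \<epsilon>0" "\<epsilon> \<le> (es / K) ^ 4"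
          and sol: "global_smooth_solution \<mu> \<kappa> \<epsilon> That v u T"
          by (auto simp: \<epsilon>1_def)
        define e where "e = K * \<epsilon> powr (1/4)"
        have ee: "\<epsilon> \<le> e"
        proof -
          have "\<epsilon> powr 1 \<le> \<epsilon> powr (1/4)" using eps by (intro powr_mono') auto
          also have "\<dots> \<le> e" using K by (simp add: e_def mult_le_cancel_right1)
          finally show ?thesis using eps by simp
        qed
        have e_es: "e \<le> es"
        proof -
          have "\<epsilon> powr (1/4) \<le> ((es / K) ^ 4) powr (1/4)" using eps by (intro powr_mono2) auto
          also have "(es / K) ^ 4 = (es / K) powr 4" using es K by (simp add: powr_realpow)
          also have "((es / K) powr 4) powr (1/4) = es / K" unfolding powr_powr using es K by simp
          finally show ?thesis using K by (simp add: e_def field_simps)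
        qed
        have e_small: "4000000 * B ^ 18 * e \<le> min 1 m / 2"
          using mult_left_mono[OF e_es, of "4000000 * B ^ 18"] B18 es' by simp
        have e0: "e > 0" using ee eps by simp
        have e_m: "e \<le> m / C1"
        proof -
          have "C1 * e \<le> 4000000 * B ^ 18 * e" unfolding C1_def using B18 e0 by (intro mult_right_mono) auto
          then have "C1 * e \<le> m" using e_small m by linarith
          then show ?thesis using C1 by (simp add: field_simps)
        qed
        have Tp0: "Tp > 0 \<and> \<bar>Tp - Tm\<bar> \<le> \<delta>0 \<and> diffusion_profile \<kappa> Tm Tp That \<and> 0 < \<epsilon> \<and> \<epsilon> \<le> \<epsilon>0"
          using assms sd eps by auto
        \<comment> \<open>The decay estimates belong to the solution furnished by the small-data
          constants; uniqueness transfers them to the given one.\<close>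
        obtain v0 u0 T0 where dec: "decay_estimates C C0 \<delta> \<kappa> \<epsilon> That v0 u0 T0"
          and uniq: "\<And>x t. t \<ge> 0 \<Longrightarrow> v x t = v0 x t \<and> u x t = u0 x t \<and> T x t = T0 x t"
          using sol0[OF Tp0] sol assms(5) by blast
        have vT: "norm (v x t - self_similar That x t, T x t - self_similar That x t) \<le> e * \<epsilon> * time_weight t"
          and un: "\<bar>u x t - u_profile \<kappa> That x t\<bar> \<le> e * time_weight t" if "t \<ge> 0" for x t
        proof -
          have w: "(1 + t) powr (-1/2) = time_weight t" "time_weight t > 0"
            using powr_minus_half[OF that] time_weight_pos[OF that] by auto
          have Ce: "C * \<delta> powr (1/4) * \<epsilon> powr (1/4) \<le> e"
            by (simp add: e_def K_def algebra_simps)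
          have "\<epsilon> powr (5/4) = \<epsilon> powr (1/4) * \<epsilon>"
            using powr_add[of \<epsilon> "1/4" 1] eps by simp
          then have "C * \<delta> powr (1/4) * \<epsilon> powr (5/4) \<le> e * \<epsilon>"
            using mult_right_mono[OF Ce, of \<epsilon>] eps by (simp add: mult.assoc)
          then have le: "C * \<delta> powr (1/4) * \<epsilon> powr (5/4) * time_weight t \<le> e * \<epsilon> * time_weight t"
            "C * \<delta> powr (1/4) * \<epsilon> powr (1/4) * time_weight t \<le> e * time_weight t"
            using Ce w by (auto intro!: mult_right_mono)
          have "norm (v0 x t - self_similar That x t, T0 x t - self_similar That x t)
              \<le> C * \<delta> powr (1/4) * \<epsilon> powr (5/4) * time_weight t"
            "\<bar>u0 x t - u_profile \<kappa> That x t\<bar> \<le> C * \<delta> powr (1/4) * \<epsilon> powr (1/4) * time_weight t"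
            using dec that unfolding decay_estimates_def w(1)[symmetric] by blast+
          then show "norm (v x t - self_similar That x t, T x t - self_similar That x t) \<le> e * \<epsilon> * time_weight t"
            "\<bar>u x t - u_profile \<kappa> That x t\<bar> \<le> e * time_weight t"
            using le uniq[OF that, of x] by auto
        qed
        have vn: "\<bar>v x t - self_similar That x t\<bar> \<le> e * \<epsilon> * time_weight t"
          and Tn: "\<bar>T x t - self_similar That x t\<bar> \<le> e * \<epsilon> * time_weight t" if "t \<ge> 0" for x t
          using vT[OF that, of x] norm_fst_le[of "v x t - self_similar That x t" "T x t - self_similar That x t"]
            norm_snd_le[of "T x t - self_similar That x t" "v x t - self_similar That x t"] by auto
        define w where "w = time_weight t"
        have w: "w > 0" using time_weight_pos[OF t] by (simp add: w_def)
        define H where "H = deriv That (x * w)"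
        have xw: "\<bar>x * w\<bar> \<le> \<eta>0"
          using xt t by (simp add: w_def time_weight_def field_simps)
        have H: "H > m" "H > c * \<delta>" "c * \<delta> > 0" using m(2)[OF xw] c(2) xw by (auto simp: H_def)
        have dxh: "dx (self_similar That) x t = w * H" by (simp add: dx_self_similar w_def H_def)
        have e1: "4000000 * B ^ 18 * e \<le> 1" using e_small by linarith
        have "\<bar>dx T x t - w * H\<bar> \<le> 4000000 * B ^ 18 * e * w"
          using temperature_gradient_estimate[OF prof B mu kap Tb qb eps(1,2) ee e1 sol vn Tn un t, of x]
          by (simp add: dxh w_def)
        also have "\<dots> \<le> H / 2 * w" using e_small H(1) w by (intro mult_right_mono) auto
        also have "\<dots> = 1/2 * (w * H)" by simp
        finally have Tx: "1/2 * (w * H) \<le> dx T x t" "dx T x t \<le> 3/2 * (w * H)" by linarith+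
        have uw: "\<bar>u x t - w * q (x * w)\<bar> \<le> e * w"
          using un[OF t, of x] by (simp add: u_profile_eq w_def)
        have eH: "e * w \<le> 1 / C1 * (w * H)"
        proof -
          have "e \<le> H / C1" using e_m H(1) C1 by (simp add: field_simps)
          from mult_right_mono[OF this, of w] w show ?thesis by (simp add: mult.commute)
        qed
        have H0: "H > 0" using H by linarith
        have "w * (2 / C1 * H) \<le> w * q (x * w)" "w * q (x * w) \<le> w * (C1 / 2 * H)"
          using ratio[of "x * w"] H0 w unfolding H_def by (intro mult_left_mono; simp)+
        then have qq: "2 * (1 / C1 * (w * H)) \<le> w * q (x * w)" "w * q (x * w) \<le> C1 * (w * H) / 2"
          by (simp_all add: mult_ac)
        have wH: "w * H > 0" using w H0 by simp
        have cw: "1 / C1 * (w * H) \<le> C1 * (w * H) / 2"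
        proof -
          have "1 / C1 \<le> 1" using C1 by simp
          then have "1 / C1 \<le> C1 / 2" using C1 by linarith
          from mult_right_mono[OF this, of "w * H"] wH show ?thesis by simp
        qed
        have ub: "1 / C1 * (w * H) \<le> u x t" "u x t \<le> C1 * (w * H)"
        proof -
          have *: "b \<le> y \<and> y \<le> b'" if "\<bar>y - a\<bar> \<le> r" "r \<le> b" "2 * b \<le> a" "a \<le> b' / 2" "b \<le> b' / 2"
            for y a r b b' :: real
            using that by linarith
          show "1 / C1 * (w * H) \<le> u x t" "u x t \<le> C1 * (w * H)"
            using *[OF uw eH qq cw] by auto
        qed
        have "c * \<delta> / (C1 * sqrt (1 + t)) = 1 / C1 * (w * (c * \<delta>))" by (simp add: w_def time_weight_def)
        moreover have "w * (c * \<delta>) < w * H" using H w by simp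
        moreover have "0 < w * (c * \<delta>)" using H w by simp
        ultimately have l1: "0 < c * \<delta> / (C1 * sqrt (1 + t))" "c * \<delta> / (C1 * sqrt (1 + t)) < 1 / C1 * (w * H)"
          using C1 by (auto simp: divide_strict_right_mono)
        have "2 / (3 * C1) * dx T x t \<le> 2 / (3 * C1) * (3/2 * (w * H))" using Tx C1 by (intro mult_left_mono) auto
        also have "\<dots> = 1 / C1 * (w * H)" by simp
        finally have l2: "2 / (3 * C1) * dx T x t \<le> u x t" using ub(1) by linarith
        have "C1 * (w * H) \<le> C1 * (2 * dx T x t)" using Tx C1 by (intro mult_left_mono) auto
        then have l3: "u x t \<le> 2 * C1 * dx T x t" using ub(2) by simp
        show "0 < c * \<delta> / (C1 * sqrt (1 + t))"
          "c * \<delta> / (C1 * sqrt (1 + t)) < 1 / C1 * dx (self_similar That) x t"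
          "1 / C1 * dx (self_similar That) x t \<le> u x t"
          "u x t \<le> C1 * dx (self_similar That) x t"
          "0 < 1/2 * dx (self_similar That) x t"
          "1/2 * dx (self_similar That) x t \<le> dx T x t"
          "dx T x t \<le> 3/2 * dx (self_similar That) x t"
          "2 / (3 * C1) * dx T x t \<le> u x t"
          "u x t \<le> 2 * C1 * dx T x t"
          unfolding dxh using l1 l2 l3 ub Tx wH by auto
      qed
    qed
  qed
qed

end
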